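(* Let $(X,\mathcal{B},\mu,T)$ be a m.d.s. Then the following are equivalent: (1) $(X,\mathcal{B},\mu,T)$ is $\mathcal{F}_{\mathrm{pubd}}$-independent; (2) $(X,\mathcal{B},\mu,T)$ is $\mathcal{F}_{\mathrm{pubd}}$-independent of order $2$; (3) $(X,\mathcal{B},\mu,T)$ has completely positive entropy.
   Context: $\mathbb{Z}_+=\{0,1,2,\dots\}$, $\mathbb{N}=\{1,2,\dots\}$. A m.d.s. $(X,\mathcal{B},\mu,T)$ consists of a Lebesgue space $(X,\mathcal{B},\mu)$ (i.e. $\mathcal{B}$ is the Borel $\sigma$-algebra of some Polish topology on $X$ and $\mu$ is a probability measure on $\mathcal{B}$) and a measurable map $T:X\to X$ with $\mu(T^{-1}B)=\mu(B)$ for all $B\in\mathcal{B}$ ($T$ need not be invertible). A set $F\subseteq\mathbb{Z}_+$ is an independence set for a tuple $(A_1,\dots,A_k)$ of sets in $\mathcal{B}$ if for every nonempty finite $J\subseteq F$ and every $s\in\{1,\dots,k\}^J$ one has $\mu(\bigcap_{j\in J}T^{-j}A_{s(j)})>0$. $\mathrm{Ind}(A_1,\dots,A_k)$ denotes the collection of all such independence sets. For an upward-hereditary collection $\mathcal{F}$ of subsets of $\mathbb{Z}_+$ and $k\in\mathbb{N}$, the m.d.s. is $\mathcal{F}$-independent of order $k$ if $\mathrm{Ind}(A_1,\dots,A_k)\cap\mathcal{F}\neq\emptyset$ for all $A_1,\dots,A_k\in\mathcal{B}$ of positive measure; it is $\mathcal{F}$-independent if it is so of order $k$ for every $k\in\mathbb{N}$.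 The upper Banach density of $F\subseteq\mathbb{Z}_+$ is $BD^*(F)=\limsup_{|I|\to+\infty}\frac{|F\cap I|}{|I|}$, with $I$ ranging over nonempty finite intervals of $\mathbb{Z}_+$; $\mathcal{F}_{\mathrm{pubd}}$ is the family of sets $F$ with $BD^*(F)>0$. The m.d.s. has completely positive entropy if $h_\mu(T,\alpha)>0$ for every countable measurable partition $\alpha$ of $X$ with $0<H(\alpha)<\infty$, where $H(\alpha)$ is the Shannon entropy of $\alpha$ and $h_\mu(T,\alpha)$ is the measure-theoretic entropy of $T$ with respect to $\alpha$. *)

theory Defs
  imports "HOL-Probability.Probability"
begin

section \<open>Measurable dynamical systems\<close>

definition polish_topology :: "'a topology \<Rightarrow> bool" where
  "polish_topology \<tau> \<longleftrightarrow> completely_metrizable_space \<tau> \<and> second_countable \<tau>"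

text \<open>The Polish topology is not part of the structure: only its Borel sets are.\<close>

locale lebesgue_space = prob_space M for M :: "'a measure" +
  assumes borel_of_polish:
    "\<exists>\<tau>. polish_topology \<tau> \<and> topspace \<tau> = space M \<and>
         sets M = sigma_sets (space M) {U. openin \<tau> U}"

locale mds = lebesgue_space M for M :: "'a measure" +
  fixes T :: "'a \<Rightarrow> 'a"
  assumes measurable_T: "T \<in> measurable M M"
    and preserving_T: "B \<in> sets M \<Longrightarrow> measure M (T -` B \<inter> space M) = measure M B"

text \<open>\<open>T\<close> is only meaningful on \<open>space M\<close>, so preimages are cut down to \<open>space M\<close>.\<close>

definition preim :: "'a measure \<Rightarrow> ('a \<Rightarrow> 'a) \<Rightarrow> nat \<Rightarrow> 'a set \<Rightarrow> 'a set" where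
  "preim M T j A = (T ^^ j) -` A \<inter> space M"


section \<open>Independence sets\<close>

text \<open>A tuple \<open>(A\<^sub>1, \<dots>, A\<^sub>k)\<close> is a function on \<open>nat\<close>
  of which only the values on \<open>{1..k}\<close> matter.\<close>

definition Ind :: "'a measure \<Rightarrow> ('a \<Rightarrow> 'a) \<Rightarrow> nat \<Rightarrow> (nat \<Rightarrow> 'a set) \<Rightarrow> nat set set" where
  "Ind M T k A =
     {F. \<forall>J s. J \<subseteq> F \<and> finite J \<and> J \<noteq> {} \<and> s \<in> J \<rightarrow>\<^sub>E {1..k} \<longrightarrow>
           measure M (\<Inter>j\<in>J. preim M T j (A (s j))) > 0}"

definition F_independent_of_order ::
    "'a measure \<Rightarrow> ('a \<Rightarrow> 'a) \<Rightarrow> nat set set \<Rightarrow> nat \<Rightarrow> bool" where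
  "F_independent_of_order M T \<F> k \<longleftrightarrow>
     (\<forall>A. (\<forall>i\<in>{1..k}. A i \<in> sets M \<and> measure M (A i) > 0) \<longrightarrow> Ind M T k A \<inter> \<F> \<noteq> {})"

definition F_independent :: "'a measure \<Rightarrow> ('a \<Rightarrow> 'a) \<Rightarrow> nat set set \<Rightarrow> bool" where
  "F_independent M T \<F> \<longleftrightarrow> (\<forall>k\<ge>1. F_independent_of_order M T \<F> k)"


section \<open>Upper Banach density\<close>

definition intervals :: "nat set set" where
  "intervals = {{a..b} | a b. a \<le> b}"

text \<open>The filter of nonempty finite intervals \<open>I\<close> with \<open>card I\<close> tending to infinity.\<close>

definition long_intervals :: "nat set filter" where
  "long_intervals = filtercomap card at_top \<sqinter> principal intervals"

definition upper_banach_density :: "nat set \<Rightarrow> ereal" where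
  "upper_banach_density F =
     Limsup long_intervals (\<lambda>I. ereal (real (card (F \<inter> I)) / real (card I)))"

definition F_pubd :: "nat set set" where
  "F_pubd = {F. upper_banach_density F > 0}"

lemma eventually_long_intervals:
  "eventually P long_intervals \<longleftrightarrow> (\<exists>N. \<forall>a b. a \<le> b \<and> N \<le> card {a..b} \<longrightarrow> P {a..b})"
proof
  assume "eventually P long_intervals"
  then obtain N where "\<And>I. N \<le> card I \<Longrightarrow> I \<in> intervals \<Longrightarrow> P I"
    unfolding long_intervals_def eventually_inf_principal eventually_filtercomap
      eventually_at_top_linorder by blast
  then show "\<exists>N. \<forall>a b. a \<le> b \<and> N \<le> card {a..b} \<longrightarrow> P {a..b}"
    unfolding intervals_def by blast
next
  assume "\<exists>N. \<forall>a b. a \<le> b \<and> N \<le> card {a..b} \<longrightarrow> P {a..b}"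
  then obtain N where "\<And>I. N \<le> card I \<Longrightarrow> I \<in> intervals \<Longrightarrow> P I"
    unfolding intervals_def by blast
  then show "eventually P long_intervals"
    unfolding long_intervals_def eventually_inf_principal eventually_filtercomap
    by (intro exI[of _ "\<lambda>n. N \<le> n"]) (auto intro: eventually_ge_at_top)
qed

lemma long_intervals_neq_bot: "long_intervals \<noteq> bot"
proof
  assume "long_intervals = bot"
  then have "eventually (\<lambda>_. False) long_intervals" by simp
  then obtain N where N: "\<And>a b :: nat. a \<le> b \<Longrightarrow> N \<le> card {a..b} \<Longrightarrow> False"
    unfolding eventually_long_intervals by blast
  show False using N[of 0 N] by simp
qed

lemma F_pubd_hereditary:
  assumes "F \<in> F_pubd" "F \<subseteq> G"
  shows "G \<in> F_pubd"
proof -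
  have "upper_banach_density F \<le> upper_banach_density G"
    unfolding upper_banach_density_def
  proof (rule Limsup_mono)
    have "card (F \<inter> {a..b}) \<le> card (G \<inter> {a..b})" for a b
      using assms(2) by (intro card_mono) auto
    then show "\<forall>\<^sub>F I in long_intervals. ereal (real (card (F \<inter> I)) / real (card I))
                 \<le> ereal (real (card (G \<inter> I)) / real (card I))"
      unfolding eventually_long_intervals by (auto intro!: divide_right_mono)
  qed
  with assms(1) show ?thesis by (auto simp: F_pubd_def)
qed


section \<open>Entropy\<close>

definition measurable_partition :: "'a measure \<Rightarrow> 'a set set \<Rightarrow> bool" where
  "measurable_partition M \<alpha> \<longleftrightarrow> partition_on (space M) \<alpha> \<and> countable \<alpha> \<and> \<alpha> \<subseteq> sets M"

text \<open>Null blocks contribute \<open>0\<close> because \<open>ln 0 = 0\<close>.\<close>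

definition partition_entropy :: "'a measure \<Rightarrow> 'a set set \<Rightarrow> ennreal" where
  "partition_entropy M \<alpha> = (\<Sum>\<^sub>\<infinity>A\<in>\<alpha>. ennreal (- (measure M A * ln (measure M A))))"

definition preim_partition :: "'a measure \<Rightarrow> ('a \<Rightarrow> 'a) \<Rightarrow> nat \<Rightarrow> 'a set set \<Rightarrow> 'a set set" where
  "preim_partition M T j \<alpha> = preim M T j ` \<alpha> - {{}}"

text \<open>The limit exists whenever \<open>\<alpha>\<close> has finite entropy (subadditivity); its terms
  are the normalised entropies of the joins of the first \<open>n\<close> preimages of \<open>\<alpha>\<close>.\<close>

definition entropy_rate :: "'a measure \<Rightarrow> ('a \<Rightarrow> 'a) \<Rightarrow> 'a set set \<Rightarrow> ennreal" where
  "entropy_rate M T \<alpha> =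
     lim (\<lambda>n. partition_entropy M
                (common_refinement ((\<lambda>j. preim_partition M T j \<alpha>) ` {..<n})) / of_nat n)"

definition completely_positive_entropy :: "'a measure \<Rightarrow> ('a \<Rightarrow> 'a) \<Rightarrow> bool" where
  "completely_positive_entropy M T \<longleftrightarrow>
     (\<forall>\<alpha>. measurable_partition M \<alpha> \<and>
           0 < partition_entropy M \<alpha> \<and> partition_entropy M \<alpha> < \<infinity> \<longrightarrow>
           entropy_rate M T \<alpha> > 0)"

end

theory Submission
  imports Defs
begin

text \<open>The implication from order \<open>2\<close> to completely positive entropy is a counting
  argument. Suppose that a partition \<open>\<alpha>\<close> has entropy rate \<open>0\<close>, and let \<open>A\<close> be a block with
  \<open>0 < \<mu>(A) < 1\<close>. For every \<open>\<epsilon> > 0\<close> there are lengths \<open>n\<close> at which all points outside a set of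
  small measure carry an \<open>\<alpha>\<close>-name of length \<open>n\<close> with probability at least \<open>exp (- \<epsilon> n)\<close>
  (\<open>mostly_heavy_words\<close>); there are at most \<open>exp (\<epsilon> n)\<close> such names. Let \<open>E\<close> be the set of points that
  are typical in this sense along a sequence of lengths with \<open>\<epsilon>\<close> tending to \<open>0\<close>, so large that
  \<open>A \<inter> E\<close> and \<open>E - A\<close> have positive measure. If \<open>F\<close> is an independence set for this
  pair, and \<open>J\<close> is the part of \<open>F\<close> in a window of length \<open>n\<close>, then all \<open>2 ^ card J\<close> patterns on
  \<open>J\<close> occur, and each of them can be read off the \<open>n\<close>-name at time \<open>Min J\<close>. Hence
  \<open>card J \<le> \<epsilon> n / ln 2\<close> (\<open>card_independent_window\<close>), and \<open>F\<close> has upper Banach density \<open>0\<close>.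

  For the implication from completely positive entropy to independence of every order \<open>k\<close>, fix
  \<open>A\<^sub>1, \<dots>, A\<^sub>k\<close> of positive measure and let \<open>\<F>\<^sub>N\<close> be the \<open>\<sigma>\<close>-algebra generated by the sets
  \<open>T\<^sup>-\<^sup>j A\<^sub>i\<close> with \<open>j \<ge> N\<close>. The proof has four steps.

  \<^item> The tail \<open>\<Inter>\<^sub>N \<F>\<^sub>N\<close> is trivial (\<open>tail_trivial\<close>). Let the letter of a point record
    which \<open>A\<^sub>i\<close> contain it, and let \<open>h\<close> be the entropy rate of the letters. A tail event \<open>D\<close> and its first
    \<open>N\<close> preimages are decided by the letters after time \<open>N\<close>. So the \<open>D\<close>-name of length \<open>N\<close>
    tells nothing about the first \<open>N\<close> letters beyond what the later letters tell, and the entropy of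
    the pair is at least that of the \<open>D\<close>-name plus \<open>N h\<close>. On the other hand, slightly
    more than \<open>N\<close> letters nearly determine the pair, so its entropy is \<open>N h + o(N)\<close>. Hence the
    partition into \<open>D\<close> and its complement has entropy rate \<open>0\<close> (\<open>tail_event_zero_entropy\<close>).

  \<^item> Let the hull of \<open>E\<close> at time \<open>N\<close> be the set where the conditional probability of \<open>E\<close> given
    \<open>\<F>\<^sub>N\<close> is positive. Hulls increase with \<open>N\<close>, and their union is a tail event that contains
    \<open>E\<close>. Hence the hulls of an event of positive measure tend to full measure (\<open>hull_tendsto_1\<close>).

  \<^item> By the second step there are a gap \<open>m\<close> and a \<open>p > 0\<close> such that, on a set of positive
    measure, every \<open>A\<^sub>i\<close> has conditional probability at least \<open>p\<close> given \<open>\<F>\<^sub>m\<close>. A probabilistic form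
    of the Sauer--Shelah lemma (\<open>exists_shattered\<close>) turns this into sets of at least \<open>c n - 1\<close> times among
    \<open>0, m, \<dots>, (n - 1) m\<close> on which all \<open>k\<close>-ary patterns occur, and it does so inside every
    sufficiently large event of \<open>\<F>\<^sub>0\<close> (\<open>exists_large_shattered\<close>).

  \<^item> A finite independence set \<open>J\<close> is enlarged by applying the third step inside the
    intersection of the hulls, at a late time \<open>N\<close>, of the finitely many pattern sets of \<open>J\<close>
    (\<open>extend_shattered\<close>). Iterating this gives an independence set that meets arbitrarily long
    intervals in a positive proportion.\<close>

section \<open>Entropy of discrete variables\<close>

text \<open>The values will be blocks of a partition or lists of such blocks, so the codomain need not be
  countable and carries no natural \<open>\<sigma>\<close>-algebra.\<close>

definition discrete_var :: "'a measure \<Rightarrow> ('a \<Rightarrow> 'b) \<Rightarrow> bool" where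
  "discrete_var M f \<longleftrightarrow> countable (f ` space M) \<and> (\<forall>b. f -` {b} \<inter> space M \<in> sets M)"

definition atom_prob :: "'a measure \<Rightarrow> ('a \<Rightarrow> 'b) \<Rightarrow> 'a \<Rightarrow> real" where
  "atom_prob M f x = measure M (f -` {f x} \<inter> space M)"

text \<open>Shannon entropy, written as the mean of the information function rather than as a sum
  over the values (\<open>ent_eq_sum\<close>): inequalities between entropies can then be checked pointwise.\<close>

definition ent :: "'a measure \<Rightarrow> ('a \<Rightarrow> 'b) \<Rightarrow> ennreal" where
  "ent M f = (\<integral>\<^sup>+x. ennreal (- ln (atom_prob M f x)) \<partial>M)"

lemma discrete_varD:
  assumes "discrete_var M f" shows "countable (f ` space M)" "f -` {b} \<inter> space M \<in> sets M"
  using assms by (auto simp: discrete_var_def)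

lemma discrete_var_vimage:
  assumes "discrete_var M f" shows "f -` S \<inter> space M \<in> sets M"
proof -
  have "f -` S \<inter> space M = (\<Union>b\<in>S \<inter> f ` space M. f -` {b} \<inter> space M)" by auto
  also have "\<dots> \<in> sets M"
    using assms by (intro sets.countable_UN') (auto simp: discrete_var_def)
  finally show ?thesis .
qed

lemma discrete_var_measurable:
  assumes "discrete_var M f" shows "f \<in> M \<rightarrow>\<^sub>M count_space UNIV"
  using discrete_var_vimage[OF assms] by (auto simp: measurable_def)

lemma discrete_var_comp:
  assumes "discrete_var M f" shows "discrete_var M (\<lambda>x. \<phi> (f x))"
  unfolding discrete_var_def
proof (intro conjI allI)
  have "(\<lambda>x. \<phi> (f x)) ` space M = \<phi> ` f ` space M" by auto
  then show "countable ((\<lambda>x. \<phi> (f x)) ` space M)" using assms by (simp add: discrete_var_def)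
  fix b
  have "(\<lambda>x. \<phi> (f x)) -` {b} = f -` (\<phi> -` {b})" by auto
  then show "(\<lambda>x. \<phi> (f x)) -` {b} \<inter> space M \<in> sets M"
    using discrete_var_vimage[OF assms] by metis
qed

lemma discrete_var_Pair:
  assumes "discrete_var M f" "discrete_var M g"
  shows "discrete_var M (\<lambda>x. (f x, g x))"
  unfolding discrete_var_def
proof (intro conjI allI)
  have "(\<lambda>x. (f x, g x)) ` space M \<subseteq> f ` space M \<times> g ` space M" by auto
  then show "countable ((\<lambda>x. (f x, g x)) ` space M)"
    using assms by (meson countable_SIGMA countable_subset discrete_varD(1))
  fix b
  have eq: "(\<lambda>x. (f x, g x)) -` {b} \<inter> space M = (f -` {fst b} \<inter> space M) \<inter> (g -` {snd b} \<inter> space M)"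
    by auto
  show "(\<lambda>x. (f x, g x)) -` {b} \<inter> space M \<in> sets M"
    unfolding eq by (intro sets.Int discrete_varD(2) assms)
qed

context prob_space begin

lemma nn_integral_discrete_var:
  assumes "discrete_var M f"
  shows "(\<integral>\<^sup>+x. \<psi> (f x) \<partial>M) =
    (\<integral>\<^sup>+b. \<psi> b * ennreal (measure M (f -` {b} \<inter> space M)) \<partial>count_space UNIV)"
proof -
  let ?C = "count_space (f ` space M)"
  have f: "f \<in> M \<rightarrow>\<^sub>M ?C"
    using discrete_var_vimage[OF assms] by (auto simp: measurable_def)
  have d: "distr M ?C f = density ?C (\<lambda>b. ennreal (measure M (f -` {b} \<inter> space M)))"
  proof (rule measure_eqI_countable[where A="f ` space M"])
    fix a assume a: "a \<in> f ` space M"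
    have "emeasure (distr M ?C f) {a} = measure M (f -` {a} \<inter> space M)"
      using a f by (simp add: emeasure_distr emeasure_eq_measure)
    also have "\<dots> = emeasure (density ?C (\<lambda>b. ennreal (measure M (f -` {b} \<inter> space M)))) {a}"
      using a by (simp add: emeasure_density nn_integral_count_space_indicator[symmetric] nn_integral_indicator_singleton)
    finally show "emeasure (distr M ?C f) {a} =
      emeasure (density ?C (\<lambda>b. ennreal (measure M (f -` {b} \<inter> space M)))) {a}" .
  qed (use assms in \<open>auto simp: discrete_var_def\<close>)
  have "(\<integral>\<^sup>+x. \<psi> (f x) \<partial>M) = (\<integral>\<^sup>+b. \<psi> b \<partial>distr M ?C f)"
    using f by (simp add: nn_integral_distr)
  also have "\<dots> = (\<integral>\<^sup>+b. \<psi> b * ennreal (measure M (f -` {b} \<inter> space M)) \<partial>?C)"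
    unfolding d by (subst nn_integral_density) (auto simp: mult.commute)
  also have "\<dots> = (\<integral>\<^sup>+b. \<psi> b * ennreal (measure M (f -` {b} \<inter> space M)) \<partial>count_space UNIV)"
  proof (rule nn_integral_count_space_eq)
    fix b assume "b \<in> UNIV - f ` space M"
    then have "f -` {b} \<inter> space M = {}" by auto
    then show "\<psi> b * ennreal (measure M (f -` {b} \<inter> space M)) = 0" by simp
  qed auto
  finally show ?thesis .
qed

lemma atom_prob_nonneg: "0 \<le> atom_prob M f x" "atom_prob M f x \<le> 1"
  by (auto simp: atom_prob_def)

lemma atom_prob_measurable:
  assumes "discrete_var M f" shows "atom_prob M f \<in> borel_measurable M"
proof -
  have "atom_prob M f = (\<lambda>b. measure M (f -` {b} \<inter> space M)) \<circ> f"
    by (auto simp: atom_prob_def)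
  then show ?thesis
    using measurable_comp[OF discrete_var_measurable[OF assms]] by (metis measurable_count_space borel_measurable_count_space)
qed

lemma atom_prob_pos:
  assumes "discrete_var M f" shows "AE x in M. 0 < atom_prob M f x"
proof -
  let ?N = "\<Union>b\<in>{b\<in>f ` space M. measure M (f -` {b} \<inter> space M) = 0}. f -` {b} \<inter> space M"
  have "?N \<in> null_sets M"
    using assms by (intro null_sets_UN') (auto simp: discrete_var_def emeasure_eq_measure null_sets_def)
  then show ?thesis
  proof (rule AE_I')
    show "{x \<in> space M. \<not> 0 < atom_prob M f x} \<subseteq> ?N"
      by (auto simp: atom_prob_def zero_less_measure_iff not_less measure_le_0_iff)
  qed
qed

lemma sum_marginal:
  assumes f: "discrete_var M f" and A: "A \<in> sets M"
  shows "(\<integral>\<^sup>+b. ennreal (measure M (f -` {b} \<inter> A)) \<partial>count_space UNIV) = ennreal (measure M A)"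
proof -
  have sub: "A \<subseteq> space M" using A by (rule sets.sets_into_space)
  have m: "f -` {b} \<inter> A \<in> sets M" for b
  proof -
    have "f -` {b} \<inter> A = (f -` {b} \<inter> space M) \<inter> A" using sub by auto
    then show ?thesis using discrete_varD(2)[OF f] A by (metis sets.Int)
  qed
  have "emeasure M (\<Union>b\<in>f ` space M. f -` {b} \<inter> A)
      = (\<integral>\<^sup>+b. emeasure M (f -` {b} \<inter> A) \<partial>count_space (f ` space M))"
    using f m by (intro emeasure_UN_countable) (auto simp: discrete_var_def disjoint_family_on_def)
  moreover have "(\<Union>b\<in>f ` space M. f -` {b} \<inter> A) = A" using sub by auto
  moreover have "(\<integral>\<^sup>+b. emeasure M (f -` {b} \<inter> A) \<partial>count_space (f ` space M))
      = (\<integral>\<^sup>+b. emeasure M (f -` {b} \<inter> A) \<partial>count_space UNIV)"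
  proof (rule nn_integral_count_space_eq)
    fix b assume "b \<in> UNIV - f ` space M"
    then have "f -` {b} \<inter> A = {}" using sub by auto
    then show "emeasure M (f -` {b} \<inter> A) = 0" by simp
  qed auto
  ultimately show ?thesis by (simp add: emeasure_eq_measure)
qed

text \<open>If \<open>f\<close> determines \<open>g\<close>, the atoms of \<open>f\<close> are smaller, and the information of \<open>f\<close> is larger at
  almost every point.\<close>

lemma ent_mono:
  assumes f: "discrete_var M f" and g: "discrete_var M g"
    and det: "\<And>x y. x \<in> space M \<Longrightarrow> y \<in> space M \<Longrightarrow> f x = f y \<Longrightarrow> g x = g y"
  shows "ent M g \<le> ent M f"
  unfolding ent_def
proof (rule nn_integral_mono_AE)
  show "AE x in M. ennreal (- ln (atom_prob M g x)) \<le> ennreal (- ln (atom_prob M f x))"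
    using atom_prob_pos[OF f]
  proof (rule AE_mp, intro AE_I2 impI)
    fix x assume x: "x \<in> space M" and pos: "0 < atom_prob M f x"
    have "atom_prob M f x \<le> atom_prob M g x"
      unfolding atom_prob_def
    proof (rule finite_measure_mono)
      show "f -` {f x} \<inter> space M \<subseteq> g -` {g x} \<inter> space M" using det[OF _ x] by auto
    qed (rule discrete_varD(2)[OF g])
    then show "ennreal (- ln (atom_prob M g x)) \<le> ennreal (- ln (atom_prob M f x))"
      using pos by (intro ennreal_leI) simp
  qed
qed

lemma ent_cong:
  assumes "discrete_var M f" "discrete_var M g"
    and "\<And>x y. x \<in> space M \<Longrightarrow> y \<in> space M \<Longrightarrow> f x = f y \<longleftrightarrow> g x = g y"
  shows "ent M g = ent M f"
  using assms by (intro antisym ent_mono) blast+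

text \<open>The inequality \<open>ln r \<le> r - 1\<close> for \<open>r = b c / (d a)\<close>, arranged so that both sides
  are sums of nonnegative terms. It can then be integrated even if entropies are infinite.\<close>

lemma Gibbs_pointwise:
  fixes a b c d :: real
  assumes "0 < a" "0 < b" "0 < c" "0 < d" "a \<le> 1" "b \<le> 1" "c \<le> 1" "d \<le> 1"
  shows "ennreal (- ln a) + ennreal (- ln d) + 1 \<le>
    ennreal (- ln b) + ennreal (- ln c) + ennreal (b * c / (d * a))"
proof -
  have "ln (b * c / (d * a)) \<le> b * c / (d * a) - 1" using assms by (intro ln_le_minus_one) simp
  then have "- ln a + - ln d + 1 \<le> - ln b + - ln c + b * c / (d * a)"
    using assms by (simp add: ln_mult ln_div)
  then have "ennreal (- ln a + - ln d + 1) \<le> ennreal (- ln b + - ln c + b * c / (d * a))"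
    by (rule ennreal_leI)
  moreover have plus: "ennreal (x + y + z) = ennreal x + ennreal y + ennreal z"
    if "0 \<le> x" "0 \<le> y" "0 \<le> z" for x y z :: real using that by simp
  ultimately show ?thesis
    using assms plus[of "- ln a" "- ln d" 1] plus[of "- ln b" "- ln c" "b * c / (d * a)"] by simp
qed

text \<open>Submodularity of entropy, that is, nonnegativity of conditional mutual information. Integrating
  \<open>Gibbs_pointwise\<close> leaves the sum of \<open>p(i,k) p(j,k) / p(k)\<close> on the right; it is at most \<open>1\<close> and is
  compensated by the \<open>1\<close> on the left.\<close>

lemma ent_submodular:
  assumes f: "discrete_var M f" and g: "discrete_var M g" and h: "discrete_var M h"
  shows "ent M (\<lambda>x. (f x, g x, h x)) + ent M h \<le> ent M (\<lambda>x. (f x, h x)) + ent M (\<lambda>x. (g x, h x))"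
proof -
  note fh = discrete_var_Pair[OF f h] and gh = discrete_var_Pair[OF g h]
  note fgh = discrete_var_Pair[OF f gh]
  let ?a = "atom_prob M (\<lambda>x. (f x, g x, h x))" and ?b = "atom_prob M (\<lambda>x. (f x, h x))"
    and ?c = "atom_prob M (\<lambda>x. (g x, h x))" and ?d = "atom_prob M h"
  note [measurable] = fh[THEN atom_prob_measurable] gh[THEN atom_prob_measurable]
    fgh[THEN atom_prob_measurable] h[THEN atom_prob_measurable]
  define p where "p = (\<lambda>i j k. measure M ((\<lambda>x. (f x, g x, h x)) -` {(i, j, k)} \<inter> space M))"
  define q where "q = (\<lambda>i k. measure M ((\<lambda>x. (f x, h x)) -` {(i, k)} \<inter> space M))"
  define r where "r = (\<lambda>j k. measure M ((\<lambda>x. (g x, h x)) -` {(j, k)} \<inter> space M))"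
  define s where "s = (\<lambda>k. measure M (h -` {k} \<inter> space M))"
  have nn: "0 \<le> p i j k" "0 \<le> q i k" "0 \<le> r j k" "0 \<le> s k" for i j k
    by (simp_all add: p_def q_def r_def s_def)
  have q_sum: "(\<integral>\<^sup>+i. ennreal (q i k) \<partial>count_space UNIV) = ennreal (s k)" for k
  proof -
    have "f -` {i} \<inter> (h -` {k} \<inter> space M) = (\<lambda>x. (f x, h x)) -` {(i, k)} \<inter> space M" for i by auto
    then show ?thesis
      using sum_marginal[OF f discrete_varD(2)[OF h, of k]] by (simp add: q_def s_def)
  qed
  have ratio: "(\<integral>\<^sup>+x. ennreal (?b x * ?c x / (?d x * ?a x)) \<partial>M) \<le> 1"
  proof -
    have "(\<integral>\<^sup>+x. ennreal (?b x * ?c x / (?d x * ?a x)) \<partial>M)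
      = (\<integral>\<^sup>+x. (\<lambda>(i, j, k). ennreal (q i k * r j k / (s k * p i j k))) (f x, g x, h x) \<partial>M)"
      by (simp add: atom_prob_def p_def q_def r_def s_def)
    also have "\<dots> = (\<integral>\<^sup>+t. (\<lambda>(i, j, k). ennreal (q i k * r j k / (s k * p i j k))) t *
        ennreal (measure M ((\<lambda>x. (f x, g x, h x)) -` {t} \<inter> space M)) \<partial>count_space UNIV)"
      by (rule nn_integral_discrete_var[OF fgh])
    also have "\<dots> \<le> (\<integral>\<^sup>+t. (\<lambda>(i, j, k). ennreal (r j k / s k) * ennreal (q i k)) t \<partial>count_space UNIV)"
    proof (rule nn_integral_mono, clarsimp)
      fix i j k
      have "ennreal (q i k * r j k / (s k * p i j k)) * ennreal (p i j k)
          = ennreal (q i k * r j k / (s k * p i j k) * p i j k)"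
        by (rule ennreal_mult''[symmetric]) (rule nn)
      also have "\<dots> \<le> ennreal (r j k / s k * q i k)"
        using nn by (intro ennreal_leI) (auto simp: field_simps)
      also have "\<dots> = ennreal (r j k / s k) * ennreal (q i k)"
        by (rule ennreal_mult'') (rule nn)
      finally show "ennreal (q i k * r j k / (s k * p i j k)) *
        ennreal (measure M ((\<lambda>x. (f x, g x, h x)) -` {(i, j, k)} \<inter> space M))
          \<le> ennreal (r j k / s k) * ennreal (q i k)" by (simp add: p_def)
    qed
    also have "\<dots> = (\<integral>\<^sup>+u. \<integral>\<^sup>+i. (case u of (j, k) \<Rightarrow> ennreal (r j k / s k) * ennreal (q i k))
        \<partial>count_space UNIV \<partial>count_space UNIV)"
      by (subst nn_integral_snd_count_space[symmetric]) (simp add: split_def)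
    also have "\<dots> = (\<integral>\<^sup>+u. (case u of (j, k) \<Rightarrow> ennreal (r j k / s k) * ennreal (s k)) \<partial>count_space UNIV)"
      by (intro nn_integral_cong) (simp add: split_def nn_integral_cmult q_sum)
    also have "\<dots> \<le> (\<integral>\<^sup>+u. ennreal (measure M ((\<lambda>x. (g x, h x)) -` {u} \<inter> space M)) \<partial>count_space UNIV)"
    proof (rule nn_integral_mono, clarsimp)
      fix j k
      have "ennreal (r j k / s k) * ennreal (s k) = ennreal (r j k / s k * s k)"
        by (rule ennreal_mult''[symmetric]) (rule nn)
      also have "\<dots> \<le> ennreal (r j k)"
        using nn by (intro ennreal_leI) auto
      finally show "ennreal (r j k / s k) * ennreal (s k) \<le>
          ennreal (measure M ((\<lambda>x. (g x, h x)) -` {(j, k)} \<inter> space M))" by (simp add: r_def)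
    qed
    also have "\<dots> = 1"
      using sum_marginal[OF gh sets.top] by (simp add: prob_space)
    finally show ?thesis .
  qed
  have "ent M (\<lambda>x. (f x, g x, h x)) + ent M h + 1
      = (\<integral>\<^sup>+x. ennreal (- ln (?a x)) + ennreal (- ln (?d x)) + 1 \<partial>M)"
    by (simp add: ent_def nn_integral_add emeasure_space_1)
  also have "\<dots> \<le> (\<integral>\<^sup>+x. ennreal (- ln (?b x)) + ennreal (- ln (?c x)) + ennreal (?b x * ?c x / (?d x * ?a x)) \<partial>M)"
  proof (rule nn_integral_mono_AE)
    show "AE x in M. ennreal (- ln (?a x)) + ennreal (- ln (?d x)) + 1 \<le>
        ennreal (- ln (?b x)) + ennreal (- ln (?c x)) + ennreal (?b x * ?c x / (?d x * ?a x))"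
      using atom_prob_pos[OF fh] atom_prob_pos[OF gh] atom_prob_pos[OF fgh] atom_prob_pos[OF h]
      by eventually_elim (intro Gibbs_pointwise; simp add: atom_prob_nonneg)
  qed
  also have "\<dots> = ent M (\<lambda>x. (f x, h x)) + ent M (\<lambda>x. (g x, h x))
      + (\<integral>\<^sup>+x. ennreal (?b x * ?c x / (?d x * ?a x)) \<partial>M)"
    by (simp add: ent_def nn_integral_add)
  also have "\<dots> \<le> ent M (\<lambda>x. (f x, h x)) + ent M (\<lambda>x. (g x, h x)) + 1"
    using ratio by (intro add_left_mono)
  finally show ?thesis
    by (simp add: ennreal_add_left_cancel_le add.commute[of _ 1])
qed

lemma ent_const: "ent M (\<lambda>x. c) = 0"
  by (simp add: ent_def atom_prob_def prob_space)

lemma ent_Pair_le: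
  assumes f: "discrete_var M f" and g: "discrete_var M g"
  shows "ent M (\<lambda>x. (f x, g x)) \<le> ent M f + ent M g"
proof -
  have c: "discrete_var M (\<lambda>x. ())" by (auto simp: discrete_var_def)
  note fc = discrete_var_Pair[OF f c] and gc = discrete_var_Pair[OF g c]
  have "ent M (\<lambda>x. (f x, g x)) = ent M (\<lambda>x. (f x, g x, ()))"
    by (rule ent_cong) (auto intro: discrete_var_Pair[OF f discrete_var_Pair[OF g c]] discrete_var_Pair[OF f g])
  also have "\<dots> \<le> ent M (\<lambda>x. (f x, ())) + ent M (\<lambda>x. (g x, ()))"
    using ent_submodular[OF f g c] by (simp add: ent_const)
  also have "ent M (\<lambda>x. (f x, ())) = ent M f" by (rule ent_cong) (auto intro: discrete_var_Pair f c)
  also have "ent M (\<lambda>x. (g x, ())) = ent M g" by (rule ent_cong) (auto intro: discrete_var_Pair g c)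
  finally show ?thesis .
qed

lemma ent_eq_sum:
  assumes "discrete_var M f"
  shows "ent M f = (\<integral>\<^sup>+b. ennreal (- (measure M (f -` {b} \<inter> space M) * ln (measure M (f -` {b} \<inter> space M))))
    \<partial>count_space UNIV)"
proof -
  have "ent M f = (\<integral>\<^sup>+x. (\<lambda>b. ennreal (- ln (measure M (f -` {b} \<inter> space M)))) (f x) \<partial>M)"
    by (simp add: ent_def atom_prob_def)
  also have "\<dots> = (\<integral>\<^sup>+b. ennreal (- ln (measure M (f -` {b} \<inter> space M))) *
      ennreal (measure M (f -` {b} \<inter> space M)) \<partial>count_space UNIV)"
    by (rule nn_integral_discrete_var[OF assms])
  also have "\<dots> = (\<integral>\<^sup>+b. ennreal (- (measure M (f -` {b} \<inter> space M) * ln (measure M (f -` {b} \<inter> space M))))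
    \<partial>count_space UNIV)"
    by (intro nn_integral_cong, subst ennreal_mult''[symmetric]) (simp_all add: mult.commute)
  finally show ?thesis .
qed

lemma ent_finite:
  assumes "discrete_var M f" "finite (f ` space M)"
  shows "ent M f < \<infinity>"
proof -
  have "ent M f = (\<integral>\<^sup>+b. ennreal (- (measure M (f -` {b} \<inter> space M) * ln (measure M (f -` {b} \<inter> space M))))
    \<partial>count_space (f ` space M))"
    unfolding ent_eq_sum[OF assms(1)]
  proof (rule nn_integral_count_space_eq)
    fix b assume "b \<in> UNIV - f ` space M"
    then have "f -` {b} \<inter> space M = {}" by auto
    then show "ennreal (- (measure M (f -` {b} \<inter> space M) * ln (measure M (f -` {b} \<inter> space M)))) = 0" by simp
  qed auto
  also have "\<dots> < \<infinity>"
    using assms(2) by (simp add: nn_integral_count_space_finite)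
  finally show ?thesis .
qed

end

section \<open>Words and the entropy rate\<close>

text \<open>Writing \<open>n = q m + r\<close> with \<open>r < m\<close> compares \<open>f n / n\<close> with \<open>f m / m\<close>, up to an error that is
  bounded in terms of \<open>m\<close> only.\<close>

lemma fekete:
  fixes f :: "nat \<Rightarrow> real"
  assumes sub: "\<And>m n. f (m + n) \<le> f m + f n" and nonneg: "\<And>n. 0 \<le> f n"
  obtains l where "(\<lambda>n. f n / n) \<longlonglongrightarrow> l" "0 \<le> l" "\<And>n. 0 < n \<Longrightarrow> l \<le> f n / n"
proof -
  define l where "l = (INF n\<in>{0<..}. f n / real n)"
  have bdd: "bdd_below ((\<lambda>n. f n / real n) ` {0<..})"
    using nonneg by (intro bdd_belowI[of _ 0]) auto
  have lower: "l \<le> f n / n" if "0 < n" for n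
    unfolding l_def using that bdd by (intro cINF_lower) auto
  have mult: "f (q * m + r) \<le> q * f m + f r" for q m r
  proof (induction q)
    case (Suc q)
    have "f (Suc q * m + r) \<le> f m + f (q * m + r)" using sub[of m "q * m + r"] by (simp add: add.assoc)
    then show ?case using Suc by (simp add: algebra_simps)
  qed simp
  have "(\<lambda>n. f n / n) \<longlonglongrightarrow> l"
  proof (rule LIMSEQ_I)
    fix e :: real assume e: "0 < e"
    have "\<exists>m\<in>{0<..}. f m / real m < l + e / 2"
    proof (rule ccontr)
      assume "\<not> ?thesis"
      then have "l + e / 2 \<le> l" unfolding l_def
        by (intro cINF_greatest) (auto simp: not_less)
      then show False using e by simp
    qed
    then obtain m where m: "0 < m" "f m / real m < l + e / 2" by auto
    define C where "C = Max (f ` {..<m})"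
    have C: "f r \<le> C" if "r < m" for r unfolding C_def using that by (intro Max_ge) auto
    have "0 \<le> C" using C[OF m(1)] nonneg[of 0] by linarith
    obtain N where N: "C / (e / 2) < real N" using reals_Archimedean2 by blast
    have "norm (f n / n - l) < e" if n: "n \<ge> Suc N" for n
    proof -
      have n0: "0 < n" using n by simp
      have "f n \<le> (n div m) * f m + f (n mod m)" using mult[of "n div m" m "n mod m"] by simp
      also have "\<dots> \<le> (real n / real m) * f m + C"
      proof (intro add_mono mult_right_mono nonneg C)
        have "real (n div m * m) \<le> real n" by (simp only: of_nat_le_iff div_times_less_eq_dividend)
        then show "real (n div m) \<le> real n / real m" using m(1) by (simp add: le_divide_eq)
      qed (use m(1) in simp)
      also have "(real n / real m) * f m = n * (f m / m)" by simp
      also have "C \<le> (e / 2) * n"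
      proof -
        have "C / (e / 2) \<le> n" using N n by linarith
        then show ?thesis using e by (simp add: field_simps)
      qed
      finally have "f n \<le> n * (f m / m) + (e / 2) * n" by simp
      also have "\<dots> < n * (l + e / 2) + (e / 2) * n"
        using m(2) n0 by (intro add_strict_right_mono mult_strict_left_mono) auto
      finally have "f n / n < l + e" using n0 by (simp add: field_simps)
      then show ?thesis using lower[OF n0] e by auto
    qed
    then show "\<exists>no. \<forall>n\<ge>no. norm (f n / real n - l) < e" by blast
  qed
  moreover have "0 \<le> l" unfolding l_def using nonneg by (intro cINF_greatest) auto
  ultimately show ?thesis using lower that by blast
qed

lemma infsum_ennreal_eq_nn_integral:
  fixes f :: "'a \<Rightarrow> ennreal"
  assumes A: "countable A"
  shows "(\<Sum>\<^sub>\<infinity>a\<in>A. f a) = (\<integral>\<^sup>+a. f a \<partial>count_space A)"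
proof -
  have sum: "(\<integral>\<^sup>+a. f a * indicator F a \<partial>count_space A) = sum f F" if "finite F" "F \<subseteq> A" for F
  proof -
    have "(\<integral>\<^sup>+a. f a * indicator F a \<partial>count_space A) = (\<integral>\<^sup>+a. f a \<partial>count_space F)"
      using that by (simp add: nn_integral_count_space_indicator indicator_def, intro nn_integral_cong) auto
    then show ?thesis using that by (simp add: nn_integral_count_space_finite)
  qed
  have inf: "(\<Sum>\<^sub>\<infinity>a\<in>A. f a) = (SUP F\<in>{F. finite F \<and> F \<subseteq> A}. sum f F)"
    by (rule nonneg_infsum_complete) simp
  show ?thesis
  proof (cases "A = {}")
    case False
    define E where "E n = from_nat_into A ` {..<n}" for n
    have E: "finite (E n)" "E n \<subseteq> A" for n
      using from_nat_into[OF False] by (auto simp: E_def)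
    have mono: "incseq (\<lambda>n a. f a * indicator (E n) a)"
      by (auto simp: incseq_def le_fun_def E_def indicator_def)
    have "(\<integral>\<^sup>+a. f a \<partial>count_space A) = (\<integral>\<^sup>+a. (SUP n. f a * indicator (E n) a) \<partial>count_space A)"
    proof (rule nn_integral_cong)
      fix a assume "a \<in> space (count_space A)"
      then obtain k where k: "a = from_nat_into A k"
        using A by (metis from_nat_into_surj space_count_space)
      have "(SUP n. f a * indicator (E n) a) = f a"
      proof (rule antisym)
        show "(SUP n. f a * indicator (E n) a) \<le> f a" by (intro SUP_least) (auto simp: indicator_def)
        have "f a = f a * indicator (E (Suc k)) a" using k by (auto simp: E_def indicator_def)
        also have "\<dots> \<le> (SUP n. f a * indicator (E n) a)" by (rule SUP_upper) simp
        finally show "f a \<le> (SUP n. f a * indicator (E n) a)" .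
      qed
      then show "f a = (SUP n. f a * indicator (E n) a)" by simp
    qed
    also have "\<dots> = (SUP n. \<integral>\<^sup>+a. f a * indicator (E n) a \<partial>count_space A)"
      by (rule nn_integral_monotone_convergence_SUP[OF mono]) simp
    also have "\<dots> \<le> (\<Sum>\<^sub>\<infinity>a\<in>A. f a)"
      unfolding inf using E by (intro SUP_least) (simp add: sum, intro SUP_upper, simp)
    finally have "(\<integral>\<^sup>+a. f a \<partial>count_space A) \<le> (\<Sum>\<^sub>\<infinity>a\<in>A. f a)" .
    moreover have "(\<Sum>\<^sub>\<infinity>a\<in>A. f a) \<le> (\<integral>\<^sup>+a. f a \<partial>count_space A)"
      unfolding inf
    proof (intro SUP_least, clarsimp)
      fix F assume "finite F" "F \<subseteq> A"
      then show "sum f F \<le> (\<integral>\<^sup>+a. f a \<partial>count_space A)"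
        by (subst sum[symmetric]) (auto intro!: nn_integral_mono simp: indicator_def)
    qed
    ultimately show ?thesis by (rule antisym[rotated])
  qed (simp add: nn_integral_count_space_finite)
qed

context prob_space begin

lemma partition_entropy_levels:
  assumes f: "discrete_var M f"
  shows "partition_entropy M ((\<lambda>b. f -` {b} \<inter> space M) ` f ` space M) = ent M f"
proof -
  let ?L = "\<lambda>b. f -` {b} \<inter> space M"
  let ?g = "\<lambda>b. ennreal (- (measure M (?L b) * ln (measure M (?L b))))"
  have inj: "inj_on ?L (f ` space M)" by (rule inj_onI) blast
  have "partition_entropy M (?L ` f ` space M) = (\<Sum>\<^sub>\<infinity>b\<in>f ` space M. ?g b)"
    unfolding partition_entropy_def by (subst infsum_reindex[OF inj]) (simp add: o_def)
  also have "\<dots> = (\<integral>\<^sup>+b. ?g b \<partial>count_space (f ` space M))"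
    using discrete_varD(1)[OF f] by (rule infsum_ennreal_eq_nn_integral)
  also have "\<dots> = (\<integral>\<^sup>+b. ?g b \<partial>count_space UNIV)"
  proof (rule nn_integral_count_space_eq)
    fix b assume "b \<in> UNIV - f ` space M"
    then have "?L b = {}" by auto
    then show "?g b = 0" by simp
  qed auto
  finally show ?thesis using ent_eq_sum[OF f] by simp
qed

end

text \<open>The \<open>f\<close>-name of length \<open>n\<close> of the point \<open>x\<close>.\<close>

definition word :: "('a \<Rightarrow> 'a) \<Rightarrow> ('a \<Rightarrow> 'b) \<Rightarrow> nat \<Rightarrow> 'a \<Rightarrow> 'b list" where
  "word T f n x = map (\<lambda>j. f ((T ^^ j) x)) [0..<n]"

lemma length_word [simp]: "length (word T f n x) = n" by (simp add: word_def)

lemma nth_word [simp]: "j < n \<Longrightarrow> word T f n x ! j = f ((T ^^ j) x)" by (simp add: word_def)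

lemma word_eq_iff: "word T f n x = word T f n y \<longleftrightarrow> (\<forall>j<n. f ((T ^^ j) x) = f ((T ^^ j) y))"
  by (auto simp: word_def)

definition block_of :: "'a set set \<Rightarrow> 'a \<Rightarrow> 'a set" where
  "block_of \<alpha> x = (THE A. A \<in> \<alpha> \<and> x \<in> A)"

lemma block_of_eq:
  assumes "partition_on X \<alpha>" "A \<in> \<alpha>" "x \<in> A"
  shows "block_of \<alpha> x = A"
  unfolding block_of_def using assms by (intro the_equality) (auto dest: partition_onD2 disjointD)

lemma block_of_in:
  assumes "partition_on X \<alpha>" "x \<in> X"
  shows "block_of \<alpha> x \<in> \<alpha>" "x \<in> block_of \<alpha> x"
proof -
  obtain A where "A \<in> \<alpha>" "x \<in> A" using assms by (metis UnionE partition_onD1)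
  then show "block_of \<alpha> x \<in> \<alpha>" "x \<in> block_of \<alpha> x" using block_of_eq[OF assms(1)] by auto
qed

context mds begin

lemma funpow_space: "x \<in> space M \<Longrightarrow> (T ^^ j) x \<in> space M"
  using measurable_space[OF measurable_T] by (induction j) auto

lemma measurable_funpow: "(T ^^ j) \<in> M \<rightarrow>\<^sub>M M"
proof (induction j)
  case (Suc j)
  then show ?case using measurable_comp[OF _ measurable_T] by (simp add: comp_def)
qed (simp add: id_def)

lemma sets_preim: "B \<in> sets M \<Longrightarrow> preim M T j B \<in> sets M"
  unfolding preim_def using measurable_funpow by (rule measurable_sets)

lemma preim_Suc: "preim M T (Suc j) B = T -` preim M T j B \<inter> space M"
  using measurable_space[OF measurable_T] by (auto simp: preim_def funpow_Suc_right simp del: funpow.simps(2))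

lemma measure_preim: "B \<in> sets M \<Longrightarrow> measure M (preim M T j B) = measure M B"
proof (induction j)
  case 0
  then show ?case using sets.sets_into_space by (auto simp: preim_def Int_absorb2)
next
  case (Suc j)
  then show ?case by (simp add: preim_Suc preserving_T sets_preim)
qed

lemma shift_level: "(\<lambda>x. f ((T ^^ j) x)) -` {b} \<inter> space M = preim M T j (f -` {b} \<inter> space M)"
  using funpow_space by (auto simp: preim_def)

lemma discrete_var_shift:
  assumes "discrete_var M f" shows "discrete_var M (\<lambda>x. f ((T ^^ j) x))"
proof -
  have "(\<lambda>x. f ((T ^^ j) x)) ` space M \<subseteq> f ` space M" using funpow_space by auto
  then show ?thesis
    using assms unfolding discrete_var_def shift_level by (auto intro: countable_subset sets_preim)
qed

text \<open>\<open>T\<close> preserves the measure of all level sets, and entropy depends on nothing else.\<close>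

lemma ent_shift:
  assumes "discrete_var M f" shows "ent M (\<lambda>x. f ((T ^^ j) x)) = ent M f"
  unfolding ent_eq_sum[OF assms] ent_eq_sum[OF discrete_var_shift[OF assms]] shift_level
  using discrete_varD(2)[OF assms] by (simp add: measure_preim)

lemma discrete_var_word:
  assumes "discrete_var M f" shows "discrete_var M (word T f n)"
proof (induction n)
  case 0
  show ?case by (auto simp: discrete_var_def word_def image_constant_conv)
next
  case (Suc n)
  have eq: "word T f (Suc n) = (\<lambda>x. (\<lambda>(u, a). u @ [a]) (word T f n x, f ((T ^^ n) x)))"
    by (auto simp: word_def)
  show ?case
    unfolding eq by (rule discrete_var_comp[OF discrete_var_Pair[OF Suc discrete_var_shift[OF assms]]])
qed

lemma word_add: "word T f (m + n) x = word T f m x @ word T f n ((T ^^ m) x)"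
  by (rule nth_equalityI) (auto simp: nth_append word_def funpow_add[symmetric] simp flip: comp_apply[of "T ^^ _" "T ^^ _"])

lemma ent_word_add:
  assumes f: "discrete_var M f"
  shows "ent M (word T f (m + n)) \<le> ent M (word T f m) + ent M (word T f n)"
proof -
  note w = discrete_var_word[OF f]
  have "ent M (word T f (m + n)) = ent M (\<lambda>x. (word T f m x, word T f n ((T ^^ m) x)))"
    by (rule ent_cong[OF discrete_var_Pair[OF w discrete_var_shift[OF w]] w]) (simp add: word_add)
  also have "\<dots> \<le> ent M (word T f m) + ent M (\<lambda>x. word T f n ((T ^^ m) x))"
    by (rule ent_Pair_le[OF w discrete_var_shift[OF w]])
  finally show ?thesis by (simp add: ent_shift[OF w])
qed

lemma ent_word_le:
  assumes f: "discrete_var M f"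
  shows "ent M (word T f n) \<le> of_nat n * ent M f"
proof (induction n)
  case 0
  have "word T f 0 = (\<lambda>x. [])" by (auto simp: word_def)
  then show ?case by (simp add: ent_const)
next
  case (Suc n)
  have "ent M (word T f 1) = ent M f"
    by (rule ent_cong[OF f discrete_var_word[OF f]]) (simp add: word_def)
  then have "ent M (word T f (Suc n)) \<le> ent M (word T f n) + ent M f"
    using ent_word_add[OF f, of n 1] by simp
  also have "\<dots> \<le> of_nat n * ent M f + ent M f" using Suc by (rule add_right_mono)
  finally show ?case by (simp add: distrib_right add.commute)
qed

definition word_ent :: "('a \<Rightarrow> 'b) \<Rightarrow> nat \<Rightarrow> real" where
  "word_ent f n = enn2real (ent M (word T f n))"

lemma ennreal_word_ent:
  assumes "discrete_var M f" "ent M f < \<infinity>"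
  shows "ennreal (word_ent f n) = ent M (word T f n)"
proof -
  have "of_nat n * ent M f < \<infinity>" using assms(2) by (simp add: ennreal_mult_less_top of_nat_less_top)
  then have "ent M (word T f n) < \<infinity>" using ent_word_le[OF assms(1)] by (rule le_less_trans[rotated])
  then show ?thesis by (simp add: word_ent_def)
qed

lemma word_ent_nonneg: "0 \<le> word_ent f n" by (simp add: word_ent_def)

lemma word_ent_limit:
  assumes f: "discrete_var M f" "ent M f < \<infinity>"
  obtains l where "(\<lambda>n. word_ent f n / n) \<longlonglongrightarrow> l" "0 \<le> l" "\<And>n. 0 < n \<Longrightarrow> l \<le> word_ent f n / n"
proof (rule fekete)
  fix m n
  have "ennreal (word_ent f (m + n)) \<le> ennreal (word_ent f m + word_ent f n)"
    using ent_word_add[OF f(1), of m n] by (simp add: ennreal_word_ent[OF f] word_ent_nonneg)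
  then show "word_ent f (m + n) \<le> word_ent f m + word_ent f n"
    by (subst (asm) ennreal_le_iff) (auto simp: word_ent_nonneg intro: add_nonneg_nonneg)
qed (auto simp: word_ent_nonneg)

lemma block_of_level:
  assumes "measurable_partition M \<alpha>" "A \<in> \<alpha>"
  shows "block_of \<alpha> -` {A} \<inter> space M = A"
  using assms block_of_eq[of "space M" \<alpha>] block_of_in[of "space M" \<alpha>] partition_onD1[of "space M" \<alpha>]
  by (auto simp: measurable_partition_def)

lemma discrete_var_block_of:
  assumes "measurable_partition M \<alpha>"
  shows "discrete_var M (block_of \<alpha>)"
  unfolding discrete_var_def
proof (intro conjI allI)
  have sub: "block_of \<alpha> ` space M \<subseteq> \<alpha>"
    using assms block_of_in by (auto simp: measurable_partition_def)
  then show "countable (block_of \<alpha> ` space M)"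
    using assms by (auto simp: measurable_partition_def intro: countable_subset)
  fix b show "block_of \<alpha> -` {b} \<inter> space M \<in> sets M"
  proof (cases "b \<in> \<alpha>")
    case True
    then show ?thesis using block_of_level[OF assms] assms by (auto simp: measurable_partition_def)
  next
    case False
    then have "block_of \<alpha> -` {b} \<inter> space M = {}" using sub by auto
    then show ?thesis by (metis sets.empty_sets)
  qed
qed

lemma partition_entropy_block_of:
  assumes "measurable_partition M \<alpha>"
  shows "partition_entropy M \<alpha> = ent M (block_of \<alpha>)"
proof -
  have "block_of \<alpha> ` space M = \<alpha>"
  proof
    show "block_of \<alpha> ` space M \<subseteq> \<alpha>" using assms block_of_in by (auto simp: measurable_partition_def)
    show "\<alpha> \<subseteq> block_of \<alpha> ` space M"
    proof
      fix A assume A: "A \<in> \<alpha>"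
      then obtain x where "x \<in> A" using assms by (metis all_not_in_conv measurable_partition_def partition_onD3)
      then show "A \<in> block_of \<alpha> ` space M" using block_of_level[OF assms A] by blast
    qed
  qed
  then have "(\<lambda>b. block_of \<alpha> -` {b} \<inter> space M) ` block_of \<alpha> ` space M = \<alpha>"
    using block_of_level[OF assms] by auto
  then show ?thesis using partition_entropy_levels[OF discrete_var_block_of[OF assms]] by simp
qed

text \<open>A block of the common refinement is determined by any one of its points. The length \<open>n = 0\<close> is
  excluded: the common refinement of no partitions is \<open>{UNIV}\<close>, whatever the space.\<close>

lemma common_refinement_words:
  assumes \<alpha>: "measurable_partition M \<alpha>" and n: "0 < n"
  shows "common_refinement ((\<lambda>j. preim_partition M T j \<alpha>) ` {..<n})
    = (\<lambda>b. word T (block_of \<alpha>) n -` {b} \<inter> space M) ` word T (block_of \<alpha>) n ` space M"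
proof -
  let ?P = "(\<lambda>j. preim_partition M T j \<alpha>) ` {..<n}"
  let ?L = "\<lambda>x. word T (block_of \<alpha>) n -` {word T (block_of \<alpha>) n x} \<inter> space M"
  have p: "partition_on (space M) \<alpha>" using \<alpha> by (simp add: measurable_partition_def)
  have in_preim: "y \<in> preim M T j A \<longleftrightarrow> block_of \<alpha> ((T ^^ j) y) = A"
    if "y \<in> space M" "A \<in> \<alpha>" for y j A
    using that block_of_eq[OF p] block_of_in[OF p] funpow_space by (auto simp: preim_def)
  have key: "\<Inter> (g ` ?P) = ?L x"
    if g: "g \<in> Pi ?P (\<lambda>P. P)" and x: "x \<in> space M" "x \<in> \<Inter> (g ` ?P)" for g x
  proof -
    have gj: "g (preim_partition M T j \<alpha>) = preim M T j (block_of \<alpha> ((T ^^ j) x))" if j: "j < n" for j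
    proof -
      have "g (preim_partition M T j \<alpha>) \<in> preim_partition M T j \<alpha>" using g j by blast
      then obtain A where A: "A \<in> \<alpha>" "g (preim_partition M T j \<alpha>) = preim M T j A"
        by (auto simp: preim_partition_def)
      moreover have "x \<in> g (preim_partition M T j \<alpha>)" using x j by blast
      ultimately show ?thesis using in_preim x by metis
    qed
    have "\<Inter> (g ` ?P) = (\<Inter>j\<in>{..<n}. preim M T j (block_of \<alpha> ((T ^^ j) x)))"
      by (simp add: image_image gj)
    also have "\<dots> = ?L x"
    proof (rule set_eqI)
      fix y
      have "y \<in> space M" if "y \<in> (\<Inter>j\<in>{..<n}. preim M T j (block_of \<alpha> ((T ^^ j) x)))"
      proof -
        have "y \<in> preim M T 0 (block_of \<alpha> ((T ^^ 0) x))" using that n by blast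
        then show ?thesis by (simp add: preim_def)
      qed
      then show "y \<in> (\<Inter>j\<in>{..<n}. preim M T j (block_of \<alpha> ((T ^^ j) x))) \<longleftrightarrow> y \<in> ?L x"
        using in_preim block_of_in(1)[OF p funpow_space[OF x(1)]] by (auto simp: word_eq_iff)
    qed
    finally show ?thesis .
  qed
  show ?thesis
  proof (intro subset_antisym subsetI)
    fix B assume "B \<in> common_refinement ?P"
    then obtain g where g: "g \<in> Pi ?P (\<lambda>P. P)" "B = \<Inter> (g ` ?P)" "B \<noteq> {}"
      by (auto simp: common_refinement)
    then obtain x where x: "x \<in> B" by auto
    have "g (preim_partition M T 0 \<alpha>) \<in> preim_partition M T 0 \<alpha>" using g(1) n by blast
    moreover have "x \<in> g (preim_partition M T 0 \<alpha>)" using g(2) x n by blast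
    ultimately have xs: "x \<in> space M" by (auto simp: preim_partition_def preim_def)
    have "B = ?L x" unfolding g(2) by (rule key[OF g(1) xs]) (use x g(2) in simp)
    then show "B \<in> (\<lambda>b. word T (block_of \<alpha>) n -` {b} \<inter> space M) ` word T (block_of \<alpha>) n ` space M"
      by (rule image_eqI) (rule imageI[OF xs])
  next
    fix B assume "B \<in> (\<lambda>b. word T (block_of \<alpha>) n -` {b} \<inter> space M) ` word T (block_of \<alpha>) n ` space M"
    then obtain x where x: "x \<in> space M" and B: "B = ?L x" by blast
    define g where "g Q = (SOME A. A \<in> Q \<and> x \<in> A)" for Q :: "'a set set"
    have g: "g Q \<in> Q \<and> x \<in> g Q" if Q: "Q \<in> ?P" for Q
    proof -
      obtain j where j: "Q = preim_partition M T j \<alpha>"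
        using Q by auto
      have "x \<in> preim M T j (block_of \<alpha> ((T ^^ j) x))"
        using in_preim[OF x block_of_in(1)[OF p funpow_space[OF x]]] by simp
      then have "preim M T j (block_of \<alpha> ((T ^^ j) x)) \<in> Q"
        using block_of_in(1)[OF p funpow_space[OF x]] j by (auto simp: preim_partition_def)
      with \<open>x \<in> preim M T j _\<close> have "\<exists>A. A \<in> Q \<and> x \<in> A" by blast
      then show ?thesis unfolding g_def by (rule someI_ex)
    qed
    then have gPi: "g \<in> Pi ?P (\<lambda>P. P)" and xg: "x \<in> \<Inter> (g ` ?P)" by blast+
    have "\<Inter> (g ` ?P) = B" unfolding B by (rule key[OF gPi x xg])
    then have "B \<in> (\<Union>f\<in>Pi ?P (\<lambda>P. P). {\<Inter> (f ` ?P)})" "B \<noteq> {}"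
      using gPi xg by (blast, metis empty_iff)
    then show "B \<in> common_refinement ?P"
      unfolding common_refinement by simp
  qed
qed

text \<open>By Fekete's lemma the expression \<open>lim\<close> in \<open>entropy_rate\<close> denotes an actual limit.\<close>

lemma entropy_rate_limit:
  assumes \<alpha>: "measurable_partition M \<alpha>" and fin: "partition_entropy M \<alpha> < \<infinity>"
  obtains l where "(\<lambda>n. word_ent (block_of \<alpha>) n / n) \<longlonglongrightarrow> l" "0 \<le> l" "entropy_rate M T \<alpha> = ennreal l"
proof -
  note f = discrete_var_block_of[OF \<alpha>] fin[unfolded partition_entropy_block_of[OF \<alpha>]]
  obtain l where l: "(\<lambda>n. word_ent (block_of \<alpha>) n / n) \<longlonglongrightarrow> l" "0 \<le> l"
    using word_ent_limit[OF f] by blast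
  have "partition_entropy M (common_refinement ((\<lambda>j. preim_partition M T j \<alpha>) ` {..<n})) / of_nat n
      = ennreal (word_ent (block_of \<alpha>) n / n)" if "0 < n" for n
    unfolding common_refinement_words[OF \<alpha> that] partition_entropy_levels[OF discrete_var_word[OF f(1)]]
    using that by (simp add: ennreal_word_ent[OF f, symmetric] divide_ennreal word_ent_nonneg
        ennreal_of_nat_eq_real_of_nat)
  then have "eventually (\<lambda>n. ennreal (word_ent (block_of \<alpha>) n / n) =
      partition_entropy M (common_refinement ((\<lambda>j. preim_partition M T j \<alpha>) ` {..<n})) / of_nat n) sequentially"
    by (intro eventually_sequentiallyI[of 1]) auto
  then have "(\<lambda>n. partition_entropy M (common_refinement ((\<lambda>j. preim_partition M T j \<alpha>) ` {..<n})) / of_nat n)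
      \<longlonglongrightarrow> ennreal l"
    by (rule Lim_transform_eventually[OF tendsto_ennrealI[OF l(1)]])
  then have "entropy_rate M T \<alpha> = ennreal l"
    unfolding entropy_rate_def by (rule limI)
  then show ?thesis using l that by blast
qed

end

section \<open>Upper Banach density\<close>

text \<open>A long interval is covered by consecutive windows of length \<open>n\<close>; only the last one can stick
  out, which costs a bounded number of points.\<close>

lemma not_F_pubd_if_sparse_windows:
  assumes "\<And>e. 0 < e \<Longrightarrow> \<exists>n>0. \<forall>a. real (card (F \<inter> {a..<a + n})) \<le> e * real n"
  shows "F \<notin> F_pubd"
proof -
  have "upper_banach_density F \<le> ereal e" if e: "0 < e" for e :: real
  proof -
    obtain n where n: "0 < n" "\<And>a. real (card (F \<inter> {a..<a + n})) \<le> e / 2 * real n"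
      using assms[of "e / 2"] e by auto
    have blocks: "real (card (F \<inter> {a..<a + q * n})) \<le> q * (e / 2 * n)" for a q
    proof (induction q)
      case (Suc q)
      have "F \<inter> {a..<a + Suc q * n} = (F \<inter> {a..<a + q * n}) \<union> (F \<inter> {a + q * n..<a + q * n + n})"
        by auto
      then have "card (F \<inter> {a..<a + Suc q * n}) \<le>
          card (F \<inter> {a..<a + q * n}) + card (F \<inter> {a + q * n..<a + q * n + n})"
        by (metis card_Un_le)
      then have "real (card (F \<inter> {a..<a + Suc q * n})) \<le>
          real (card (F \<inter> {a..<a + q * n})) + real (card (F \<inter> {a + q * n..<a + q * n + n}))"
        by (simp only: of_nat_add[symmetric] of_nat_le_iff)
      then show ?case using Suc n(2)[of "a + q * n"] by (simp add: algebra_simps)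
    qed simp
    have "real (card (F \<inter> {a..b})) / real (card {a..b}) \<le> e" if ab: "a \<le> b" "n \<le> card {a..b}" for a b
    proof -
      define l where "l = card {a..b}"
      have l: "l = Suc b - a" "n \<le> l" "0 < l" using ab n by (auto simp: l_def)
      have dv: "l < (l div n + 1) * n"
        using n(1) by (metis Suc_eq_plus1 dividend_less_times_div mult.commute mult_Suc_right)
      have "F \<inter> {a..b} \<subseteq> F \<inter> {a..<a + (l div n + 1) * n}" using dv l(1) by auto
      then have "real (card (F \<inter> {a..b})) \<le> real (card (F \<inter> {a..<a + (l div n + 1) * n}))"
        by (simp add: card_mono)
      also have "\<dots> \<le> real (l div n + 1) * (e / 2 * n)" by (rule blocks)
      also have "\<dots> = e / 2 * real ((l div n) * n + n)" by (simp add: algebra_simps)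
      also have "\<dots> \<le> e / 2 * real (l + l)"
        using e l(2) by (intro mult_left_mono) (auto simp only: of_nat_le_iff intro!: add_mono div_times_less_eq_dividend)
      finally show ?thesis using l(3) unfolding l_def[symmetric] by (simp add: divide_le_eq)
    qed
    then show ?thesis
      unfolding upper_banach_density_def by (intro Limsup_bounded) (auto simp: eventually_long_intervals)
  qed
  then have "upper_banach_density F \<le> 0"
    by (intro ereal_le_epsilon2[of _ 0]) auto
  then show ?thesis by (simp add: F_pubd_def)
qed

lemma F_pubdI:
  assumes c: "0 < c"
    and dense: "\<And>N. \<exists>a b. a \<le> b \<and> N \<le> card {a..b} \<and> c \<le> real (card (F \<inter> {a..b})) / real (card {a..b})"
  shows "F \<in> F_pubd"
proof -
  have "ereal c \<le> upper_banach_density F"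
    unfolding upper_banach_density_def Limsup_def
  proof (rule INF_greatest)
    fix P assume "P \<in> {P. eventually P long_intervals}"
    then obtain N where N: "\<And>a b. a \<le> b \<Longrightarrow> N \<le> card {a..b} \<Longrightarrow> P {a..b}"
      unfolding eventually_long_intervals by blast
    obtain a b where ab: "a \<le> b" "N \<le> card {a..b}" "c \<le> real (card (F \<inter> {a..b})) / real (card {a..b})"
      using dense by blast
    have "ereal c \<le> ereal (real (card (F \<inter> {a..b})) / real (card {a..b}))" using ab(3) by (simp only: ereal_less_eq)
    also have "\<dots> \<le> (SUP I\<in>{I. P I}. ereal (real (card (F \<inter> I)) / real (card I)))"
      using N[OF ab(1,2)] by (intro SUP_upper) simp
    finally show "ereal c \<le> (SUP I\<in>{I. P I}. ereal (real (card (F \<inter> I)) / real (card I)))" .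
  qed
  then show ?thesis using c by (auto simp: F_pubd_def intro: less_le_trans[of 0 "ereal c"])
qed

section \<open>Independence of order two forces positive entropy\<close>

context prob_space begin

lemma card_heavy_values:
  assumes f: "discrete_var M f" and c: "0 < c"
  shows "finite {b. c \<le> measure M (f -` {b} \<inter> space M)}"
    and "real (card {b. c \<le> measure M (f -` {b} \<inter> space M)}) \<le> 1 / c"
proof -
  let ?B = "{b. c \<le> measure M (f -` {b} \<inter> space M)}"
  have le: "real (card S) \<le> 1 / c" if S: "finite S" "S \<subseteq> ?B" for S
  proof -
    have "real (card S) * c = (\<Sum>b\<in>S. c)" by simp
    also have "\<dots> \<le> (\<Sum>b\<in>S. measure M (f -` {b} \<inter> space M))" using S by (intro sum_mono) auto
    also have "\<dots> = measure M (\<Union>b\<in>S. f -` {b} \<inter> space M)"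
      using S discrete_varD(2)[OF f]
      by (intro finite_measure_finite_Union[symmetric]) (auto simp: disjoint_family_on_def)
    also have "\<dots> \<le> 1" by simp
    finally show ?thesis using c by (simp add: field_simps)
  qed
  have "card S \<le> nat \<lfloor>1 / c\<rfloor>" if "finite S" "S \<subseteq> ?B" for S
    using le[OF that] by (simp add: le_nat_floor)
  then show fin: "finite ?B" using finite_if_finite_subsets_card_bdd[of ?B "nat \<lfloor>1 / c\<rfloor>"] by blast
  show "real (card ?B) \<le> 1 / c" by (rule le[OF fin]) simp
qed

text \<open>Markov's inequality for the information function.\<close>

lemma light_atoms_Markov:
  assumes f: "discrete_var M f"
  shows "ennreal t * emeasure M {x \<in> space M. atom_prob M f x < exp (- t)} \<le> ent M f"
proof -
  let ?B = "{x \<in> space M. atom_prob M f x < exp (- t)}"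
  note [measurable] = atom_prob_measurable[OF f]
  have "ennreal t * emeasure M ?B = (\<integral>\<^sup>+x. ennreal t * indicator ?B x \<partial>M)"
    by (simp add: nn_integral_cmult_indicator)
  also have "\<dots> \<le> ent M f"
    unfolding ent_def
  proof (rule nn_integral_mono_AE)
    show "AE x in M. ennreal t * indicator ?B x \<le> ennreal (- ln (atom_prob M f x))"
      using atom_prob_pos[OF f]
    proof eventually_elim
      case (elim x)
      show ?case
      proof (cases "x \<in> ?B")
        case True
        then have "ln (atom_prob M f x) < - t"
          using elim ln_less_cancel_iff[of "atom_prob M f x" "exp (- t)"] by simp
        then show ?thesis using True by (simp add: ennreal_leI)
      qed simp
    qed
  qed
  finally show ?thesis .
qed

end

lemma IndD:
  assumes "F \<in> Ind M T k A" "J \<subseteq> F" "finite J" "J \<noteq> {}" "s \<in> J \<rightarrow>\<^sub>E {1..k}"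
  shows "measure M (\<Inter>j\<in>J. preim M T j (A (s j))) > 0"
  using assms unfolding Ind_def by blast

context mds begin

text \<open>All \<open>2 ^ card J\<close> patterns occur on the part \<open>J\<close> of \<open>F\<close> in the window. A point that realises a
  pattern is typical at the first time \<open>m\<close> of \<open>J\<close>, and its word of length \<open>n\<close> read from time \<open>m\<close> on
  covers the rest of \<open>J\<close>. The word therefore determines the pattern, and at most \<open>exp t\<close> words are
  available.\<close>

lemma card_independent_window:
  assumes f: "discrete_var M f" and F: "F \<in> Ind M T 2 B"
    and sep: "\<And>x y. x \<in> B 1 \<Longrightarrow> y \<in> B 2 \<Longrightarrow> f x \<noteq> f y"
    and heavy: "\<And>i x. i \<in> {1..2} \<Longrightarrow> x \<in> B i \<Longrightarrow> exp (- t) \<le> atom_prob M (word T f n) x"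
    and t: "0 \<le> t"
  shows "card (F \<inter> {a..<a + n}) * ln 2 \<le> t"
proof (cases "F \<inter> {a..<a + n} = {}")
  case False
  let ?J = "F \<inter> {a..<a + n}"
  let ?W = "{b. exp (- t) \<le> measure M (word T f n -` {b} \<inter> space M)}"
  define m where "m = Min ?J"
  have m: "m \<in> ?J" unfolding m_def using False by (intro Min_in) auto
  have mle: "m \<le> j" if "j \<in> ?J" for j unfolding m_def using that by (intro Min_le) auto
  have "\<exists>x. x \<in> (\<Inter>j\<in>?J. preim M T j (B (s j)))" if "s \<in> ?J \<rightarrow>\<^sub>E {1..2}" for s :: "nat \<Rightarrow> nat"
  proof -
    have "0 < measure M (\<Inter>j\<in>?J. preim M T j (B (s j)))"
      by (rule IndD[OF F _ _ False that]) auto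
    then have "(\<Inter>j\<in>?J. preim M T j (B (s j))) \<noteq> {}" by (metis less_irrefl measure_empty)
    then show ?thesis by blast
  qed
  then obtain x where x: "x s \<in> (\<Inter>j\<in>?J. preim M T j (B (s j)))" if "s \<in> ?J \<rightarrow>\<^sub>E {1..2}" for s :: "nat \<Rightarrow> nat"
    by metis
  have xB: "(T ^^ j) (x s) \<in> B (s j)" "x s \<in> space M" if "s \<in> ?J \<rightarrow>\<^sub>E {1..2}" "j \<in> ?J" for s :: "nat \<Rightarrow> nat" and j
  proof -
    have "x s \<in> preim M T j (B (s j))" using x[OF that(1)] that(2) by blast
    then show "(T ^^ j) (x s) \<in> B (s j)" "x s \<in> space M" by (auto simp: preim_def)
  qed
  define w where "w s = word T f n ((T ^^ m) (x s))" for s :: "nat \<Rightarrow> nat"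
  have inj: "inj_on w (?J \<rightarrow>\<^sub>E {1..2})"
  proof (rule inj_onI)
    fix r s assume r: "r \<in> ?J \<rightarrow>\<^sub>E {1..2}" and s: "s \<in> ?J \<rightarrow>\<^sub>E {1..2}" and eq: "w r = w s"
    show "r = s"
    proof (rule PiE_ext[OF r s])
      fix j assume j: "j \<in> ?J"
      have "j - m < n" using j m by auto
      then have "f ((T ^^ (j - m)) ((T ^^ m) (x r))) = f ((T ^^ (j - m)) ((T ^^ m) (x s)))"
        using eq unfolding w_def word_eq_iff by blast
      moreover have "(T ^^ (j - m)) ((T ^^ m) y) = (T ^^ j) y" for y
        using mle[OF j] by (metis comp_apply funpow_add le_add_diff_inverse2)
      ultimately have eqj: "f ((T ^^ j) (x r)) = f ((T ^^ j) (x s))" by simp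
      have "r j \<in> {1..2}" "s j \<in> {1..2}" using r s j by blast+
      then consider "r j = s j" | "r j = 1" "s j = 2" | "r j = 2" "s j = 1" by fastforce
      then show "r j = s j"
        using sep[of "(T ^^ j) (x r)" "(T ^^ j) (x s)"] sep[of "(T ^^ j) (x s)" "(T ^^ j) (x r)"]
          xB(1)[OF r j] xB(1)[OF s j] eqj by cases auto
    qed
  qed
  have sub: "w ` (?J \<rightarrow>\<^sub>E {1..2}) \<subseteq> ?W"
  proof clarify
    fix s :: "nat \<Rightarrow> nat" assume s: "s \<in> ?J \<rightarrow>\<^sub>E {1..2}"
    have "s m \<in> {1..2}" using s m by blast
    then have "exp (- t) \<le> atom_prob M (word T f n) ((T ^^ m) (x s))" using heavy xB(1)[OF s m] by blast
    then show "exp (- t) \<le> measure M (word T f n -` {w s} \<inter> space M)" by (simp add: w_def atom_prob_def)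
  qed
  note W = card_heavy_values[OF discrete_var_word[OF f, of n], of "exp (- t)"]
  have "card (?J \<rightarrow>\<^sub>E {1..2::nat}) = 2 ^ card ?J" by (simp add: card_PiE)
  then have "2 ^ card ?J \<le> card ?W" using card_inj_on_le[OF inj sub] W(1) by simp
  then have "2 ^ card ?J \<le> real (card ?W)" by (metis of_nat_le_iff of_nat_numeral of_nat_power)
  also have "\<dots> \<le> exp t" using W(2) by (simp add: exp_minus field_simps)
  finally have "ln (2 ^ card ?J) \<le> ln (exp t :: real)" by (subst ln_le_cancel_iff) auto
  then show ?thesis by (simp add: ln_realpow)
qed (use t in simp)

lemma mostly_heavy_words:
  assumes f: "discrete_var M f" "ent M f < \<infinity>" and lim: "(\<lambda>n. word_ent f n / n) \<longlonglongrightarrow> 0"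
    and e: "0 < e" and d: "0 < d"
  shows "\<exists>n>0. measure M {x \<in> space M. atom_prob M (word T f n) x < exp (- (e * real n))} \<le> d"
proof -
  have "eventually (\<lambda>n. word_ent f n / n < e * d) sequentially"
    using lim e d by (intro order_tendstoD(2)) auto
  then have "eventually (\<lambda>n. word_ent f n / n < e * d \<and> 0 < n) sequentially"
    by (intro eventually_conj eventually_gt_at_top)
  then have "\<exists>n. word_ent f n / n < e * d \<and> 0 < n"
    by (rule eventually_happens'[OF sequentially_bot])
  then obtain n where n: "0 < n" "word_ent f n / n < e * d" by blast
  let ?B = "{x \<in> space M. atom_prob M (word T f n) x < exp (- (e * real n))}"
  have "ennreal (e * n * measure M ?B) = ennreal (e * n) * emeasure M ?B"
    using e by (simp add: emeasure_eq_measure ennreal_mult)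
  also have "\<dots> \<le> ennreal (word_ent f n)"
    unfolding ennreal_word_ent[OF f] by (rule light_atoms_Markov[OF discrete_var_word[OF f(1)]])
  finally have "e * n * measure M ?B \<le> word_ent f n" by (simp add: word_ent_nonneg)
  also have "\<dots> \<le> e * n * d" using n by (simp add: field_simps)
  finally have "measure M ?B \<le> d" using e n(1) by simp
  then show ?thesis using n(1) by blast
qed

text \<open>Points are discarded at lengths \<open>n i\<close> with tolerance \<open>1 / (i + 1)\<close>. The discarded sets \<open>L i\<close> have
  total measure at most \<open>d / 2\<close>, so they exhaust neither \<open>A\<close> nor its complement.\<close>

theorem independent_order_2_imp_cpe:
  assumes ind: "F_independent_of_order M T F_pubd 2"
  shows "completely_positive_entropy M T"
  unfolding completely_positive_entropy_def
proof (intro allI impI, rule ccontr)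
  fix \<alpha>
  assume "measurable_partition M \<alpha> \<and> 0 < partition_entropy M \<alpha> \<and> partition_entropy M \<alpha> < \<infinity>"
  then have \<alpha>: "measurable_partition M \<alpha>" and pos: "0 < partition_entropy M \<alpha>"
    and fin: "partition_entropy M \<alpha> < \<infinity>" by auto
  assume zero: "\<not> entropy_rate M T \<alpha> > 0"
  let ?f = "block_of \<alpha>"
  have p: "partition_on (space M) \<alpha>" and sets: "\<alpha> \<subseteq> sets M"
    using \<alpha> by (auto simp: measurable_partition_def)
  note f = discrete_var_block_of[OF \<alpha>] fin[unfolded partition_entropy_block_of[OF \<alpha>]]
  have lim: "(\<lambda>n. word_ent ?f n / n) \<longlonglongrightarrow> 0"
  proof -
    obtain l where "(\<lambda>n. word_ent ?f n / n) \<longlonglongrightarrow> l" "0 \<le> l" "entropy_rate M T \<alpha> = ennreal l"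
      using entropy_rate_limit[OF \<alpha> fin] by blast
    with zero show ?thesis by simp
  qed
  have "\<exists>A\<in>\<alpha>. 0 < measure M A \<and> measure M A < 1"
  proof (rule ccontr)
    assume none: "\<not> ?thesis"
    have "measure M A = 0 \<or> measure M A = 1" if "A \<in> \<alpha>" for A
    proof -
      have "\<not> (0 < measure M A \<and> measure M A < 1)" using none that by blast
      then show ?thesis
        using prob_le_1[of A] by (cases "0 < measure M A") (auto simp: zero_less_measure_iff)
    qed
    then have "partition_entropy M \<alpha> = 0"
      unfolding partition_entropy_def by (intro infsum_0) fastforce
    then show False using pos by simp
  qed
  then obtain A where A: "A \<in> \<alpha>" "0 < measure M A" "measure M A < 1" by blast
  have [measurable]: "A \<in> sets M" using A sets by blast
  define d where "d = min (measure M A) (1 - measure M A)"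
  have d: "0 < d" using A by (simp add: d_def)
  have "\<forall>i. \<exists>n. 0 < n \<and> measure M {x \<in> space M.
      atom_prob M (word T ?f n) x < exp (- (1 / Suc i * real n))} \<le> d / 4 * (1 / 2) ^ i"
    using d by (intro allI mostly_heavy_words[OF f lim]) auto
  from choice[OF this] obtain n where n: "\<And>i. 0 < n i"
    "\<And>i. measure M {x \<in> space M. atom_prob M (word T ?f (n i)) x < exp (- (1 / Suc i * real (n i)))} \<le> d / 4 * (1 / 2) ^ i"
    by blast
  define L where "L i = {x \<in> space M. atom_prob M (word T ?f (n i)) x < exp (- (1 / Suc i * real (n i)))}" for i
  note [measurable] = atom_prob_measurable[OF discrete_var_word[OF f(1)]]
  have L [measurable]: "L i \<in> sets M" for i unfolding L_def by measurable
  have sm: "(\<lambda>i. d / 4 * (1 / 2) ^ i) sums (d / 4 * 2)"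
    using sums_mult[OF geometric_sums[of "1 / 2 :: real"], of "d / 4"] by simp
  have summ: "summable (\<lambda>i. measure M (L i))"
    by (rule summable_comparison_test_ev[OF _ sums_summable[OF sm]]) (use n(2) in \<open>auto simp: L_def\<close>)
  have UL: "measure M (\<Union>i. L i) < d"
  proof -
    have "measure M (\<Union>i. L i) \<le> (\<Sum>i. measure M (L i))"
      using summ L by (intro finite_measure_subadditive_countably) auto
    also have "\<dots> \<le> (\<Sum>i. d / 4 * (1 / 2) ^ i)"
      using n(2) by (intro suminf_le summ sums_summable[OF sm]) (auto simp: L_def)
    also have "\<dots> = d / 2" using sums_unique[OF sm] by simp
    finally show ?thesis using d by simp
  qed
  define B where "B i = (if i = 1 then A else space M - A) - (\<Union>i. L i)" for i :: nat
  have B: "B i \<in> sets M" "0 < measure M (B i)" for i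
  proof -
    have m: "(if i = 1 then A else space M - A) \<in> sets M" by simp
    have U: "(\<Union>i. L i) \<in> sets M" using L by blast
    show "B i \<in> sets M" unfolding B_def by (rule sets.Diff[OF m U])
    have "measure M (if i = 1 then A else space M - A) \<ge> d"
      by (auto simp: d_def prob_compl)
    moreover have "measure M (if i = 1 then A else space M - A) \<le> measure M (B i) + measure M (\<Union>i. L i)"
    proof -
      have "measure M (if i = 1 then A else space M - A) \<le> measure M (B i \<union> (\<Union>i. L i))"
        unfolding B_def by (rule finite_measure_mono[OF _ sets.Un[OF sets.Diff[OF m U] U]]) blast
      also have "\<dots> \<le> measure M (B i) + measure M (\<Union>i. L i)"
        unfolding B_def using sets.Diff[OF m U] U by (rule measure_Un_le)
      finally show ?thesis .
    qed
    ultimately show "0 < measure M (B i)" using UL by linarith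
  qed
  then obtain F where F: "F \<in> Ind M T 2 B" "F \<in> F_pubd"
    using ind unfolding F_independent_of_order_def by blast
  have "F \<notin> F_pubd"
  proof (rule not_F_pubd_if_sparse_windows)
    fix e :: real assume e: "0 < e"
    obtain i where i: "1 / real (Suc i) < e * ln 2"
      using e nat_approx_posE[of "e * ln 2"] by (metis ln_gt_zero mult_pos_pos one_less_numeral_iff semiring_norm(76))
    have "card (F \<inter> {a..<a + n i}) \<le> e * n i" for a
    proof -
      have "card (F \<inter> {a..<a + n i}) * ln 2 \<le> 1 / Suc i * real (n i)"
      proof (rule card_independent_window[OF f(1) F(1)])
        fix x y assume "x \<in> B 1" "y \<in> B 2"
        then have "x \<in> A" "y \<in> space M" "y \<notin> A" by (auto simp: B_def)
        then show "?f x \<noteq> ?f y" using block_of_eq[OF p A(1)] block_of_in[OF p] by metis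
      next
        fix k :: nat and x assume "x \<in> B k"
        then have "x \<in> space M" "x \<notin> L i" using sets.sets_into_space[of A M] by (auto simp: B_def split: if_splits)
        then show "exp (- (1 / Suc i * real (n i))) \<le> atom_prob M (word T ?f (n i)) x"
          by (auto simp: L_def)
      qed simp
      also have "\<dots> \<le> (e * ln 2) * n i" using i by (intro mult_right_mono) auto
      finally have "card (F \<inter> {a..<a + n i}) * ln 2 \<le> (e * n i) * ln 2" by (simp add: mult_ac)
      then show ?thesis by simp
    qed
    then show "\<exists>n>0. \<forall>a. real (card (F \<inter> {a..<a + n})) \<le> e * real n" using n(1) by blast
  qed
  with F(2) show False by blast
qed

end

section \<open>Tail events have zero entropy\<close>

definition finite_var :: "'a measure \<Rightarrow> ('a \<Rightarrow> 'b) \<Rightarrow> bool" where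
  "finite_var M f \<longleftrightarrow> discrete_var M f \<and> finite (f ` space M)"

text \<open>Entropies of finite-valued variables are finite, so that they can be subtracted from each
  other as real numbers.\<close>

definition fent :: "'a measure \<Rightarrow> ('a \<Rightarrow> 'b) \<Rightarrow> real" where
  "fent M f = enn2real (ent M f)"

lemma finite_var_discrete: "finite_var M f \<Longrightarrow> discrete_var M f"
  by (simp add: finite_var_def)

lemma finite_var_Pair:
  assumes "finite_var M f" "finite_var M g"
  shows "finite_var M (\<lambda>x. (f x, g x))"
proof -
  have "(\<lambda>x. (f x, g x)) ` space M \<subseteq> f ` space M \<times> g ` space M" by auto
  then have "finite ((\<lambda>x. (f x, g x)) ` space M)"
    using assms by (meson finite_SigmaI finite_subset finite_var_def)
  then show ?thesis using assms discrete_var_Pair[of M f g] by (simp add: finite_var_def)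
qed

lemma finite_var_mem: "E \<in> sets M \<Longrightarrow> finite_var M (\<lambda>x. x \<in> E)"
proof -
  assume E: "E \<in> sets M"
  have "(\<lambda>x. x \<in> E) -` {b} \<inter> space M = (if b then E else space M - E)" for b
    using sets.sets_into_space[OF E] by auto
  then show ?thesis using E by (auto simp: finite_var_def discrete_var_def)
qed

context prob_space begin

lemma ennreal_fent: "finite_var M f \<Longrightarrow> ennreal (fent M f) = ent M f"
  using ent_finite[of f] by (simp add: fent_def finite_var_def)

lemma fent_nonneg: "0 \<le> fent M f" by (simp add: fent_def)

lemma fent_mono:
  assumes "finite_var M f" "finite_var M g"
    and "\<And>x y. x \<in> space M \<Longrightarrow> y \<in> space M \<Longrightarrow> f x = f y \<Longrightarrow> g x = g y"
  shows "fent M g \<le> fent M f"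
proof -
  have "ennreal (fent M g) \<le> ennreal (fent M f)"
    unfolding assms(1,2)[THEN ennreal_fent] by (rule ent_mono) (use assms finite_var_discrete in blast)+
  then show ?thesis by (simp add: fent_nonneg)
qed

lemma fent_cong:
  assumes "finite_var M f" "finite_var M g"
    and "\<And>x y. x \<in> space M \<Longrightarrow> y \<in> space M \<Longrightarrow> f x = f y \<longleftrightarrow> g x = g y"
  shows "fent M g = fent M f"
  using assms by (intro antisym fent_mono) blast+

lemma fent_submodular:
  assumes f: "finite_var M f" and g: "finite_var M g" and h: "finite_var M h"
  shows "fent M (\<lambda>x. (f x, g x, h x)) + fent M h \<le> fent M (\<lambda>x. (f x, h x)) + fent M (\<lambda>x. (g x, h x))"
proof -
  have "ennreal (fent M (\<lambda>x. (f x, g x, h x)) + fent M h) \<le> ennreal (fent M (\<lambda>x. (f x, h x)) + fent M (\<lambda>x. (g x, h x)))"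
    using ent_submodular[of f g h] assms
    by (simp add: fent_nonneg ennreal_fent finite_var_Pair finite_var_discrete)
  then show ?thesis by (subst (asm) ennreal_le_iff) (auto intro: add_nonneg_nonneg fent_nonneg)
qed

lemma fent_Pair_le:
  assumes f: "finite_var M f" and g: "finite_var M g"
  shows "fent M (\<lambda>x. (f x, g x)) \<le> fent M f + fent M g"
proof -
  have "ennreal (fent M (\<lambda>x. (f x, g x))) \<le> ennreal (fent M f + fent M g)"
    using ent_Pair_le[of f g] assms by (simp add: fent_nonneg ennreal_fent finite_var_Pair finite_var_discrete)
  then show ?thesis by (subst (asm) ennreal_le_iff) (auto intro: add_nonneg_nonneg fent_nonneg)
qed

text \<open>The bound \<open>ln y \<le> y - 1\<close> at \<open>y = 1 / sqrt p\<close>.\<close>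

lemma minus_p_ln_p_le: "- (p * ln p) \<le> 2 * sqrt p" if "0 \<le> p" for p :: real
proof (cases "p = 0")
  case False
  then have p: "0 < p" using that by simp
  have "ln (1 / sqrt p) \<le> 1 / sqrt p - 1" using p by (intro ln_le_minus_one) simp
  then have "- ln p \<le> 2 * (1 / sqrt p)" using p by (simp add: ln_div ln_sqrt)
  then have "p * (- ln p) \<le> p * (2 * (1 / sqrt p))" using p by (intro mult_left_mono) auto
  also have "\<dots> = 2 * (p / sqrt p)" by simp
  also have "\<dots> = 2 * sqrt p" using p by (simp only: real_div_sqrt[OF less_imp_le])
  finally show ?thesis by simp
qed simp

text \<open>The entropy of deciding an event tends to \<open>0\<close> with its probability; an explicit
  bound, obtained from \<open>2 * sqrt p\<close> for the event and \<open>p\<close> for its complement, is enough below.\<close>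

lemma fent_event_le:
  assumes E: "E \<in> sets M"
  shows "fent M (\<lambda>x. x \<in> E) \<le> 3 * sqrt (measure M E)"
proof -
  let ?p = "measure M E"
  have lev: "(\<lambda>x. x \<in> E) -` {b} \<inter> space M = (if b then E else space M - E)" for b
    using sets.sets_into_space[OF E] by auto
  note fv = finite_var_mem[OF E]
  have "ennreal (fent M (\<lambda>x. x \<in> E)) = ennreal (- (?p * ln ?p)) + ennreal (- ((1 - ?p) * ln (1 - ?p)))"
    unfolding ennreal_fent[OF fv] ent_eq_sum[OF finite_var_discrete[OF fv]] lev
    by (simp add: nn_integral_count_space_finite UNIV_bool prob_compl[OF E] add.commute)
  also have "\<dots> \<le> ennreal (2 * sqrt ?p) + ennreal ?p"
  proof (intro add_mono ennreal_leI)
    show "- (?p * ln ?p) \<le> 2 * sqrt ?p" by (rule minus_p_ln_p_le) simp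
    show "- ((1 - ?p) * ln (1 - ?p)) \<le> ?p"
    proof (cases "?p = 1")
      case False
      then have q: "0 < 1 - ?p" using prob_le_1[of E] by linarith
      have "ln (1 / (1 - ?p)) \<le> 1 / (1 - ?p) - 1" using q by (intro ln_le_minus_one) simp
      then have "(1 - ?p) * (- ln (1 - ?p)) \<le> (1 - ?p) * (1 / (1 - ?p) - 1)"
        using q by (intro mult_left_mono) (auto simp: ln_div)
      also have "\<dots> = ?p" using q by (simp add: right_diff_distrib)
      finally show ?thesis by simp
    qed simp
  qed
  also have "\<dots> = ennreal (2 * sqrt ?p + ?p)" by simp
  finally have "fent M (\<lambda>x. x \<in> E) \<le> 2 * sqrt ?p + ?p"
    by (subst (asm) ennreal_le_iff) auto
  moreover have "?p \<le> sqrt ?p"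
    using prob_le_1[of E] by (metis mult_left_le measure_nonneg real_sqrt_ge_0_iff real_sqrt_le_1_iff real_sqrt_mult_self abs_of_nonneg)
  ultimately show ?thesis by simp
qed

end

text \<open>The increments of \<open>h\<close> decrease. If one of them were below \<open>l\<close>, all later ones would be at least
  as far below \<open>l\<close>, and \<open>h n / n\<close> would eventually drop below \<open>l\<close>.\<close>

lemma antitone_increments_ge_rate:
  fixes h :: "nat \<Rightarrow> real"
  assumes conc: "\<And>n. h (Suc (Suc n)) + h n \<le> 2 * h (Suc n)"
    and rate: "\<And>n. 0 < n \<Longrightarrow> l \<le> h n / n"
  shows "n * l \<le> h (m + n) - h m"
proof -
  have dec: "h (Suc (m + j)) - h (m + j) \<le> h (Suc m) - h m" for m j
  proof (induction j)
    case (Suc j)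
    then show ?case using conc[of "m + j"] by simp
  qed simp
  have inc: "l \<le> h (Suc m) - h m" for m
  proof (rule ccontr)
    assume "\<not> ?thesis"
    then have c: "0 < l - (h (Suc m) - h m)" by simp
    have up: "h (m + j) \<le> h m + j * (h (Suc m) - h m)" for j
    proof (induction j)
      case (Suc j)
      then show ?case using dec[of m j] by (simp add: algebra_simps)
    qed simp
    obtain j where j: "(h m - m * l) / (l - (h (Suc m) - h m)) < real j" using reals_Archimedean2 by blast
    define i where "i = Suc j"
    have "(h m - m * l) / (l - (h (Suc m) - h m)) < real i" using j by (simp add: i_def)
    then have "h m - m * l < i * (l - (h (Suc m) - h m))" using c by (simp add: divide_less_eq)
    moreover have "real (m + i) * l \<le> h (m + i)"
      using rate[of "m + i"] by (simp add: i_def field_simps)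
    ultimately show False using up[of i] by (simp add: algebra_simps)
  qed
  show ?thesis
  proof (induction n)
    case (Suc n)
    then show ?case using inc[of "m + n"] by (simp add: algebra_simps)
  qed simp
qed

context mds begin

lemma finite_var_shift:
  assumes "finite_var M f" shows "finite_var M (\<lambda>x. f ((T ^^ j) x))"
proof -
  have "(\<lambda>x. f ((T ^^ j) x)) ` space M \<subseteq> f ` space M" using funpow_space by auto
  then show ?thesis
    using assms discrete_var_shift by (auto simp: finite_var_def intro: finite_subset)
qed

lemma finite_var_word:
  assumes "finite_var M f" shows "finite_var M (word T f n)"
proof -
  have "word T f n ` space M \<subseteq> {u. set u \<subseteq> f ` space M \<and> length u = n}"
    using funpow_space by (auto simp: word_def)
  then show ?thesis
    using assms discrete_var_word finite_lists_length_eq[of "f ` space M" n]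
    by (auto simp: finite_var_def intro: finite_subset)
qed

lemma fent_shift:
  assumes "finite_var M f" shows "fent M (\<lambda>x. f ((T ^^ j) x)) = fent M f"
  using ent_shift[OF finite_var_discrete[OF assms]] by (simp add: fent_def)

lemma word_ent_eq_fent: "word_ent f n = fent M (word T f n)"
  by (simp add: word_ent_def fent_def)

lemma word_ent_le:
  assumes f: "finite_var M f" shows "word_ent f n \<le> n * fent M f"
proof -
  have "ennreal (word_ent f n) \<le> ennreal (n * fent M f)"
    using ent_word_le[OF finite_var_discrete[OF f], of n]
    by (simp add: word_ent_eq_fent ennreal_fent f finite_var_word ennreal_mult fent_nonneg ennreal_of_nat_eq_real_of_nat)
  then show ?thesis by (subst (asm) ennreal_le_iff) (auto intro: mult_nonneg_nonneg fent_nonneg)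
qed

text \<open>Submodularity for the first and the last letter of a word of length \<open>n + 2\<close>, conditioned on the
  \<open>n\<close> letters in between.\<close>

lemma word_ent_concave:
  assumes f: "finite_var M f"
  shows "word_ent f (Suc (Suc n)) + word_ent f n \<le> 2 * word_ent f (Suc n)"
proof -
  let ?h = "\<lambda>x. word T f n ((T ^^ 1) x)" and ?l = "\<lambda>x. f ((T ^^ Suc n) x)"
  have h: "finite_var M ?h" by (rule finite_var_shift[OF finite_var_word[OF f]])
  have l: "finite_var M ?l" by (rule finite_var_shift[OF f])
  have Suc': "(\<forall>j<Suc k. P j) \<longleftrightarrow> P 0 \<and> (\<forall>j<k. P (Suc j))" for P k
    by (metis less_Suc_eq_0_disj)
  have T1: "(T ^^ j) ((T ^^ Suc 0) x) = (T ^^ Suc j) x" for j x by (simp add: funpow_swap1)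
  have hl: "?h x = ?h y \<longleftrightarrow> (\<forall>j<n. f ((T ^^ Suc j) x) = f ((T ^^ Suc j) y))" for x y
    by (simp add: word_eq_iff T1 del: funpow.simps)
  have "fent M (\<lambda>x. (f x, ?l x, ?h x)) = word_ent f (Suc (Suc n))"
    unfolding word_ent_eq_fent
  proof (rule fent_cong[OF finite_var_word[OF f] finite_var_Pair[OF f finite_var_Pair[OF l h]]])
    show "word T f (Suc (Suc n)) x = word T f (Suc (Suc n)) y \<longleftrightarrow> (f x, ?l x, ?h x) = (f y, ?l y, ?h y)" for x y
      unfolding word_eq_iff[of T f "Suc (Suc n)"] Suc'[of "Suc n"] prod.inject hl
      by (auto simp: less_Suc_eq simp del: funpow.simps(2))
  qed
  moreover have "fent M ?h = word_ent f n"
    unfolding word_ent_eq_fent by (rule fent_shift[OF finite_var_word[OF f]])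
  moreover have "fent M (\<lambda>x. (f x, ?h x)) = word_ent f (Suc n)"
    unfolding word_ent_eq_fent
  proof (rule fent_cong[OF finite_var_word[OF f] finite_var_Pair[OF f h]])
    show "word T f (Suc n) x = word T f (Suc n) y \<longleftrightarrow> (f x, ?h x) = (f y, ?h y)" for x y
      unfolding word_eq_iff[of T f "Suc n"] Suc'[of n] prod.inject hl by simp
  qed
  moreover have "fent M (\<lambda>x. (?l x, ?h x)) = word_ent f (Suc n)"
  proof -
    have "fent M (\<lambda>x. (?l x, ?h x)) = fent M (\<lambda>x. word T f (Suc n) ((T ^^ 1) x))"
    proof (rule fent_cong[OF finite_var_shift[OF finite_var_word[OF f]] finite_var_Pair[OF l h]])
      show "word T f (Suc n) ((T ^^ 1) x) = word T f (Suc n) ((T ^^ 1) y) \<longleftrightarrow> (?l x, ?h x) = (?l y, ?h y)" for x y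
        unfolding prod.inject hl by (auto simp: word_eq_iff T1 less_Suc_eq simp del: funpow.simps)
    qed
    then show ?thesis unfolding word_ent_eq_fent using fent_shift[OF finite_var_word[OF f]] by metis
  qed
  ultimately show ?thesis using fent_submodular[OF f l h] by simp
qed

text \<open>Write \<open>W\<close> for the \<open>a\<close>-word and \<open>V\<close> for the \<open>D\<close>-word of length \<open>N\<close>, and \<open>Q\<close> for a long \<open>a\<close>-word
  of length \<open>K\<close> that starts at time \<open>N\<close>. Up to an error of entropy \<open>N d\<close>, the word \<open>V\<close> is determined by the
  \<open>a\<close>-word of length \<open>N + L\<close>, where \<open>L\<close> does not depend on \<open>N\<close>; and up to the same error it is
  determined by \<open>Q\<close>, because \<open>D\<close> is a tail event. With \<open>H\<^sub>n\<close> the entropy of the \<open>a\<close>-word of length \<open>n\<close>,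
  submodularity gives
  \<open>H\<^sub>N\<^sub>+\<^sub>K + H(V) \<le> H(W, Q, V) + H(V) \<le> H(W, V) + H(Q, V) \<le> H\<^sub>N\<^sub>+\<^sub>L + H\<^sub>K + 2 N d\<close>. Since
  \<open>H\<^sub>N\<^sub>+\<^sub>K - H\<^sub>K\<close> is at least \<open>N\<close> times the rate of \<open>a\<close>, and \<open>H\<^sub>N\<^sub>+\<^sub>L / N\<close> tends to that rate,
  at most \<open>2 d\<close> is left for the limit of \<open>H(V) / N\<close>.\<close>

lemma tail_event_zero_entropy:
  fixes a :: "'a \<Rightarrow> 'b"
  assumes a: "finite_var M a" and D: "D \<in> sets M"
    and tail: "\<And>N e. 0 < e \<Longrightarrow> \<exists>L S. measure M {x \<in> space M. (x \<in> D) \<noteq> (word T a L ((T ^^ N) x) \<in> S)} < e"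
  shows "(\<lambda>n. word_ent (\<lambda>x. x \<in> D) n / n) \<longlonglongrightarrow> 0"
proof -
  let ?b = "\<lambda>x. x \<in> D"
  have b: "finite_var M ?b" by (rule finite_var_mem[OF D])
  note wa = finite_var_word[OF a] and wb = finite_var_word[OF b]
  note comp = funpow_add[THEN fun_cong, unfolded comp_apply]
  have approx: "\<exists>L S e. finite_var M e \<and> fent M e \<le> d \<and>
      (\<forall>x\<in>space M. x \<in> D \<longleftrightarrow> e x \<noteq> (word T a L ((T ^^ N) x) \<in> S))" if d: "0 < d" for N d
  proof -
    obtain L S where LS: "measure M {x \<in> space M. (x \<in> D) \<noteq> (word T a L ((T ^^ N) x) \<in> S)} < (d / 3)\<^sup>2"
      using tail[of "(d / 3)\<^sup>2" N] d by auto
    let ?E = "{x \<in> space M. (x \<in> D) \<noteq> (word T a L ((T ^^ N) x) \<in> S)}"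
    have "?E = (\<lambda>x. (x \<in> D, word T a L ((T ^^ N) x))) -` {(p, w). p \<noteq> (w \<in> S)} \<inter> space M" by auto
    also have "\<dots> \<in> sets M"
      by (rule discrete_var_vimage[OF finite_var_discrete[OF finite_var_Pair[OF b finite_var_shift[OF wa]]]])
    finally have E: "?E \<in> sets M" .
    \<comment> \<open>The tolerance \<open>(d / 3)\<^sup>2\<close> inverts this bound.\<close>
    have "fent M (\<lambda>x. x \<in> ?E) \<le> 3 * sqrt (measure M ?E)" by (rule fent_event_le[OF E])
    also have "\<dots> \<le> 3 * sqrt ((d / 3)\<^sup>2)"
      using LS by (intro mult_left_mono real_sqrt_le_mono) simp_all
    also have "\<dots> = d" using d by simp
    finally have "fent M (\<lambda>x. x \<in> ?E) \<le> d" .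
    then show ?thesis using finite_var_mem[OF E] by (intro exI[of _ L] exI[of _ S] exI[of _ "\<lambda>x. x \<in> ?E"]) auto
  qed
  obtain la where la: "(\<lambda>n. word_ent a n / n) \<longlonglongrightarrow> la" "\<And>n. 0 < n \<Longrightarrow> la \<le> word_ent a n / n"
    using word_ent_limit[of a] a ent_finite[of a] by (auto simp: finite_var_def)
  obtain lb where lb: "(\<lambda>n. word_ent ?b n / n) \<longlonglongrightarrow> lb" "0 \<le> lb"
    using word_ent_limit[of ?b] b ent_finite[of ?b] by (auto simp: finite_var_def)
  have "lb \<le> 2 * d" if d: "0 < d" for d
  proof -
    obtain L S e where e: "finite_var M e" "fent M e \<le> d"
      "\<And>x. x \<in> space M \<Longrightarrow> x \<in> D \<longleftrightarrow> e x \<noteq> (word T a L ((T ^^ 0) x) \<in> S)"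
      using approx[OF d, of 0] by blast
    have bound: "word_ent ?b N \<le> word_ent a (N + L) - N * la + 2 * N * d" for N
    proof -
      obtain L' S' e' where e': "finite_var M e'" "fent M e' \<le> d"
        "\<And>x. x \<in> space M \<Longrightarrow> x \<in> D \<longleftrightarrow> e' x \<noteq> (word T a L' ((T ^^ N) x) \<in> S')"
        using approx[OF d, of N] by blast
      define K where "K = N + L'"
      let ?W = "word T a N" and ?V = "word T ?b N" and ?Q = "\<lambda>x. word T a K ((T ^^ N) x)"
      have Q: "finite_var M ?Q" by (rule finite_var_shift[OF wa])
      have werr: "fent M (word T e N) \<le> N * d" "fent M (word T e' N) \<le> N * d"
        using word_ent_le[OF e(1), of N] word_ent_le[OF e'(1), of N] e(2) e'(2)
          mult_left_mono[of "fent M e" d "real N"] mult_left_mono[of "fent M e'" d "real N"]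
        by (auto simp: word_ent_eq_fent)
      have "fent M (\<lambda>x. (?W x, ?V x)) \<le> fent M (\<lambda>x. (word T a (N + L) x, word T e N x))"
      proof (rule fent_mono[OF finite_var_Pair[OF wa finite_var_word[OF e(1)]] finite_var_Pair[OF wa wb]])
        fix x y assume x: "x \<in> space M" and y: "y \<in> space M"
          and eq: "(word T a (N + L) x, word T e N x) = (word T a (N + L) y, word T e N y)"
        have aj: "a ((T ^^ j) x) = a ((T ^^ j) y)" if "j < N + L" for j
          using eq that by (simp add: word_eq_iff)
        have ej: "e ((T ^^ j) x) = e ((T ^^ j) y)" if "j < N" for j
          using eq that by (simp add: word_eq_iff)
        have "word T a L ((T ^^ j) x) = word T a L ((T ^^ j) y)" if "j < N" for j
          using that aj by (auto simp: word_eq_iff comp[symmetric])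
        then have "((T ^^ j) x \<in> D) = ((T ^^ j) y \<in> D)" if "j < N" for j
          using that ej e(3)[OF funpow_space[OF x]] e(3)[OF funpow_space[OF y]] by simp
        then show "(?W x, ?V x) = (?W y, ?V y)" using aj by (simp add: word_eq_iff)
      qed
      also have "\<dots> \<le> word_ent a (N + L) + N * d"
        using fent_Pair_le[OF wa finite_var_word[OF e(1)], of "N + L" N] werr(1) by (simp add: word_ent_eq_fent)
      finally have upper: "fent M (\<lambda>x. (?W x, ?V x)) \<le> word_ent a (N + L) + N * d" .
      have "fent M (\<lambda>x. (?Q x, ?V x)) \<le> fent M (\<lambda>x. (?Q x, word T e' N x))"
      proof (rule fent_mono[OF finite_var_Pair[OF Q finite_var_word[OF e'(1)]] finite_var_Pair[OF Q wb]])
        fix x y assume x: "x \<in> space M" and y: "y \<in> space M"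
          and eq: "(?Q x, word T e' N x) = (?Q y, word T e' N y)"
        have aj: "a ((T ^^ j) ((T ^^ N) x)) = a ((T ^^ j) ((T ^^ N) y))" if "j < K" for j
          using eq that by (simp add: word_eq_iff)
        have ej: "e' ((T ^^ j) x) = e' ((T ^^ j) y)" if "j < N" for j
          using eq that by (simp add: word_eq_iff)
        have "word T a L' ((T ^^ N) ((T ^^ j) x)) = word T a L' ((T ^^ N) ((T ^^ j) y))" if "j < N" for j
          unfolding word_eq_iff
        proof (intro allI impI)
          fix i assume "i < L'"
          then show "a ((T ^^ i) ((T ^^ N) ((T ^^ j) x))) = a ((T ^^ i) ((T ^^ N) ((T ^^ j) y)))"
            using aj[of "i + j"] that by (simp add: K_def comp[symmetric] add_ac)
        qed
        then have "((T ^^ j) x \<in> D) = ((T ^^ j) y \<in> D)" if "j < N" for j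
          using that ej e'(3)[OF funpow_space[OF x]] e'(3)[OF funpow_space[OF y]] by simp
        then show "(?Q x, ?V x) = (?Q y, ?V y)" using eq by (simp add: word_eq_iff)
      qed
      also have "\<dots> \<le> word_ent a K + N * d"
        using fent_Pair_le[OF Q finite_var_word[OF e'(1)], of N] werr(2) fent_shift[OF wa, of K N]
        by (simp add: word_ent_eq_fent)
      finally have QV: "fent M (\<lambda>x. (?Q x, ?V x)) \<le> word_ent a K + N * d" .
      have "word_ent a (N + K) \<le> fent M (\<lambda>x. (?W x, ?Q x, ?V x))"
        unfolding word_ent_eq_fent
        by (rule fent_mono[OF finite_var_Pair[OF wa finite_var_Pair[OF Q wb]] wa]) (simp add: word_add)
      moreover have "fent M (\<lambda>x. (?W x, ?Q x, ?V x)) + fent M ?V \<le> fent M (\<lambda>x. (?W x, ?V x)) + fent M (\<lambda>x. (?Q x, ?V x))"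
        by (rule fent_submodular[OF wa Q wb])
      moreover have "N * la \<le> word_ent a (K + N) - word_ent a K"
        by (rule antitone_increments_ge_rate[OF word_ent_concave[OF a] la(2)])
      ultimately show ?thesis using upper QV by (simp add: word_ent_eq_fent add.commute)
    qed
    have sub: "word_ent a (N + L) \<le> word_ent a N + word_ent a L" for N
    proof -
      have "ennreal (word_ent a (N + L)) \<le> ennreal (word_ent a N + word_ent a L)"
        using ent_word_add[OF finite_var_discrete[OF a], of N L]
        by (simp add: word_ent_eq_fent ennreal_fent wa fent_nonneg)
      then show ?thesis by (subst (asm) ennreal_le_iff) (auto simp: word_ent_nonneg intro: add_nonneg_nonneg)
    qed
    have "(\<lambda>N. word_ent a N / N + word_ent a L / N - la + 2 * d) \<longlonglongrightarrow> la + 0 - la + 2 * d"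
      by (intro tendsto_intros la(1) lim_const_over_n)
    moreover have "word_ent ?b N / N \<le> word_ent a N / N + word_ent a L / N - la + 2 * d" if "1 \<le> N" for N
      using bound[of N] sub[of N] that by (simp add: field_simps)
    ultimately have "lb \<le> la + 0 - la + 2 * d"
      by (intro LIMSEQ_le[OF lb(1)]) blast+
    then show ?thesis by simp
  qed
  \<comment> \<open>The bound \<open>lb \<le> 2 d\<close> at \<open>d = lb / 4\<close> excludes \<open>lb > 0\<close>.\<close>
  from this[of "lb / 4"] lb(2) have "lb = 0" by (cases "lb = 0") auto
  then show ?thesis using lb(1) by simp
qed

end

section \<open>Triviality of the tail and growth of hulls\<close>

text \<open>The \<open>\<sigma>\<close>-algebra of the events that are decided by the letters read from time \<open>N\<close> on.\<close>

definition future :: "'a measure \<Rightarrow> ('a \<Rightarrow> 'a) \<Rightarrow> ('a \<Rightarrow> 'b) \<Rightarrow> nat \<Rightarrow> 'a measure" where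
  "future M T a N = sigma (space M) {preim M T j (a -` {v} \<inter> space M) | j v. N \<le> j}"

text \<open>Up to null sets this is the smallest event of \<open>future M T a N\<close> that contains \<open>E\<close>; the property
  that characterises it is \<open>hull_null_iff\<close>.\<close>

definition meas_hull :: "'a measure \<Rightarrow> ('a \<Rightarrow> 'a) \<Rightarrow> ('a \<Rightarrow> 'b) \<Rightarrow> nat \<Rightarrow> 'a set \<Rightarrow> 'a set" where
  "meas_hull M T a N E = {x \<in> space M. 0 < real_cond_exp M (future M T a N) (indicat_real E) x}"

lemma space_future [simp]: "space (future M T a N) = space M"
  unfolding future_def by (rule space_measure_of) (auto simp: preim_def)

lemma sets_future:
  "sets (future M T a N) = sigma_sets (space M) {preim M T j (a -` {v} \<inter> space M) | j v. N \<le> j}"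
  unfolding future_def by (rule sets_measure_of) (auto simp: preim_def)

lemma future_antimono: "N \<le> N' \<Longrightarrow> sets (future M T a N') \<subseteq> sets (future M T a N)"
  unfolding sets_future by (rule sigma_sets_mono') (use order_trans in blast)

context mds begin

lemma preim_preim: "preim M T m (preim M T j B) = preim M T (j + m) B"
  using funpow_space by (auto simp: preim_def funpow_add)

lemma future_sub: "discrete_var M a \<Longrightarrow> sets (future M T a N) \<subseteq> sets M"
  unfolding sets_future
  by (rule sets.sigma_sets_subset) (auto simp: discrete_var_def intro: sets_preim)

lemma future_shift: "sets (future M T a (N + m)) = {preim M T m B | B. B \<in> sets (future M T a N)}"
proof -
  have "{preim M T m B | B. B \<in> sets (future M T a N)} =
      {(T ^^ m) -` B \<inter> space M | B. B \<in> sigma_sets (space M) {preim M T j (a -` {v} \<inter> space M) | j v. N \<le> j}}"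
    unfolding sets_future by (simp only: preim_def)
  also have "\<dots> = sigma_sets (space M) {(T ^^ m) -` B \<inter> space M | B. B \<in> {preim M T j (a -` {v} \<inter> space M) | j v. N \<le> j}}"
    by (rule sigma_sets_vimage_commute) (use funpow_space in auto)
  also have "{(T ^^ m) -` B \<inter> space M | B. B \<in> {preim M T j (a -` {v} \<inter> space M) | j v. N \<le> j}}
      = {preim M T j (a -` {v} \<inter> space M) | j v. N + m \<le> j}" (is "?L = ?R")
  proof
    show "?L \<subseteq> ?R"
    proof
      fix X assume "X \<in> ?L"
      then obtain j v where "N \<le> j" "X = preim M T m (preim M T j (a -` {v} \<inter> space M))"
        by (auto simp: preim_def[of M T m])
      then have "X = preim M T (j + m) (a -` {v} \<inter> space M)" "N + m \<le> j + m" by (simp_all add: preim_preim)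
      then show "X \<in> ?R" by blast
    qed
    show "?R \<subseteq> ?L"
    proof
      fix X assume "X \<in> ?R"
      then obtain j v where j: "N + m \<le> j" "X = preim M T j (a -` {v} \<inter> space M)" by blast
      then have "X = preim M T m (preim M T (j - m) (a -` {v} \<inter> space M))" "N \<le> j - m"
        by (simp_all add: preim_preim)
      then show "X \<in> ?L" unfolding preim_def[of M T m] by blast
    qed
  qed
  finally show ?thesis unfolding sets_future by simp
qed

lemma funpow_measurable_future: "(T ^^ m) \<in> future M T a (N + m) \<rightarrow>\<^sub>M future M T a N"
proof (rule measurableI)
  fix B assume "B \<in> sets (future M T a N)"
  then show "(T ^^ m) -` B \<inter> space (future M T a (N + m)) \<in> sets (future M T a (N + m))"
    unfolding future_shift by (auto simp: preim_def)
qed (use funpow_space in simp)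

text \<open>Events that are approximable in measure by finite words form a \<open>\<sigma>\<close>-algebra: a countable
  union is first cut off after finitely many terms, and finitely many approximating words are prefixes
  of a common longer one.\<close>

lemma future_approximable:
  fixes a :: "'a \<Rightarrow> 'b"
  assumes a: "discrete_var M a" and D: "D \<in> sets (future M T a N)" and e: "0 < e"
  shows "\<exists>L S. measure M {x \<in> space M. (x \<in> D) \<noteq> (word T a L ((T ^^ N) x) \<in> S)} < e"
  using D e unfolding sets_future
proof (induction arbitrary: e rule: sigma_sets.induct)
  case (Basic D)
  then obtain j v where j: "N \<le> j" "D = preim M T j (a -` {v} \<inter> space M)" by blast
  have "word T a (Suc (j - N)) ((T ^^ N) x) ! (j - N) = a ((T ^^ j) x)" for x
    using j(1) by (simp add: funpow_add[THEN fun_cong, unfolded comp_apply, symmetric])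
  then have none: "{x \<in> space M. (x \<in> D) \<noteq> (word T a (Suc (j - N)) ((T ^^ N) x) \<in> {w. w ! (j - N) = v})} = {}"
    using j(2) funpow_space by (auto simp: preim_def)
  show ?case
    by (intro exI[of _ "Suc (j - N)"] exI[of _ "{w. w ! (j - N) = v}"]) (unfold none, use Basic(2) in simp)
next
  case Empty
  then show ?case by (intro exI[of _ 0] exI[of _ "{}"]) simp
next
  case (Compl D)
  obtain L S where "measure M {x \<in> space M. (x \<in> D) \<noteq> (word T a L ((T ^^ N) x) \<in> S)} < e"
    using Compl by blast
  moreover have "{x \<in> space M. (x \<in> space M - D) \<noteq> (word T a L ((T ^^ N) x) \<in> - S)} =
      {x \<in> space M. (x \<in> D) \<noteq> (word T a L ((T ^^ N) x) \<in> S)}" by auto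
  ultimately show ?case by (intro exI[of _ L] exI[of _ "- S"]) simp
next
  case (Union A)
  have A: "A i \<in> sets M" for i
    using Union(1)[of i] future_sub[OF a, of N] by (auto simp: sets_future)
  have w: "discrete_var M (\<lambda>x. word T a L ((T ^^ N) x))" for L
    by (rule discrete_var_shift[OF discrete_var_word[OF a]])
  define U where "U n = (\<Union>i<n. A i)" for n
  have "incseq U" unfolding incseq_def U_def by (intro allI impI UN_mono) auto
  moreover have UU: "(\<Union>n. U n) = (\<Union>i. A i)" by (auto simp: U_def)
  moreover have U: "U n \<in> sets M" for n using A by (auto simp: U_def)
  ultimately have "(\<lambda>n. measure M (U n)) \<longlonglongrightarrow> measure M (\<Union>i. A i)"
    using finite_Lim_measure_incseq[of U] by auto
  then have "eventually (\<lambda>n. measure M (\<Union>i. A i) - e / 2 < measure M (U n)) sequentially"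
    using Union(3) by (intro order_tendstoD(1)) auto
  then have "\<exists>n. measure M (\<Union>i. A i) - e / 2 < measure M (U n)"
    by (rule eventually_happens'[OF sequentially_bot])
  then obtain n where n: "measure M (\<Union>i. A i) - e / 2 < measure M (U n)" ..
  \<comment> \<open>The number \<open>n\<close> of terms is fixed first, so that the \<open>n\<close> errors add up to at most \<open>e / 2\<close>.\<close>
  have "\<exists>p. measure M {x \<in> space M. (x \<in> A i) \<noteq> (word T a (fst p) ((T ^^ N) x) \<in> snd p)} < e / (2 * real (Suc n))" for i
    using Union(2)[of "e / (2 * real (Suc n))" i] Union(3) by (simp add: field_simps)
  then have "\<exists>p. \<forall>i. measure M {x \<in> space M. (x \<in> A i) \<noteq> (word T a (fst (p i)) ((T ^^ N) x) \<in> snd (p i))} < e / (2 * real (Suc n))"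
    by (intro choice allI)
  then obtain p where p: "\<And>i. measure M {x \<in> space M. (x \<in> A i) \<noteq> (word T a (fst (p i)) ((T ^^ N) x) \<in> snd (p i))} < e / (2 * real (Suc n))"
    by blast
  define L where "L = (\<Sum>i<n. fst (p i))"
  define S where "S = {w. \<exists>i<n. take (fst (p i)) w \<in> snd (p i)}"
  let ?E = "\<lambda>i. {x \<in> space M. (x \<in> A i) \<noteq> (word T a (fst (p i)) ((T ^^ N) x) \<in> snd (p i))}"
  have E: "?E i \<in> sets M" for i
  proof -
    have "{x \<in> space M. word T a (fst (p i)) ((T ^^ N) x) \<in> snd (p i)} \<in> sets M"
      using discrete_var_vimage[OF w[of "fst (p i)"], of "snd (p i)"] by (simp add: vimage_def Int_def conj_commute)
    then have "(A i - {x \<in> space M. word T a (fst (p i)) ((T ^^ N) x) \<in> snd (p i)}) \<union>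
        ({x \<in> space M. word T a (fst (p i)) ((T ^^ N) x) \<in> snd (p i)} - A i) \<in> sets M" using A[of i] by blast
    also have "(A i - {x \<in> space M. word T a (fst (p i)) ((T ^^ N) x) \<in> snd (p i)}) \<union>
        ({x \<in> space M. word T a (fst (p i)) ((T ^^ N) x) \<in> snd (p i)} - A i) = ?E i"
      using sets.sets_into_space[OF A[of i]] by auto
    finally show ?thesis .
  qed
  have take: "take (fst (p i)) (word T a L y) = word T a (fst (p i)) y" if "i < n" for i y
  proof -
    have "fst (p i) \<le> L" unfolding L_def using that by (intro member_le_sum) auto
    then show ?thesis by (intro nth_equalityI) auto
  qed
  have "{x \<in> space M. (x \<in> (\<Union>i. A i)) \<noteq> (word T a L ((T ^^ N) x) \<in> S)} \<subseteq> ((\<Union>i. A i) - U n) \<union> (\<Union>i<n. ?E i)"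
    using take by (auto simp: S_def U_def)
  then have "measure M {x \<in> space M. (x \<in> (\<Union>i. A i)) \<noteq> (word T a L ((T ^^ N) x) \<in> S)}
      \<le> measure M (((\<Union>i. A i) - U n) \<union> (\<Union>i<n. ?E i))"
    using A U E by (intro finite_measure_mono) auto
  also have "\<dots> \<le> measure M ((\<Union>i. A i) - U n) + measure M (\<Union>i<n. ?E i)"
    using A U E by (intro measure_Un_le) auto
  also have "measure M ((\<Union>i. A i) - U n) = measure M (\<Union>i. A i) - measure M (U n)"
    using A U by (intro finite_measure_Diff) (auto simp: U_def)
  also have "measure M (\<Union>i<n. ?E i) \<le> (\<Sum>i<n. measure M (?E i))"
    using E by (intro finite_measure_subadditive_finite) auto
  also have "\<dots> \<le> (\<Sum>i<n. e / (2 * real (Suc n)))"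
    using p by (intro sum_mono less_imp_le)
  also have "\<dots> \<le> e / 2" using Union(3) by (simp add: field_simps)
  finally have "measure M {x \<in> space M. (x \<in> (\<Union>i. A i)) \<noteq> (word T a L ((T ^^ N) x) \<in> S)} < e"
    using n by simp
  then show ?case by blast
qed

text \<open>Otherwise \<open>D\<close> and its complement would form a partition of positive entropy whose
  entropy rate is \<open>0\<close>.\<close>

lemma tail_trivial:
  assumes cpe: "completely_positive_entropy M T" and a: "finite_var M a"
    and D: "\<And>N. D \<in> sets (future M T a N)"
  shows "measure M D = 0 \<or> measure M D = 1"
proof (rule ccontr)
  assume "\<not> ?thesis"
  then have mD: "0 < measure M D" "measure M D < 1"
    using prob_le_1[of D] by (auto simp: zero_less_measure_iff less_le)
  have DM: "D \<in> sets M" using D future_sub[OF finite_var_discrete[OF a]] by blast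
  have Dsub: "D \<subseteq> space M" by (rule sets.sets_into_space[OF DM])
  have "(\<lambda>n. word_ent (\<lambda>x. x \<in> D) n / n) \<longlonglongrightarrow> 0"
    by (rule tail_event_zero_entropy[OF a DM]) (rule future_approximable[OF finite_var_discrete[OF a] D])
  define \<beta> where "\<beta> = {D, space M - D}"
  have ne: "D \<noteq> {}" "space M - D \<noteq> {}"
    using mD prob_space measure_empty by (auto simp: Diff_eq_empty_iff dest: subset_antisym[OF Dsub])
  have Dne: "D \<noteq> space M - D" using ne by blast
  have p: "partition_on (space M) \<beta>"
    using Dsub ne by (auto simp: \<beta>_def partition_on_def disjoint_def)
  have \<beta>: "measurable_partition M \<beta>"
    using p DM by (auto simp: measurable_partition_def \<beta>_def)
  have ln: "0 < - (q * ln q)" if "0 < q" "q < 1" for q :: real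
    using that by (simp add: mult_pos_neg)
  have H: "partition_entropy M \<beta> = ennreal (- (measure M D * ln (measure M D)))
      + ennreal (- (measure M (space M - D) * ln (measure M (space M - D))))"
    unfolding partition_entropy_def \<beta>_def using Dne by (subst infsum_finite) simp_all
  have fin: "partition_entropy M \<beta> < \<infinity>" unfolding H by simp
  have pos: "0 < partition_entropy M \<beta>" unfolding H using ln[OF mD] by (simp add: add_pos_nonneg)
  obtain l where l: "(\<lambda>n. word_ent (block_of \<beta>) n / n) \<longlonglongrightarrow> l" "entropy_rate M T \<beta> = ennreal l"
    using entropy_rate_limit[OF \<beta> fin] by blast
  have "word_ent (block_of \<beta>) n = word_ent (\<lambda>x. x \<in> D) n" for n
  proof -
    have bl: "block_of \<beta> x = (if x \<in> D then D else space M - D)" if "x \<in> space M" for x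
      using that block_of_eq[OF p, of D x] block_of_eq[OF p, of "space M - D" x]
      by (simp add: \<beta>_def)
    have "block_of \<beta> x = block_of \<beta> y \<longleftrightarrow> (x \<in> D) = (y \<in> D)" if "x \<in> space M" "y \<in> space M" for x y
      using ne bl[OF that(1)] bl[OF that(2)] by auto
    then have "ent M (word T (block_of \<beta>) n) = ent M (word T (\<lambda>x. x \<in> D) n)"
      using funpow_space
      by (intro ent_cong discrete_var_word discrete_var_block_of[OF \<beta>] finite_var_discrete[OF finite_var_mem[OF DM]])
        (simp add: word_eq_iff)
    then show ?thesis by (simp add: word_ent_def)
  qed
  then have "l = 0" using LIMSEQ_unique[OF l(1)] \<open>_ \<longlonglongrightarrow> 0\<close> by simp
  then show False using cpe \<beta> pos fin l(2) unfolding completely_positive_entropy_def by fastforce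
qed

lemma subalgebra_future:
  "discrete_var M a \<Longrightarrow> finite_measure_subalgebra M (future M T a N)"
  by unfold_locales (simp add: subalgebra_def future_sub)

lemma hull_in_future:
  assumes "discrete_var M a" shows "meas_hull M T a N E \<in> sets (future M T a N)"
proof -
  have "{x \<in> space (future M T a N). 0 < real_cond_exp M (future M T a N) (indicat_real E) x} \<in> sets (future M T a N)"
    by measurable
  then show ?thesis by (simp add: meas_hull_def)
qed

lemma integrable_event: "E \<in> sets M \<Longrightarrow> integrable M (indicat_real E)"
  by (intro integrable_real_indicator) (auto simp: emeasure_eq_measure)

text \<open>Both sides say that the conditional probability of \<open>E\<close>, which is nonnegative and whose
  integral over \<open>Z\<close> is the measure of \<open>E \<inter> Z\<close>, vanishes almost everywhere on \<open>Z\<close>.\<close>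

lemma hull_null_iff:
  assumes a: "discrete_var M a" and E: "E \<in> sets M" and Z: "Z \<in> sets (future M T a N)"
  shows "measure M (meas_hull M T a N E \<inter> Z) = 0 \<longleftrightarrow> measure M (E \<inter> Z) = 0"
proof -
  let ?F = "future M T a N"
  let ?e = "real_cond_exp M ?F (indicat_real E)"
  interpret F: finite_measure_subalgebra M ?F by (rule subalgebra_future[OF a])
  have ZM: "Z \<in> sets M" using Z future_sub[OF a] by blast
  have HM: "meas_hull M T a N E \<in> sets M" using hull_in_future[OF a] future_sub[OF a] by blast
  have int: "integrable M (\<lambda>x. indicat_real Z x * indicat_real E x)"
    by (rule integrable_real_mult_indicator[OF E integrable_event[OF ZM]])
  have e_int: "integrable M (\<lambda>x. indicat_real Z x * ?e x)"
    and e_eq: "(\<integral>x. indicat_real Z x * ?e x \<partial>M) = (\<integral>x. indicat_real Z x * indicat_real E x \<partial>M)"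
    using F.real_cond_exp_intg[OF int] Z E by auto
  have "(\<integral>x. indicat_real Z x * indicat_real E x \<partial>M) = measure M (E \<inter> Z)"
    using E ZM by (simp add: indicator_inter_arith[symmetric] Int_commute)
  then have eq: "(\<integral>x. indicat_real Z x * ?e x \<partial>M) = measure M (E \<inter> Z)" using e_eq by simp
  have pos: "AE x in M. 0 \<le> ?e x" using E by (intro F.real_cond_exp_pos) auto
  have "(\<integral>x. indicat_real Z x * ?e x \<partial>M) = 0 \<longleftrightarrow> (AE x in M. indicat_real Z x * ?e x = 0)"
    using pos by (intro integral_nonneg_eq_0_iff_AE[OF e_int]) (auto simp: indicator_def)
  also have "\<dots> \<longleftrightarrow> (AE x in M. x \<notin> meas_hull M T a N E \<inter> Z)"
  proof
    assume "AE x in M. indicat_real Z x * ?e x = 0"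
    then show "AE x in M. x \<notin> meas_hull M T a N E \<inter> Z" by eventually_elim (auto simp: meas_hull_def)
  next
    assume "AE x in M. x \<notin> meas_hull M T a N E \<inter> Z"
    then show "AE x in M. indicat_real Z x * ?e x = 0"
      using pos AE_space by eventually_elim (auto simp: meas_hull_def indicator_def)
  qed
  also have "\<dots> \<longleftrightarrow> measure M (meas_hull M T a N E \<inter> Z) = 0"
    using sets.Int[OF HM ZM] by (subst AE_iff_null_sets[symmetric]) (auto simp: null_sets_def emeasure_eq_measure)
  finally show ?thesis using eq by simp
qed

text \<open>By \<open>hull_null_iff\<close> the hulls contain \<open>E\<close> and increase, up to null sets. Their upper limit is
  therefore a tail event of positive measure, which has measure \<open>1\<close>, and so has the
  union of the hulls.\<close>

lemma hull_tendsto_1: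
  assumes cpe: "completely_positive_entropy M T" and a: "finite_var M a"
    and E: "E \<in> sets M" "0 < measure M E"
  shows "(\<lambda>N. measure M (meas_hull M T a N E)) \<longlonglongrightarrow> 1"
proof -
  let ?h = "\<lambda>N. meas_hull M T a N E"
  note d = finite_var_discrete[OF a]
  have hN: "?h N \<in> sets (future M T a N)" for N by (rule hull_in_future[OF d])
  have hM: "?h N \<in> sets M" for N using hN future_sub[OF d] by blast
  have compl: "space M - ?h N \<in> sets (future M T a N)" for N
    using sets.compl_sets[OF hN[of N]] by simp
  have E_null: "measure M (E - ?h N) = 0" for N
  proof -
    have "?h N \<inter> (space M - ?h N) = {}" by auto
    then have "measure M (E \<inter> (space M - ?h N)) = 0"
      using hull_null_iff[OF d E(1) compl[of N]] by simp
    moreover have "E \<inter> (space M - ?h N) = E - ?h N" using sets.sets_into_space[OF E(1)] by auto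
    ultimately show ?thesis by simp
  qed
  have mono_null: "measure M (?h m - ?h n) = 0" if "m \<le> n" for m n
  proof -
    have "space M - ?h n \<in> sets (future M T a m)" using compl[of n] future_antimono[OF that] by blast
    moreover have "E \<inter> (space M - ?h n) = E - ?h n" using sets.sets_into_space[OF E(1)] by auto
    ultimately have "measure M (?h m \<inter> (space M - ?h n)) = 0"
      using hull_null_iff[OF d E(1), of "space M - ?h n" m] E_null[of n] by simp
    moreover have "?h m \<inter> (space M - ?h n) = ?h m - ?h n" by (auto simp: meas_hull_def)
    ultimately show ?thesis by simp
  qed
  define H where "H = (\<Inter>N. \<Union>m\<in>{N..}. ?h m)"
  \<comment> \<open>Dropping the first \<open>N\<close> terms does not change the upper limit.\<close>
  have H_tail: "H \<in> sets (future M T a N)" for N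
  proof -
    have "H = (\<Inter>n\<in>{N..}. \<Union>m\<in>{n..}. ?h m)"
    proof (intro subset_antisym subsetI)
      fix x assume x: "x \<in> (\<Inter>n\<in>{N..}. \<Union>m\<in>{n..}. ?h m)"
      show "x \<in> H" unfolding H_def
      proof
        fix n
        have "x \<in> (\<Union>m\<in>{max n N..}. ?h m)" using x by (rule INT_D) simp
        then show "x \<in> (\<Union>m\<in>{n..}. ?h m)" by auto
      qed
    qed (auto simp: H_def)
    also have "\<dots> \<in> sets (future M T a N)"
    proof (rule sets.countable_INT')
      have "?h m \<in> sets (future M T a N)" if "N \<le> m" for m
        using hN[of m] future_antimono[OF that] by blast
      then show "(\<lambda>n. \<Union>m\<in>{n..}. ?h m) ` {N..} \<subseteq> sets (future M T a N)"
        by (intro image_subsetI sets.countable_UN') auto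
    qed auto
    finally show ?thesis .
  qed
  have HM: "H \<in> sets M" using H_tail future_sub[OF d] by blast
  have "measure M H \<noteq> 0"
  proof
    assume H0: "measure M H = 0"
    have "E \<subseteq> H \<union> (\<Union>N. E - ?h N)" by (auto simp: H_def)
    moreover have "measure M (H \<union> (\<Union>N. E - ?h N)) = 0"
    proof -
      have "(\<Union>N. E - ?h N) \<in> null_sets M"
        using E_null E(1) hM by (intro null_sets_UN) (auto simp: null_sets_def emeasure_eq_measure)
      moreover have "H \<in> null_sets M" using H0 HM by (auto simp: null_sets_def emeasure_eq_measure)
      ultimately have "H \<union> (\<Union>N. E - ?h N) \<in> null_sets M" by (metis null_sets.Un)
      then show ?thesis by (simp add: null_sets_def emeasure_eq_measure)
    qed
    ultimately have "measure M E \<le> 0"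
      using finite_measure_mono[of E "H \<union> (\<Union>N. E - ?h N)"] HM hM E(1) by (metis sets.Un sets.Diff sets.countable_UN'' countableI_type)
    then show False using E(2) by simp
  qed
  then have H1: "measure M H = 1" using tail_trivial[OF cpe a H_tail] by blast
  define U where "U n = (\<Union>m\<le>n. ?h m)" for n
  have UM: "U n \<in> sets M" for n unfolding U_def using hM by auto
  have "incseq U" by (fastforce simp: U_def incseq_def)
  then have lim: "(\<lambda>n. measure M (U n)) \<longlonglongrightarrow> measure M (\<Union>n. U n)"
    using finite_Lim_measure_incseq[of U] UM by auto
  have "measure M H \<le> measure M (\<Union>n. U n)"
  proof (rule finite_measure_mono)
    show "H \<subseteq> (\<Union>n. U n)"
    proof
      fix x assume "x \<in> H"
      then have "x \<in> (\<Union>m\<in>{0..}. ?h m)" unfolding H_def by (rule INT_D) simp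
      then obtain m where "x \<in> ?h m" by blast
      then have "x \<in> U m" by (auto simp: U_def)
      then show "x \<in> (\<Union>n. U n)" by blast
    qed
  qed (use UM in blast)
  then have U1: "measure M (\<Union>n. U n) = 1" using H1 prob_le_1[of "\<Union>n. U n"] by linarith
  have "measure M (U n) = measure M (?h n)" for n
  proof (rule antisym)
    have "U n \<subseteq> ?h n \<union> (\<Union>m\<le>n. ?h m - ?h n)" by (auto simp: U_def)
    then have "measure M (U n) \<le> measure M (?h n \<union> (\<Union>m\<le>n. ?h m - ?h n))"
      using hM by (intro finite_measure_mono) auto
    also have "\<dots> \<le> measure M (?h n) + measure M (\<Union>m\<le>n. ?h m - ?h n)"
      using hM by (intro measure_Un_le) auto
    also have "measure M (\<Union>m\<le>n. ?h m - ?h n) \<le> (\<Sum>m\<le>n. measure M (?h m - ?h n))"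
      using hM by (intro finite_measure_subadditive_finite) auto
    also have "\<dots> = 0" by (simp add: mono_null)
    finally show "measure M (U n) \<le> measure M (?h n)" by simp
    show "measure M (?h n) \<le> measure M (U n)"
      using UM by (intro finite_measure_mono) (auto simp: U_def)
  qed
  then show ?thesis using lim U1 by simp
qed

end

section \<open>Shattered sets of times\<close>

definition pattern :: "'a measure \<Rightarrow> ('a \<Rightarrow> 'a) \<Rightarrow> nat \<Rightarrow> (nat \<Rightarrow> 'a set) \<Rightarrow> nat set \<Rightarrow> (nat \<Rightarrow> nat) \<Rightarrow> 'a set" where
  "pattern M T m A J s = {x \<in> space M. \<forall>j\<in>J. (T ^^ (m * j)) x \<in> A (s j)}"

text \<open>Times are counted in multiples of the gap \<open>m\<close>. For \<open>m = 1\<close>, \<open>D = space M\<close>,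
  \<open>k \<ge> 1\<close> and measurable \<open>A i\<close>, this says that the finite set \<open>J\<close> belongs to \<open>Ind M T k A\<close>.\<close>

definition shattered :: "'a measure \<Rightarrow> ('a \<Rightarrow> 'a) \<Rightarrow> nat \<Rightarrow> nat \<Rightarrow> (nat \<Rightarrow> 'a set) \<Rightarrow> 'a set \<Rightarrow> nat set \<Rightarrow> bool" where
  "shattered M T m k A D J \<longleftrightarrow>
    (\<forall>s. (\<forall>j\<in>J. s j \<in> {1..k}) \<longrightarrow> measure M (D \<inter> pattern M T m A J s) > 0)"

text \<open>The points whose future from time \<open>m\<close> on makes one of the events \<open>A i\<close> unlikely.\<close>

definition bad_set :: "'a measure \<Rightarrow> ('a \<Rightarrow> 'a) \<Rightarrow> ('a \<Rightarrow> 'b) \<Rightarrow> nat \<Rightarrow> nat \<Rightarrow> (nat \<Rightarrow> 'a set) \<Rightarrow> real \<Rightarrow> 'a set" where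
  "bad_set M T a m k A p = {x \<in> space M. \<exists>i\<in>{1..k}. real_cond_exp M (future M T a m) (indicat_real (A i)) x < p}"

text \<open>A factor \<open>1 - p\<close> for every visit to \<open>Z\<close>. In \<open>exists_shattered\<close> it pays for the times at which
  nothing is known about the conditional probabilities of the \<open>A i\<close>.\<close>

definition penalty :: "('a \<Rightarrow> 'a) \<Rightarrow> nat \<Rightarrow> 'a set \<Rightarrow> real \<Rightarrow> nat \<Rightarrow> 'a \<Rightarrow> real" where
  "penalty T m Z p n x = (\<Prod>j<n. if (T ^^ (m * j)) x \<in> Z then 1 - p else 1)"

lemma penalty_Suc:
  "penalty T m Z p (Suc n) x = (if x \<in> Z then 1 - p else 1) * penalty T m Z p n ((T ^^ m) x)"
  unfolding penalty_def
  by (subst prod.lessThan_Suc_shift) (simp add: funpow_add[THEN fun_cong, unfolded comp_apply, symmetric] add.commute)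

lemma penalty_bounds:
  assumes "0 < p" "p < 1" shows "0 \<le> penalty T m Z p n x" "penalty T m Z p n x \<le> 1"
  unfolding penalty_def using assms by (auto intro!: prod_nonneg prod_le_1)

context mds begin

lemma distr_funpow: "distr M M (T ^^ m) = M"
proof (rule measure_eqI)
  fix B assume "B \<in> sets (distr M M (T ^^ m))"
  then have B: "B \<in> sets M" by simp
  then have "emeasure (distr M M (T ^^ m)) B = emeasure M (preim M T m B)"
    using measurable_funpow by (simp add: emeasure_distr preim_def)
  then show "emeasure (distr M M (T ^^ m)) B = emeasure M B"
    using measure_preim[OF B] by (simp add: emeasure_eq_measure)
qed simp

lemma integral_shift:
  fixes g :: "'a \<Rightarrow> real"
  assumes "g \<in> borel_measurable M"
  shows "(\<integral>x. g ((T ^^ m) x) \<partial>M) = (\<integral>x. g x \<partial>M)"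
  using integral_distr[OF measurable_funpow assms, of m] by (simp add: distr_funpow)

lemma funpow_measurable_future_0:
  assumes a: "discrete_var M a" shows "(T ^^ q) \<in> future M T a 0 \<rightarrow>\<^sub>M future M T a 0"
proof -
  have "subalgebra (future M T a 0) (future M T a q)"
    using future_antimono[of 0 q M T a] by (simp add: subalgebra_def)
  moreover have "(T ^^ q) \<in> future M T a q \<rightarrow>\<^sub>M future M T a 0"
    using funpow_measurable_future[of q a 0] by simp
  ultimately show ?thesis by (rule measurable_from_subalg)
qed

lemma pattern_in_future:
  assumes a: "discrete_var M a" and A: "\<And>i. i \<in> {1..k} \<Longrightarrow> A i \<in> sets (future M T a 0)"
    and J: "finite J" "\<forall>j\<in>J. s j \<in> {1..k}"
  shows "pattern M T m A J s \<in> sets (future M T a 0)"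
proof -
  have "{x \<in> space (future M T a 0). (T ^^ (m * j)) x \<in> A (s j)} \<in> sets (future M T a 0)" if "j \<in> J" for j
    using measurable_sets[OF funpow_measurable_future_0[OF a] A, of "s j" "m * j"] J(2) that
    by (simp add: vimage_def Int_def conj_commute)
  then have "{x \<in> space (future M T a 0). \<forall>j\<in>J. (T ^^ (m * j)) x \<in> A (s j)} \<in> sets (future M T a 0)"
    using J(1) by (rule sets.sets_Collect_finite_All)
  then show ?thesis by (simp add: pattern_def)
qed

lemma bad_set_in_future:
  "bad_set M T a m k A p \<in> sets (future M T a m)"
proof -
  have "{x \<in> space (future M T a m). \<exists>i\<in>{1..k}. real_cond_exp M (future M T a m) (indicat_real (A i)) x < p}
      \<in> sets (future M T a m)" by measurable
  then show ?thesis by (simp add: bad_set_def)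
qed

lemma penalty_measurable:
  assumes a: "discrete_var M a" and Z: "Z \<in> sets (future M T a 0)"
  shows "penalty T m Z p n \<in> borel_measurable (future M T a 0)"
proof -
  have "(\<lambda>x. if (T ^^ (m * j)) x \<in> Z then 1 - p else 1) \<in> borel_measurable (future M T a 0)" for j
  proof (rule measurable_If)
    have "(T ^^ (m * j)) -` Z \<inter> space (future M T a 0) \<in> sets (future M T a 0)"
      by (rule measurable_sets[OF funpow_measurable_future_0[OF a] Z])
    then show "{x \<in> space (future M T a 0). (T ^^ (m * j)) x \<in> Z} \<in> sets (future M T a 0)"
      by (simp add: vimage_def Int_def conj_commute)
  qed auto
  then show ?thesis unfolding penalty_def[abs_def] by (rule borel_measurable_prod)
qed

text \<open>Inside the hull of \<open>E\<close>, an event that is decided from time \<open>m\<close> on and has positive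
  measure must meet \<open>E\<close> itself.\<close>

lemma measure_Int_preim_pos:
  assumes a: "discrete_var M a" and E: "E \<in> sets M" and P: "P \<in> sets (future M T a 0)"
    and B: "B \<in> sets (future M T a 0)" "preim M T m B \<subseteq> meas_hull M T a m E"
    and pos: "0 < measure M (B \<inter> P)"
  shows "0 < measure M (E \<inter> preim M T m P)"
proof -
  have Z: "preim M T m P \<in> sets (future M T a m)" using future_shift[of a 0 m] P by auto
  have H: "meas_hull M T a m E \<inter> preim M T m P \<in> sets M"
    using hull_in_future[OF a] Z future_sub[OF a] by blast
  have BP: "B \<inter> P \<in> sets M" using B(1) P future_sub[OF a] by blast
  have "measure M (B \<inter> P) = measure M (preim M T m (B \<inter> P))" by (rule measure_preim[OF BP, symmetric])
  also have "\<dots> \<le> measure M (meas_hull M T a m E \<inter> preim M T m P)"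
    using B(2) H by (intro finite_measure_mono) (auto simp: preim_def)
  finally have "measure M (meas_hull M T a m E \<inter> preim M T m P) \<noteq> 0" using pos by simp
  then have "measure M (E \<inter> preim M T m P) \<noteq> 0" using hull_null_iff[OF a E Z] by simp
  then show ?thesis by (simp add: zero_less_measure_iff)
qed

text \<open>The one-step estimate behind \<open>exists_shattered\<close>. Let \<open>e\<close> be the conditional probability of \<open>D\<close>. It
  vanishes outside the hull \<open>Y\<close> and is at most \<open>1\<close>. At a point of the bad set the
  factor \<open>1 - p\<close> gives the bound. At any other point, either all \<open>D \<inter> A i\<close> have positive
  conditional probability, and the point lies in \<open>Y'\<close>; or \<open>D\<close> misses some \<open>A i\<close> conditionally, and
  then \<open>e \<le> 1 - p\<close> because \<open>A i\<close> has conditional probability at least \<open>p\<close>.\<close>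

lemma cond_exp_penalised_le:
  fixes a :: "'a \<Rightarrow> 'b" and A :: "nat \<Rightarrow> 'a set" and m k :: nat and p :: real
  assumes a: "discrete_var M a" and A: "\<And>i. i \<in> {1..k} \<Longrightarrow> A i \<in> sets M" and D: "D \<in> sets M"
    and p: "0 < p" "p < 1"
  defines "Y \<equiv> meas_hull M T a m D"
    and "Y' \<equiv> {x \<in> space M. \<forall>i\<in>{1..k}. x \<in> meas_hull M T a m (D \<inter> A i)}"
  shows "AE x in M. (if x \<in> bad_set M T a m k A p then 1 - p else 1) * real_cond_exp M (future M T a m) (indicat_real D) x
    \<le> (1 - p) * indicat_real Y x + p * indicat_real Y' x"
proof -
  let ?G = "future M T a m"
  let ?e = "\<lambda>E. real_cond_exp M ?G (indicat_real E)"
  interpret G: finite_measure_subalgebra M ?G by (rule subalgebra_future[OF a])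
  have int: "integrable M (indicat_real E)" if "E \<in> sets M" for E using that by (rule integrable_event)
  have e1: "AE x in M. ?e D x \<le> 1"
  proof -
    have "AE x in M. ?e D x \<le> real_cond_exp M ?G (\<lambda>x. 1) x"
      by (intro G.real_cond_exp_mono int D) (auto simp: indicator_def)
    moreover have "AE x in M. real_cond_exp M ?G (\<lambda>x. 1) x = 1"
      by (intro G.real_cond_exp_F_meas) auto
    ultimately show ?thesis by eventually_elim simp
  qed
  have ei: "AE x in M. \<forall>i\<in>{1..k}. ?e D x \<le> ?e (D \<inter> A i) x + 1 - ?e (A i) x"
  proof (rule AE_finite_allI)
    fix i assume i: "i \<in> {1..k}"
    note Ai = A[OF i]
    have DA: "D \<inter> A i \<in> sets M" using D Ai by blast
    have "AE x in M. real_cond_exp M ?G (\<lambda>x. indicat_real D x + indicat_real (A i) x) x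
        \<le> real_cond_exp M ?G (\<lambda>x. indicat_real (D \<inter> A i) x + 1) x"
    proof (rule G.real_cond_exp_mono)
      show "AE x in M. indicat_real D x + indicat_real (A i) x \<le> indicat_real (D \<inter> A i) x + 1"
        by (auto simp: indicator_def)
    qed (intro Bochner_Integration.integrable_add int D Ai DA integrable_const)+
    moreover have "AE x in M. real_cond_exp M ?G (\<lambda>x. indicat_real D x + indicat_real (A i) x) x = ?e D x + ?e (A i) x"
      by (intro G.real_cond_exp_add int D Ai)
    moreover have "AE x in M. real_cond_exp M ?G (\<lambda>x. indicat_real (D \<inter> A i) x + 1) x
        = ?e (D \<inter> A i) x + real_cond_exp M ?G (\<lambda>x. 1) x"
      by (intro G.real_cond_exp_add int DA) simp
    moreover have "AE x in M. real_cond_exp M ?G (\<lambda>x. 1) x = 1"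
      by (intro G.real_cond_exp_F_meas) auto
    ultimately show "AE x in M. ?e D x \<le> ?e (D \<inter> A i) x + 1 - ?e (A i) x"
      by eventually_elim simp
  qed simp
  show ?thesis
    using e1 ei AE_space
  proof eventually_elim
    case (elim x)
    have Y: "x \<in> Y \<longleftrightarrow> 0 < ?e D x" using elim(3) by (simp add: Y_def meas_hull_def)
    show ?case
    proof (cases "0 < ?e D x")
      case False
      then have "(if x \<in> bad_set M T a m k A p then 1 - p else 1) * ?e D x \<le> 0"
        using p by (auto intro: mult_nonneg_nonpos)
      also have "0 \<le> (1 - p) * indicat_real Y x + p * indicat_real Y' x" using p by simp
      finally show ?thesis .
    next
      case True
      then have Y1: "indicat_real Y x = 1" using Y by simp
      show ?thesis
      proof (cases "x \<in> bad_set M T a m k A p")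
        case True
        have "(1 - p) * ?e D x \<le> 1 - p" using elim(1) p by (intro mult_left_le) auto
        then show ?thesis using True Y1 p by (simp add: add_increasing2)
      next
        case good: False
        show ?thesis
        proof (cases "x \<in> Y'")
          case True
          then show ?thesis using good Y1 elim(1) by simp
        next
          case False
          then obtain i where i: "i \<in> {1..k}" "?e (D \<inter> A i) x \<le> 0"
            using elim(3) by (auto simp: Y'_def meas_hull_def not_less)
          have "p \<le> ?e (A i) x" using good elim(3) i(1) by (auto simp: bad_set_def not_less)
          then show ?thesis using good Y1 False elim(2) i by force
        qed
      qed
    qed
  qed
qed

text \<open>A probabilistic form of the Sauer--Shelah lemma. Without bad points it bounds the measure of \<open>D\<close>:
  if all shattered sets are small then \<open>D\<close> is exponentially small.

  The proof splits off time \<open>0\<close>. The events \<open>Y\<close> and \<open>Y'\<close> of \<open>cond_exp_penalised_le\<close> are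
  decided from time \<open>m\<close> on, hence preimages of events \<open>B\<close> and \<open>B'\<close>. A set \<open>J\<^sub>1\<close> shattered in \<open>B\<close>
  gives the shattered set \<open>Suc ` J\<^sub>1\<close> in \<open>D\<close>; a set \<open>J\<^sub>2\<close> shattered in \<open>B'\<close> gives \<open>{0} \<union> Suc ` J\<^sub>2\<close>,
  since in \<open>Y'\<close> every symbol is possible at time \<open>0\<close>. The larger of the two has at least as many elements as \<open>J\<^sub>1\<close> and
  more than \<open>J\<^sub>2\<close>, so the two terms of the one-step estimate contribute the factors \<open>1 - p\<close> and \<open>p z\<close>.\<close>

lemma exists_shattered:
  fixes a :: "'a \<Rightarrow> 'b" and A :: "nat \<Rightarrow> 'a set" and m k :: nat and p :: real
  assumes a: "discrete_var M a" and A: "\<And>i. i \<in> {1..k} \<Longrightarrow> A i \<in> sets (future M T a 0)"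
    and p: "0 < p" "p < 1" and z: "0 < z" "z < 1"
    and D: "D \<in> sets (future M T a 0)" "0 < measure M D"
  defines "Z \<equiv> bad_set M T a m k A p"
  shows "\<exists>J. J \<subseteq> {..<n} \<and> shattered M T m k A D J \<and>
    (\<integral>x. indicat_real D x * penalty T m Z p n x \<partial>M) * z ^ card J \<le> (1 - p + p * z) ^ n"
  using D
proof (induction n arbitrary: D)
  case 0
  have "D \<inter> space M = D" using sets.sets_into_space[OF 0(1)] by auto
  then have "shattered M T m k A D {}"
    using 0(2) by (simp add: shattered_def pattern_def)
  moreover have "(\<integral>x. indicat_real D x * penalty T m Z p 0 x \<partial>M) \<le> 1"
    by (simp add: penalty_def \<open>D \<inter> space M = D\<close>)
  ultimately show ?case by (intro exI[of _ "{}"]) simp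
next
  case (Suc n)
  let ?F = "future M T a 0" and ?G = "future M T a m"
  let ?e = "\<lambda>E. real_cond_exp M ?G (indicat_real E)"
  interpret G: finite_measure_subalgebra M ?G by (rule subalgebra_future[OF a])
  have FM: "B \<in> sets M" if "B \<in> sets ?F" for B using that future_sub[OF a] by blast
  note DM = FM[OF Suc.prems(1)]
  have DA: "D \<inter> A i \<in> sets M" if "i \<in> {1..k}" for i using DM FM[OF A[OF that]] by blast
  define Y where "Y = meas_hull M T a m D"
  define Y' where "Y' = {x \<in> space M. \<forall>i\<in>{1..k}. x \<in> meas_hull M T a m (D \<inter> A i)}"
  have YG: "Y \<in> sets ?G" unfolding Y_def by (rule hull_in_future[OF a])
  have "{x \<in> space ?G. \<forall>i\<in>{1..k}. x \<in> meas_hull M T a m (D \<inter> A i)} \<in> sets ?G"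
  proof (rule sets.sets_Collect_finite_All)
    fix i
    have "meas_hull M T a m (D \<inter> A i) \<in> sets ?G" by (rule hull_in_future[OF a])
    moreover have "{x \<in> space ?G. x \<in> meas_hull M T a m (D \<inter> A i)} = meas_hull M T a m (D \<inter> A i)"
      by (auto simp: meas_hull_def)
    ultimately show "{x \<in> space ?G. x \<in> meas_hull M T a m (D \<inter> A i)} \<in> sets ?G" by simp
  qed simp
  then have Y'G: "Y' \<in> sets ?G" by (simp add: Y'_def)
  have lift: "\<exists>B\<in>sets ?F. X = preim M T m B" if "X \<in> sets ?G" for X
    using that future_shift[of a 0 m] by auto
  obtain B where B: "B \<in> sets ?F" "Y = preim M T m B" using lift[OF YG] by blast
  obtain B' where B': "B' \<in> sets ?F" "Y' = preim M T m B'" using lift[OF Y'G] by blast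
  have ZG: "Z \<in> sets ?G" unfolding Z_def by (rule bad_set_in_future)
  have ZF: "Z \<in> sets ?F" using ZG future_antimono[of 0 m M T a] by blast
  let ?w = "penalty T m Z p n"
  have wF: "?w \<in> borel_measurable ?F" by (rule penalty_measurable[OF a ZF])
  have wM: "?w \<in> borel_measurable M" using FM by (intro measurable_from_subalg[OF _ wF]) (auto simp: subalgebra_def)
  have wT: "(\<lambda>x. ?w ((T ^^ m) x)) \<in> borel_measurable ?G"
    using measurable_compose[OF funpow_measurable_future[of m a 0] wF] by simp
  have wTM: "(\<lambda>x. ?w ((T ^^ m) x)) \<in> borel_measurable M" by (rule measurable_from_subalg[OF G.subalg wT])
  define g where "g x = (if x \<in> Z then 1 - p else 1) * ?w ((T ^^ m) x)" for x
  have gG: "g \<in> borel_measurable ?G"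
    unfolding g_def[abs_def] using ZG wT
    by (intro borel_measurable_times measurable_If_set) (auto intro: sets.Int[OF ZG sets.top[of ?G], simplified])
  have gM: "g \<in> borel_measurable M" by (rule measurable_from_subalg[OF G.subalg gG])
  have g01: "0 \<le> g x" "g x \<le> 1" for x
    using penalty_bounds[OF p, of T m Z "Suc n" x] by (simp_all add: g_def penalty_Suc)
  have int_bdd: "integrable M h" if "h \<in> borel_measurable M" "\<And>x. \<bar>h x\<bar> \<le> 1" for h :: "'a \<Rightarrow> real"
    using that by (intro integrable_const_bound[where B = 1]) auto
  have shift: "(\<integral>x. indicat_real (preim M T m X) x * ?w ((T ^^ m) x) \<partial>M) = (\<integral>x. indicat_real X x * ?w x \<partial>M)"
    if "X \<in> sets ?F" for X
  proof -
    have "(\<integral>x. indicat_real (preim M T m X) x * ?w ((T ^^ m) x) \<partial>M)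
        = (\<integral>x. (\<lambda>y. indicat_real X y * ?w y) ((T ^^ m) x) \<partial>M)"
      by (intro Bochner_Integration.integral_cong) (auto simp: preim_def indicator_def)
    also have "\<dots> = (\<integral>x. indicat_real X x * ?w x \<partial>M)"
      using FM[OF that] wM by (intro integral_shift) auto
    finally show ?thesis .
  qed
  have int_gD: "integrable M (\<lambda>x. g x * indicat_real D x)"
    using gM DM g01 by (intro int_bdd) (auto simp: indicator_def)
  have intY: "integrable M (\<lambda>x. indicat_real X x * ?w ((T ^^ m) x))" if "X \<in> sets ?G" for X
    using that future_sub[OF a, of m] wTM penalty_bounds[OF p, of T m Z n]
    by (intro int_bdd) (auto simp: indicator_def)
  have "(\<integral>x. indicat_real D x * penalty T m Z p (Suc n) x \<partial>M) = (\<integral>x. g x * indicat_real D x \<partial>M)"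
    by (simp add: g_def penalty_Suc mult.commute)
  also have "\<dots> = (\<integral>x. g x * ?e D x \<partial>M)"
    by (rule G.real_cond_exp_intg(2)[OF int_gD gG, symmetric]) (use DM in simp)
  also have "\<dots> \<le> (\<integral>x. (1 - p) * (indicat_real Y x * ?w ((T ^^ m) x)) + p * (indicat_real Y' x * ?w ((T ^^ m) x)) \<partial>M)"
  proof (rule integral_mono_AE)
    show "integrable M (\<lambda>x. g x * ?e D x)"
      by (rule G.real_cond_exp_intg(1)[OF int_gD gG]) (use DM in simp)
    show "integrable M (\<lambda>x. (1 - p) * (indicat_real Y x * ?w ((T ^^ m) x)) + p * (indicat_real Y' x * ?w ((T ^^ m) x)))"
      by (intro Bochner_Integration.integrable_add Bochner_Integration.integrable_mult_right intY YG Y'G)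
    have "AE x in M. (if x \<in> Z then 1 - p else 1) * ?e D x \<le> (1 - p) * indicat_real Y x + p * indicat_real Y' x"
      unfolding Y_def Y'_def Z_def by (rule cond_exp_penalised_le[OF a FM[OF A] DM p])
    then show "AE x in M. g x * ?e D x
        \<le> (1 - p) * (indicat_real Y x * ?w ((T ^^ m) x)) + p * (indicat_real Y' x * ?w ((T ^^ m) x))"
    proof eventually_elim
      case (elim x)
      have "?w ((T ^^ m) x) * ((if x \<in> Z then 1 - p else 1) * ?e D x)
          \<le> ?w ((T ^^ m) x) * ((1 - p) * indicat_real Y x + p * indicat_real Y' x)"
        using elim penalty_bounds[OF p] by (intro mult_left_mono) auto
      then show ?case by (simp only: g_def algebra_simps)
    qed
  qed
  also have "\<dots> = (1 - p) * (\<integral>x. indicat_real B x * ?w x \<partial>M) + p * (\<integral>x. indicat_real B' x * ?w x \<partial>M)"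
    using intY[OF YG] intY[OF Y'G] shift[OF B(1)] shift[OF B'(1)] by (simp add: B(2) B'(2))
  finally have main: "(\<integral>x. indicat_real D x * penalty T m Z p (Suc n) x \<partial>M)
      \<le> (1 - p) * (\<integral>x. indicat_real B x * ?w x \<partial>M) + p * (\<integral>x. indicat_real B' x * ?w x \<partial>M)" .
  have T_Suc: "(T ^^ (m * j)) ((T ^^ m) x) = (T ^^ (m * Suc j)) x" for j x
    by (simp add: funpow_add[THEN fun_cong, unfolded comp_apply, symmetric] add.commute)
  have pat_Suc: "pattern M T m A (Suc ` J) s = preim M T m (pattern M T m A J (\<lambda>j. s (Suc j)))" for J s
    using funpow_space
    by (auto simp: pattern_def preim_def T_Suc simp del: mult_Suc_right)
  have pat_ins: "A (s 0) \<inter> preim M T m (pattern M T m A J (\<lambda>j. s (Suc j))) \<subseteq> pattern M T m A (insert 0 (Suc ` J)) s" for J s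
    unfolding pat_Suc[symmetric] by (auto simp: pattern_def)
  have pF: "pattern M T m A J s \<in> sets ?F" if "J \<subseteq> {..<n}" "\<forall>j\<in>J. s j \<in> {1..k}" for J s
    using that finite_subset[OF that(1)] by (intro pattern_in_future[OF a A]) auto
  have cardS: "card (Suc ` J) = card J" for J by (simp add: card_image)
  have Bpos: "0 < measure M B"
  proof -
    have "measure M (Y \<inter> space M) \<noteq> 0"
      using hull_null_iff[OF a DM, of "space M" m] Suc.prems(2) sets.top[of ?G] DM
      by (simp add: Y_def Int_absorb2[OF sets.sets_into_space[OF DM]])
    moreover have "Y \<inter> space M = Y" by (auto simp: Y_def meas_hull_def)
    ultimately show ?thesis using measure_preim[OF FM[OF B(1)], of m] B(2) by (simp add: zero_less_measure_iff)
  qed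
  obtain J1 where J1: "J1 \<subseteq> {..<n}" "shattered M T m k A B J1"
    "(\<integral>x. indicat_real B x * ?w x \<partial>M) * z ^ card J1 \<le> (1 - p + p * z) ^ n"
    using Suc.IH[OF B(1) Bpos] by blast
  have sh1: "shattered M T m k A D (Suc ` J1)"
    unfolding shattered_def pat_Suc
  proof (intro allI impI)
    fix s assume s: "\<forall>j\<in>Suc ` J1. s j \<in> {1..k}"
    then have s': "\<forall>j\<in>J1. s (Suc j) \<in> {1..k}" by simp
    have "0 < measure M (B \<inter> pattern M T m A J1 (\<lambda>j. s (Suc j)))"
      using J1(2) s' by (simp add: shattered_def)
    then show "0 < measure M (D \<inter> preim M T m (pattern M T m A J1 (\<lambda>j. s (Suc j))))"
      by (intro measure_Int_preim_pos[OF a DM pF[OF J1(1) s'] B(1)]) (auto simp: B(2)[symmetric] Y_def)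
  qed
  let ?\<kappa> = "1 - p + p * z"
  have \<kappa>: "0 < ?\<kappa>" using p z by (simp add: add_pos_pos)
  have I_nonneg: "0 \<le> (\<integral>x. indicat_real X x * ?w x \<partial>M)" for X
    using penalty_bounds[OF p] by (intro Bochner_Integration.integral_nonneg mult_nonneg_nonneg) auto
  show ?case
  proof (cases "measure M B' = 0")
    case True
    have "(\<integral>x. indicat_real B' x * ?w x \<partial>M) = 0"
    proof (rule integral_eq_zero_AE)
      have "AE x in M. x \<notin> B'"
        using True FM[OF B'(1)] by (intro AE_not_in) (auto simp: null_sets_def emeasure_eq_measure)
      then show "AE x in M. indicat_real B' x * ?w x = 0" by eventually_elim simp
    qed
    then have "(\<integral>x. indicat_real D x * penalty T m Z p (Suc n) x \<partial>M) * z ^ card J1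
        \<le> (1 - p) * ((\<integral>x. indicat_real B x * ?w x \<partial>M) * z ^ card J1)"
      using mult_right_mono[OF main, of "z ^ card J1"] z by simp
    also have "\<dots> \<le> (1 - p) * ?\<kappa> ^ n" using J1(3) p by (intro mult_left_mono) auto
    also have "\<dots> \<le> ?\<kappa> * ?\<kappa> ^ n" using p z \<kappa> by (intro mult_right_mono) auto
    finally have "(\<integral>x. indicat_real D x * penalty T m Z p (Suc n) x \<partial>M) * z ^ card (Suc ` J1) \<le> ?\<kappa> ^ Suc n"
      by (simp add: cardS)
    then show ?thesis using sh1 J1(1) by (intro exI[of _ "Suc ` J1"]) auto
  next
    case False
    then obtain J2 where J2: "J2 \<subseteq> {..<n}" "shattered M T m k A B' J2"
      "(\<integral>x. indicat_real B' x * ?w x \<partial>M) * z ^ card J2 \<le> ?\<kappa> ^ n"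
      using Suc.IH[OF B'(1)] by (auto simp: zero_less_measure_iff)
    have sh2: "shattered M T m k A D (insert 0 (Suc ` J2))"
      unfolding shattered_def
    proof (intro allI impI)
      fix s assume s: "\<forall>j\<in>insert 0 (Suc ` J2). s j \<in> {1..k}"
      then have s': "\<forall>j\<in>J2. s (Suc j) \<in> {1..k}" and s0: "s 0 \<in> {1..k}" by simp_all
      let ?P = "pattern M T m A J2 (\<lambda>j. s (Suc j))"
      have "0 < measure M (B' \<inter> ?P)" using J2(2) s' by (simp add: shattered_def)
      then have "0 < measure M (D \<inter> A (s 0) \<inter> preim M T m ?P)"
        using s0 by (intro measure_Int_preim_pos[OF a DA[OF s0] pF[OF J2(1) s'] B'(1)])
          (auto simp: B'(2)[symmetric] Y'_def)
      also have "\<dots> \<le> measure M (D \<inter> pattern M T m A (insert 0 (Suc ` J2)) s)"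
      proof (rule finite_measure_mono)
        show "D \<inter> A (s 0) \<inter> preim M T m ?P \<subseteq> D \<inter> pattern M T m A (insert 0 (Suc ` J2)) s"
          using pat_ins[of s J2] by blast
        have "pattern M T m A (insert 0 (Suc ` J2)) s \<in> sets ?F"
          using s finite_subset[OF J2(1)] by (intro pattern_in_future[OF a A]) auto
        then show "D \<inter> pattern M T m A (insert 0 (Suc ` J2)) s \<in> sets M" using DM FM by blast
      qed
      finally show "0 < measure M (D \<inter> pattern M T m A (insert 0 (Suc ` J2)) s)" .
    qed
    have card2: "card (insert 0 (Suc ` J2)) = Suc (card J2)"
      using finite_subset[OF J2(1)] by (subst card_insert_disjoint) (auto simp: cardS)
    have "\<exists>J. J \<subseteq> {..<Suc n} \<and> shattered M T m k A D J \<and> card J1 \<le> card J \<and> Suc (card J2) \<le> card J"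
    proof (cases "card J1 \<le> Suc (card J2)")
      case True
      then show ?thesis using sh2 J2(1) card2 by (intro exI[of _ "insert 0 (Suc ` J2)"]) auto
    next
      case False
      then show ?thesis using sh1 J1(1) cardS[of J1] by (intro exI[of _ "Suc ` J1"]) auto
    qed
    then obtain J where J: "J \<subseteq> {..<Suc n}" "shattered M T m k A D J" "card J1 \<le> card J" "Suc (card J2) \<le> card J"
      by blast
    let ?I = "\<lambda>X. \<integral>x. indicat_real X x * ?w x \<partial>M"
    have "?I B * z ^ card J \<le> ?I B * z ^ card J1"
      using z J(3) I_nonneg by (intro mult_left_mono power_decreasing) auto
    then have 1: "?I B * z ^ card J \<le> ?\<kappa> ^ n" using J1(3) by linarith
    have "?I B' * z ^ card J \<le> ?I B' * z ^ Suc (card J2)"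
      using z J(4) I_nonneg by (intro mult_left_mono power_decreasing) auto
    also have "\<dots> = z * (?I B' * z ^ card J2)" by simp
    also have "\<dots> \<le> z * ?\<kappa> ^ n" using J2(3) z by (intro mult_left_mono) auto
    finally have 2: "?I B' * z ^ card J \<le> z * ?\<kappa> ^ n" .
    have "(\<integral>x. indicat_real D x * penalty T m Z p (Suc n) x \<partial>M) * z ^ card J
        \<le> ((1 - p) * ?I B + p * ?I B') * z ^ card J"
      using main z by (intro mult_right_mono) auto
    also have "\<dots> = (1 - p) * (?I B * z ^ card J) + p * (?I B' * z ^ card J)" by (simp add: algebra_simps)
    also have "\<dots> \<le> (1 - p) * ?\<kappa> ^ n + p * (z * ?\<kappa> ^ n)"
      using 1 2 p by (intro add_mono mult_left_mono) auto
    also have "\<dots> = ?\<kappa> ^ Suc n" by (simp add: algebra_simps)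
    finally show ?thesis using J by blast
  qed
qed

end

context mds begin

text \<open>By invariance, \<open>n\<close> times the measure of \<open>Z\<close> is the mean number of visits to \<open>Z\<close>. The penalty is an
  exponential of that number, so it lies above its tangent at \<open>n * \<tau>\<close>. Integrating the
  tangent over \<open>D\<close> gives the bound, as in Jensen's inequality.\<close>

lemma penalty_integral_lower:
  assumes Z: "Z \<in> sets M" and p: "0 < p" "p < 1" and D: "D \<in> sets M"
    and \<tau>: "measure M Z \<le> \<tau> * measure M D"
  shows "exp (ln (1 - p) * \<tau>) ^ n * measure M D \<le> (\<integral>x. indicat_real D x * penalty T m Z p n x \<partial>M)"
proof -
  define l where "l = - ln (1 - p)"
  have l: "0 < l" using p by (simp add: l_def)
  define t where "t = n * \<tau>"
  define K where "K = exp (- (l * t))"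
  define c where "c x = (\<Sum>j<n. indicat_real Z ((T ^^ (m * j)) x))" for x
  have pen: "penalty T m Z p n x = exp (- (l * c x))" for x
  proof -
    have "(if (T ^^ (m * j)) x \<in> Z then 1 - p else 1) = exp (- (l * indicat_real Z ((T ^^ (m * j)) x)))" for j
      using p by (simp add: l_def)
    then have "penalty T m Z p n x = (\<Prod>j<n. exp (- (l * indicat_real Z ((T ^^ (m * j)) x))))"
      by (simp only: penalty_def)
    also have "\<dots> = exp (\<Sum>j<n. - (l * indicat_real Z ((T ^^ (m * j)) x)))"
      by (rule exp_sum[symmetric]) simp
    also have "\<dots> = exp (- (l * c x))" by (simp only: c_def sum_negf sum_distrib_left)
    finally show ?thesis .
  qed
  have c0: "0 \<le> c x" for x unfolding c_def by (intro sum_nonneg) simp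
  have cj: "(\<lambda>x. indicat_real Z ((T ^^ (m * j)) x)) \<in> borel_measurable M" for j
    using measurable_compose[OF measurable_funpow borel_measurable_indicator[OF Z]] .
  have cint: "integrable M (\<lambda>x. indicat_real Z ((T ^^ (m * j)) x))" for j
    using cj by (intro integrable_const_bound[where B = 1]) auto
  have c_int: "integrable M c" unfolding c_def[abs_def] by (intro Bochner_Integration.integrable_sum cint)
  have "(\<integral>x. c x \<partial>M) = (\<Sum>j<n. \<integral>x. indicat_real Z ((T ^^ (m * j)) x) \<partial>M)"
    unfolding c_def by (intro Bochner_Integration.integral_sum cint)
  also have "\<dots> = n * measure M Z"
    using Z by (simp add: integral_shift)
  finally have c_mean: "(\<integral>x. c x \<partial>M) = n * measure M Z" .
  have Dint: "integrable M (indicat_real D)" by (rule integrable_event[OF D])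
  have pen_int: "integrable M (\<lambda>x. indicat_real D x * penalty T m Z p n x)"
  proof (intro integrable_const_bound[where B = 1])
    show "(\<lambda>x. indicat_real D x * penalty T m Z p n x) \<in> borel_measurable M"
      unfolding pen using D c_int by measurable
    show "AE x in M. norm (indicat_real D x * penalty T m Z p n x) \<le> 1"
      using penalty_bounds[OF p, of T m Z n] by (intro AE_I2) (auto simp: indicator_def)
  qed
  have "K * measure M D \<le> K * measure M D + K * l * (n * (\<tau> * measure M D - measure M Z))"
    using \<tau> l by (simp add: K_def)
  also have "\<dots> = K * (1 + l * t) * measure M D - K * l * (n * measure M Z)"
    by (simp add: t_def algebra_simps)
  also have "\<dots> = (\<integral>x. K * (1 + l * t) * indicat_real D x - K * l * c x \<partial>M)"
    using Dint c_int D by (simp add: c_mean)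
  also have "\<dots> \<le> (\<integral>x. indicat_real D x * penalty T m Z p n x \<partial>M)"
  proof (rule Bochner_Integration.integral_mono)
    show "integrable M (\<lambda>x. K * (1 + l * t) * indicat_real D x - K * l * c x)"
      using Dint c_int by simp
    fix x
    show "K * (1 + l * t) * indicat_real D x - K * l * c x \<le> indicat_real D x * penalty T m Z p n x"
    proof (cases "x \<in> D")
      case True
      have "1 + l * (t - c x) \<le> exp (l * (t - c x))" by (rule exp_ge_add_one_self)
      then have "K * (1 + l * (t - c x)) \<le> K * exp (l * (t - c x))" by (simp add: K_def)
      also have "\<dots> = penalty T m Z p n x"
        unfolding pen K_def exp_add[symmetric] by (simp add: algebra_simps)
      finally show ?thesis using True by (simp add: algebra_simps)
    next
      case False
      then show ?thesis using c0[of x] l by (simp add: K_def)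
    qed
  qed (rule pen_int)
  finally show ?thesis
    by (simp add: K_def l_def t_def exp_of_nat_mult[symmetric] mult_ac)
qed

text \<open>With \<open>q = (1 - p) powr \<tau>\<close>, the two bounds on the penalty integral give
  \<open>q ^ n / 2 * z ^ card J \<le> (1 - p + p * z) ^ n\<close>. Since the bad set does not have full measure, \<open>\<tau>\<close> can
  be chosen below \<open>1\<close>, and then \<open>q > 1 - p\<close>. So \<open>1 - p + p * z < q\<close> for small \<open>z\<close>, and
  \<open>card J\<close> grows linearly in \<open>n\<close>.\<close>

lemma exists_large_shattered:
  fixes a :: "'a \<Rightarrow> 'b" and A :: "nat \<Rightarrow> 'a set" and m k :: nat and p :: real
  assumes a: "discrete_var M a" and A: "\<And>i. i \<in> {1..k} \<Longrightarrow> A i \<in> sets (future M T a 0)"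
    and p: "0 < p" "p < 1" and bad: "measure M (bad_set M T a m k A p) < 1"
  obtains c \<beta> where "0 < c" "\<beta> < 1"
    "\<And>n D. D \<in> sets (future M T a 0) \<Longrightarrow> \<beta> \<le> measure M D \<Longrightarrow>
      \<exists>J. J \<subseteq> {..<n} \<and> shattered M T m k A D J \<and> c * real n - 1 \<le> real (card J)"
proof -
  let ?Z = "bad_set M T a m k A p"
  define b where "b = measure M ?Z"
  \<comment> \<open>\<open>\<tau>\<close> lies strictly between the measure \<open>b\<close> of the bad set and \<open>1\<close>; then \<open>b \<le> \<tau> * \<beta>\<close> with \<open>\<beta> < 1\<close>.\<close>
  define \<tau> where "\<tau> = (1 + b) / 2"
  define \<beta> where "\<beta> = max (1 / 2) (b / \<tau>)"
  define q where "q = exp (ln (1 - p) * \<tau>)"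
  \<comment> \<open>This keeps \<open>\<kappa>\<close> from exceeding the midpoint of \<open>1 - p\<close> and \<open>q\<close>, and \<open>z \<le> 1 / 2\<close> makes \<open>ln 2 / (- ln z) \<le> 1\<close>.\<close>
  define z where "z = min (1 / 2) ((q - (1 - p)) / (2 * p))"
  define \<kappa> where "\<kappa> = 1 - p + p * z"
  define c where "c = (ln q - ln \<kappa>) / (- ln z)"
  have b: "0 \<le> b" "b < 1" using bad by (auto simp: b_def)
  have \<tau>: "0 < \<tau>" "\<tau> < 1" "b < \<tau>" using b by (auto simp: \<tau>_def)
  have \<beta>: "\<beta> < 1" "1 / 2 \<le> \<beta>" "b / \<tau> \<le> \<beta>" using \<tau> by (auto simp: \<beta>_def)
  have "ln (1 - p) < ln (1 - p) * \<tau>" using p \<tau>(2) by simp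
  then have "exp (ln (1 - p)) < q" unfolding q_def by (simp only: exp_less_cancel_iff)
  then have q: "1 - p < q" "0 < q" using p by (auto simp: q_def)
  have z: "0 < z" "z \<le> 1 / 2" using q p by (auto simp: z_def)
  have "p * z \<le> p * ((q - (1 - p)) / (2 * p))" using p by (intro mult_left_mono) (auto simp: z_def)
  also have "\<dots> = (q - (1 - p)) / 2" using p by simp
  finally have \<kappa>: "\<kappa> < q" "0 < \<kappa>" using q p z by (auto simp: \<kappa>_def add_pos_pos)
  have lnz: "ln 2 \<le> - ln z"
  proof -
    have "ln z \<le> ln (1 / 2)" using z by (subst ln_le_cancel_iff) auto
    then show ?thesis by (simp add: ln_div)
  qed
  have lnz0: "0 < - ln z" using lnz ln_gt_zero[of "2 :: real"] by linarith
  have ZM: "?Z \<in> sets M" using bad_set_in_future future_sub[OF a] by blast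
  have "\<exists>J. J \<subseteq> {..<n} \<and> shattered M T m k A D J \<and> c * real n - 1 \<le> real (card J)"
    if D: "D \<in> sets (future M T a 0)" "\<beta> \<le> measure M D" for n D
  proof -
    have DM: "D \<in> sets M" using D(1) future_sub[OF a] by blast
    have Dpos: "0 < measure M D" using D(2) \<beta>(2) by linarith
    have z1: "z < 1" using z(2) by linarith
    have "\<exists>J. J \<subseteq> {..<n} \<and> shattered M T m k A D J \<and>
        (\<integral>x. indicat_real D x * penalty T m ?Z p n x \<partial>M) * z ^ card J \<le> \<kappa> ^ n"
      unfolding \<kappa>_def by (rule exists_shattered[OF a A p z(1) z1 D(1) Dpos])
    then obtain J where J: "J \<subseteq> {..<n}" "shattered M T m k A D J"
      "(\<integral>x. indicat_real D x * penalty T m ?Z p n x \<partial>M) * z ^ card J \<le> \<kappa> ^ n"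
      by (elim exE conjE)
    have "b \<le> \<tau> * measure M D" using order_trans[OF \<beta>(3) D(2)] \<tau>(1) by (simp add: field_simps)
    then have "q ^ n * measure M D \<le> (\<integral>x. indicat_real D x * penalty T m ?Z p n x \<partial>M)"
      unfolding q_def b_def by (rule penalty_integral_lower[OF ZM p DM])
    moreover have "q ^ n * (1 / 2) \<le> q ^ n * measure M D"
      using D(2) \<beta>(2) q(2) by (intro mult_left_mono) auto
    ultimately have "q ^ n * (1 / 2) * z ^ card J \<le> \<kappa> ^ n"
      using mult_right_mono[of "q ^ n * (1 / 2)" _ "z ^ card J"] J(3) z(1)
      by (meson order_trans zero_le_power less_imp_le)
    then have "ln (q ^ n * (1 / 2) * z ^ card J) \<le> ln (\<kappa> ^ n)"
      using q(2) z(1) \<kappa>(2) by (subst ln_le_cancel_iff) auto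
    then have "n * ln q - ln 2 + card J * ln z \<le> n * ln \<kappa>"
      using q(2) z(1) \<kappa>(2) by (simp add: ln_mult ln_realpow ln_div)
    then have "n * (ln q - ln \<kappa>) - (- ln z) \<le> card J * (- ln z)"
      using lnz by (simp add: algebra_simps)
    then have "(n * (ln q - ln \<kappa>) - (- ln z)) / (- ln z) \<le> card J"
      using lnz0 by (subst pos_divide_le_eq) auto
    moreover have "(n * (ln q - ln \<kappa>) - (- ln z)) / (- ln z) = c * n - 1"
    proof -
      have "(X - W) / W = X / W - 1" if "0 < W" for X W :: real using that by (simp add: diff_divide_distrib)
      from this[OF lnz0] show ?thesis by (simp only: c_def times_divide_eq_left times_divide_eq_right mult.commute)
    qed
    ultimately show ?thesis using J(1,2) by auto
  qed
  moreover have "0 < c" unfolding c_def using \<kappa> lnz0 by (intro divide_pos_pos) auto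
  ultimately show ?thesis using that \<beta>(1) by blast
qed

section \<open>Completely positive entropy forces independence\<close>

lemma common_hull_large:
  assumes cpe: "completely_positive_entropy M T" and a: "finite_var M a"
    and S: "finite S" "\<And>E. E \<in> S \<Longrightarrow> E \<in> sets M \<and> 0 < measure M E" and d: "0 < d"
  shows "eventually (\<lambda>N. {x \<in> space M. \<forall>E\<in>S. x \<in> meas_hull M T a N E} \<in> sets (future M T a N) \<and>
    1 - d < measure M {x \<in> space M. \<forall>E\<in>S. x \<in> meas_hull M T a N E}) sequentially"
proof -
  let ?h = "\<lambda>N E. meas_hull M T a N E"
  note da = finite_var_discrete[OF a]
  have hM: "?h N E \<in> sets M" for N E using hull_in_future[OF da] future_sub[OF da] by blast
  define e where "e = d / (1 + card S)"
  have e: "0 < e" using d by (simp add: e_def)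
  have "eventually (\<lambda>N. \<forall>E\<in>S. 1 - e < measure M (?h N E)) sequentially"
    using S(1)
  proof (rule eventually_ball_finite, intro ballI)
    fix E assume E: "E \<in> S"
    show "eventually (\<lambda>N. 1 - e < measure M (?h N E)) sequentially"
      using hull_tendsto_1[OF cpe a, of E] S(2)[OF E] e by (intro order_tendstoD(1)[of _ 1]) auto
  qed
  then show ?thesis
  proof eventually_elim
    case (elim N)
    let ?X = "{x \<in> space M. \<forall>E\<in>S. x \<in> ?h N E}"
    have "{x \<in> space (future M T a N). \<forall>E\<in>S. x \<in> ?h N E} \<in> sets (future M T a N)"
    proof (rule sets.sets_Collect_finite_All)
      fix E
      have "{x \<in> space (future M T a N). x \<in> ?h N E} = ?h N E" by (auto simp: meas_hull_def)
      then show "{x \<in> space (future M T a N). x \<in> ?h N E} \<in> sets (future M T a N)"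
        using hull_in_future[OF da] by simp
    qed (rule S(1))
    then have X: "?X \<in> sets (future M T a N)" by simp
    have XM: "?X \<in> sets M" using X future_sub[OF da] by blast
    have "space M - ?X = (\<Union>E\<in>S. space M - ?h N E)" by auto
    then have "1 - measure M ?X = measure M (\<Union>E\<in>S. space M - ?h N E)"
      using prob_compl[OF XM] by simp
    also have "\<dots> \<le> (\<Sum>E\<in>S. measure M (space M - ?h N E))"
      using S(1) hM by (intro finite_measure_subadditive_finite) auto
    also have "\<dots> \<le> (\<Sum>E\<in>S. e)"
      using elim hM by (intro sum_mono) (auto simp: prob_compl less_imp_le)
    also have "\<dots> < d" using d by (simp add: e_def field_simps)
    finally show ?case using X by simp
  qed
qed

text \<open>Where all the conditional probabilities are positive they are bounded below by some \<open>1 / (2 + n)\<close>,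
  and countably many bad sets of full measure would leave nothing outside of them.\<close>

lemma bad_set_small_prob:
  assumes a: "discrete_var M a"
    and pos: "0 < measure M {x \<in> space M. \<forall>i\<in>{1..k}. x \<in> meas_hull M T a m (A i)}"
  obtains p where "0 < p" "p < 1" "measure M (bad_set M T a m k A p) < 1"
proof -
  let ?G = "{x \<in> space M. \<forall>i\<in>{1..k}. x \<in> meas_hull M T a m (A i)}"
  let ?e = "\<lambda>i. real_cond_exp M (future M T a m) (indicat_real (A i))"
  let ?p = "\<lambda>n. 1 / (2 + real n)"
  let ?B = "\<lambda>n. bad_set M T a m k A (?p n)"
  have BM: "?B n \<in> sets M" for n using bad_set_in_future future_sub[OF a] by blast
  have "?G \<subseteq> (\<Union>n. space M - ?B n)"
  proof
    fix x assume x: "x \<in> ?G"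
    then have e: "0 < ?e i x" if "i \<in> {1..k}" for i using that by (auto simp: meas_hull_def)
    define r where "r = Min (insert 1 ((\<lambda>i. ?e i x) ` {1..k}))"
    have r: "0 < r" "\<And>i. i \<in> {1..k} \<Longrightarrow> r \<le> ?e i x"
    proof -
      show "0 < r" unfolding r_def using e by (subst Min_gr_iff) auto
      show "r \<le> ?e i x" if "i \<in> {1..k}" for i unfolding r_def using that by (intro Min_le) auto
    qed
    obtain n where "1 / real (Suc n) < r" using nat_approx_posE[OF r(1)] by blast
    moreover have "?p n \<le> 1 / real (Suc n)" by (simp add: frac_le)
    ultimately have "?p n \<le> ?e i x" if "i \<in> {1..k}" for i using r(2)[OF that] by linarith
    then have "x \<in> space M - ?B n" using x by (auto simp: bad_set_def not_less)
    then show "x \<in> (\<Union>n. space M - ?B n)" by blast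
  qed
  then have le: "measure M ?G \<le> measure M (\<Union>n. space M - ?B n)"
    using BM by (intro finite_measure_mono) auto
  have "\<exists>n. measure M (?B n) < 1"
  proof (rule ccontr)
    assume "\<not> ?thesis"
    then have "measure M (?B n) = 1" for n using prob_le_1[of "?B n"] by (meson not_less order_antisym)
    then have "space M - ?B n \<in> null_sets M" for n
      using BM by (auto simp: null_sets_def emeasure_eq_measure prob_compl)
    then have "(\<Union>n. space M - ?B n) \<in> null_sets M" by (rule null_sets_UN)
    then show False using le pos by (simp add: null_sets_def emeasure_eq_measure)
  qed
  then obtain n where n: "measure M (?B n) < 1" ..
  show ?thesis by (rule that[OF _ _ n]) auto
qed

lemma Ind_of_patterns:
  assumes k: "1 \<le> k" and A: "\<And>i. i \<in> {1..k} \<Longrightarrow> A i \<in> sets M"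
    and inc: "incseq J" and fin: "\<And>n. finite (J n)"
    and sh: "\<And>n. shattered M T 1 k A (space M) (J n)"
  shows "(\<Union>n. J n) \<in> Ind M T k A"
  unfolding Ind_def
proof (intro CollectI allI impI)
  fix I s assume I: "I \<subseteq> (\<Union>n. J n) \<and> finite I \<and> I \<noteq> {} \<and> s \<in> I \<rightarrow>\<^sub>E {1..k}"
  have "\<exists>n. I \<subseteq> J n"
  proof -
    have "\<exists>n. i \<in> J n" if "i \<in> I" for i using I that by blast
    then have "\<exists>N. \<forall>i\<in>I. i \<in> J (N i)" by (intro bchoice) blast
    then obtain N where N: "\<forall>i\<in>I. i \<in> J (N i)" ..
    have "J (N i) \<subseteq> J (Max (N ` I))" if "i \<in> I" for i
      by (rule incseqD[OF inc]) (use I that in \<open>simp add: Max_ge\<close>)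
    then show ?thesis using N by blast
  qed
  then obtain n where n: "I \<subseteq> J n" ..
  \<comment> \<open>Outside \<open>I\<close> any admissible symbol will do; \<open>1\<close> is one since \<open>1 \<le> k\<close>.\<close>
  define s' where "s' j = (if j \<in> I then s j else 1)" for j
  have s': "\<forall>j\<in>J n. s' j \<in> {1..k}" using I k by (auto simp: s'_def PiE_iff)
  then have "0 < measure M (space M \<inter> pattern M T 1 A (J n) s')"
    using sh[of n] by (simp add: shattered_def)
  also have "\<dots> \<le> measure M (\<Inter>j\<in>I. preim M T j (A (s j)))"
  proof (rule finite_measure_mono)
    show "space M \<inter> pattern M T 1 A (J n) s' \<subseteq> (\<Inter>j\<in>I. preim M T j (A (s j)))"
      using n by (auto simp: pattern_def preim_def s'_def)
    show "(\<Inter>j\<in>I. preim M T j (A (s j))) \<in> sets M"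
      using I A by (intro sets.finite_INT sets_preim) (auto simp: PiE_iff)
  qed
  finally show "0 < measure M (\<Inter>j\<in>I. preim M T j (A (s j)))" .
qed

text \<open>Let \<open>S\<close> be the finite set of pattern events of \<open>J\<close>. For late \<open>N\<close> the intersection of their hulls at
  time \<open>N\<close> is nearly everything, and it is the preimage under \<open>T ^^ N\<close> of some \<open>B\<close>. A set \<open>J\<^sub>2\<close>
  shattered in \<open>B\<close> is moved to the times \<open>N + m * j\<close>. Its patterns then have positive measure inside each
  of the hulls, hence inside each event of \<open>S\<close>.

  The new times may overlap with \<open>J\<close>: both parts of a pattern come from the same \<open>s\<close>.\<close>

lemma extend_shattered:
  fixes a :: "'a \<Rightarrow> 'b" and A :: "nat \<Rightarrow> 'a set" and m k :: nat and c \<beta> :: real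
  assumes cpe: "completely_positive_entropy M T" and a: "finite_var M a"
    and A: "\<And>i. i \<in> {1..k} \<Longrightarrow> A i \<in> sets (future M T a 0)"
    and \<beta>: "\<beta> < 1" and large: "\<And>n D. D \<in> sets (future M T a 0) \<Longrightarrow> \<beta> \<le> measure M D \<Longrightarrow>
      \<exists>J. J \<subseteq> {..<n} \<and> shattered M T m k A D J \<and> c * real n - 1 \<le> real (card J)"
    and m: "0 < m"
    and J: "finite J" "shattered M T 1 k A (space M) J"
  shows "\<exists>J' N. finite J' \<and> shattered M T 1 k A (space M) J' \<and> J \<subseteq> J' \<and>
    c * real n - 1 \<le> real (card (J' \<inter> {N..N + m * n}))"
proof -
  note da = finite_var_discrete[OF a]
  define S where "S = pattern M T 1 A J ` (J \<rightarrow>\<^sub>E {1..k})"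
  have fin: "finite S" unfolding S_def using J(1) by (intro finite_imageI finite_PiE) auto
  have SE: "pattern M T 1 A J s \<in> sets M" "0 < measure M (pattern M T 1 A J s)"
    if "\<forall>j\<in>J. s j \<in> {1..k}" for s
  proof -
    show "pattern M T 1 A J s \<in> sets M"
      by (rule subsetD[OF future_sub[OF da] pattern_in_future[OF da A J(1) that]])
    have "space M \<inter> pattern M T 1 A J s = pattern M T 1 A J s" by (auto simp: pattern_def)
    then show "0 < measure M (pattern M T 1 A J s)"
      using J(2) that by (auto simp: shattered_def)
  qed
  have Sprop: "E \<in> sets M \<and> 0 < measure M E" if "E \<in> S" for E
    using that SE by (auto simp: S_def PiE_iff)
  have "\<exists>N. {x \<in> space M. \<forall>E\<in>S. x \<in> meas_hull M T a N E} \<in> sets (future M T a N) \<and>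
      1 - (1 - \<beta>) < measure M {x \<in> space M. \<forall>E\<in>S. x \<in> meas_hull M T a N E}"
    using \<beta> by (intro eventually_happens'[OF sequentially_bot] common_hull_large[OF cpe a fin Sprop]) auto
  then obtain N where N: "{x \<in> space M. \<forall>E\<in>S. x \<in> meas_hull M T a N E} \<in> sets (future M T a N)"
    "\<beta> < measure M {x \<in> space M. \<forall>E\<in>S. x \<in> meas_hull M T a N E}" by auto
  obtain B where B: "B \<in> sets (future M T a 0)"
    "{x \<in> space M. \<forall>E\<in>S. x \<in> meas_hull M T a N E} = preim M T N B"
    using N(1) future_shift[of a 0 N] by auto
  have BM: "B \<in> sets M" using B(1) future_sub[OF da] by blast
  have "\<beta> \<le> measure M B" using N(2) measure_preim[OF BM, of N] unfolding B(2) by simp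
  then obtain J2 where J2: "J2 \<subseteq> {..<n}" "shattered M T m k A B J2" "c * n - 1 \<le> card J2"
    using large[OF B(1)] by blast
  have fin2: "finite J2" by (rule finite_subset[OF J2(1)]) simp
  let ?K = "(\<lambda>j. N + m * j) ` J2"
  have inj: "inj_on (\<lambda>j. N + m * j) J2" using m by (intro inj_onI) simp
  have "shattered M T 1 k A (space M) (J \<union> ?K)"
    unfolding shattered_def
  proof (intro allI impI)
    fix s assume s: "\<forall>j\<in>J \<union> ?K. s j \<in> {1..k}"
    let ?E = "pattern M T 1 A J s" and ?P = "pattern M T m A J2 (\<lambda>j. s (N + m * j))"
    have sJ: "\<forall>j\<in>J. s j \<in> {1..k}" and sJ2: "\<forall>j\<in>J2. s (N + m * j) \<in> {1..k}" using s by auto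
    have ES: "?E \<in> S"
      unfolding S_def
    proof (rule image_eqI)
      show "?E = pattern M T 1 A J (restrict s J)" by (simp add: pattern_def)
      show "restrict s J \<in> J \<rightarrow>\<^sub>E {1..k}" using sJ by auto
    qed
    have "0 < measure M (B \<inter> ?P)" using J2(2) sJ2 by (simp add: shattered_def)
    moreover have "preim M T N B \<subseteq> meas_hull M T a N ?E" using ES unfolding B(2)[symmetric] by blast
    ultimately have "0 < measure M (?E \<inter> preim M T N ?P)"
      using pattern_in_future[OF da A fin2 sJ2] by (intro measure_Int_preim_pos[OF da SE(1)[OF sJ] _ B(1)])
    also have "\<dots> \<le> measure M (space M \<inter> pattern M T 1 A (J \<union> ?K) s)"
    proof (rule finite_measure_mono)
      show "?E \<inter> preim M T N ?P \<subseteq> space M \<inter> pattern M T 1 A (J \<union> ?K) s"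
        by (auto simp: pattern_def preim_def funpow_add[THEN fun_cong, unfolded comp_apply, symmetric] add.commute)
      have "pattern M T 1 A (J \<union> ?K) s \<in> sets (future M T a 0)"
        using s J(1) fin2 by (intro pattern_in_future[OF da A]) auto
      then show "space M \<inter> pattern M T 1 A (J \<union> ?K) s \<in> sets M" using future_sub[OF da] by blast
    qed
    finally show "0 < measure M (space M \<inter> pattern M T 1 A (J \<union> ?K) s)" .
  qed
  moreover have "c * n - 1 \<le> card ((J \<union> ?K) \<inter> {N..N + m * n})"
  proof -
    have "?K \<subseteq> (J \<union> ?K) \<inter> {N..N + m * n}" using J2(1) by (auto intro: less_imp_le)
    then have "card ?K \<le> card ((J \<union> ?K) \<inter> {N..N + m * n})" by (intro card_mono) auto
    then show ?thesis using J2(3) by (simp add: card_image[OF inj])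
  qed
  ultimately show ?thesis using J(1) fin2
    by (intro exI[of _ "J \<union> ?K"] exI[of _ N]) auto
qed

text \<open>The letter of a point \<open>x\<close> is the set of all \<open>i\<close> with \<open>x \<in> A i\<close>, because the sets \<open>A i\<close> may overlap.
  The independence set is the union of the finite sets obtained by repeated extension, where
  the \<open>n\<close>-th step adds about \<open>c n\<close> times in an interval of length about \<open>m n\<close>.\<close>

theorem cpe_imp_independent:
  assumes cpe: "completely_positive_entropy M T" and k: "1 \<le> k"
  shows "F_independent_of_order M T F_pubd k"
  unfolding F_independent_of_order_def
proof (intro allI impI)
  fix A :: "nat \<Rightarrow> 'a set"
  assume A: "\<forall>i\<in>{1..k}. A i \<in> sets M \<and> measure M (A i) > 0"
  define a where "a x = {i\<in>{1..k}. x \<in> A i}" for x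
  have a_level: "a -` {u} \<inter> space M = {x \<in> space M. \<forall>i\<in>{1..k}. (x \<in> A i) = (i \<in> u)}" if "u \<subseteq> {1..k}" for u
  proof -
    have "a x = u \<longleftrightarrow> (\<forall>i\<in>{1..k}. (x \<in> A i) = (i \<in> u))" for x
      unfolding a_def set_eq_iff mem_Collect_eq using that by blast
    then show ?thesis by (simp add: vimage_def Int_def conj_commute)
  qed
  have a_range: "a ` space M \<subseteq> Pow {1..k}" by (auto simp: a_def)
  have a: "finite_var M a"
    unfolding finite_var_def discrete_var_def
  proof (intro conjI allI)
    show fin: "finite (a ` space M)" using a_range by (rule finite_subset) simp
    then show "countable (a ` space M)" by (rule countable_finite)
    fix u show "a -` {u} \<inter> space M \<in> sets M"
    proof (cases "u \<subseteq> {1..k}")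
      case True
      have "{x \<in> space M. \<forall>i\<in>{1..k}. (x \<in> A i) = (i \<in> u)} \<in> sets M"
      proof (rule sets.sets_Collect_finite_All')
        fix i assume i: "i \<in> {1..k}"
        have "{x \<in> space M. (x \<in> A i) = (i \<in> u)} = (if i \<in> u then A i else space M - A i)"
          using A i sets.sets_into_space[of "A i" M] by auto
        then show "{x \<in> space M. (x \<in> A i) = (i \<in> u)} \<in> sets M" using A i by auto
      qed (use k in auto)
      then show ?thesis using a_level[OF True] by simp
    next
      case False
      then have "a -` {u} \<inter> space M = {}" by (auto simp: a_def)
      then show ?thesis by (metis sets.empty_sets)
    qed
  qed
  note da = finite_var_discrete[OF a]
  have AF: "A i \<in> sets (future M T a 0)" if i: "i \<in> {1..k}" for i
  proof -
    have "A i = (\<Union>u\<in>{u. u \<subseteq> {1..k} \<and> i \<in> u}. preim M T 0 (a -` {u} \<inter> space M))"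
      using A i sets.sets_into_space[of "A i" M] by (auto simp: preim_def a_def)
    also have "\<dots> \<in> sets (future M T a 0)"
    proof (rule sets.finite_UN)
      show "finite {u. u \<subseteq> {1..k} \<and> i \<in> u}" by (rule finite_subset[of _ "Pow {1..k}"]) auto
      show "preim M T 0 (a -` {u} \<inter> space M) \<in> sets (future M T a 0)" for u
        unfolding sets_future by (rule sigma_sets.Basic) blast
    qed
    finally show ?thesis .
  qed
  have "eventually (\<lambda>N. {x \<in> space M. \<forall>E\<in>A ` {1..k}. x \<in> meas_hull M T a N E} \<in> sets (future M T a N) \<and>
    1 - 1 < measure M {x \<in> space M. \<forall>E\<in>A ` {1..k}. x \<in> meas_hull M T a N E}) sequentially"
    using A by (intro common_hull_large[OF cpe a]) auto
  then have "eventually (\<lambda>N. 0 < measure M {x \<in> space M. \<forall>i\<in>{1..k}. x \<in> meas_hull M T a N (A i)} \<and> 0 < N) sequentially"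
    using eventually_gt_at_top[of 0] by eventually_elim simp
  then have "\<exists>m. 0 < measure M {x \<in> space M. \<forall>i\<in>{1..k}. x \<in> meas_hull M T a m (A i)} \<and> 0 < m"
    by (rule eventually_happens'[OF sequentially_bot])
  then obtain m where m: "0 < m" "0 < measure M {x \<in> space M. \<forall>i\<in>{1..k}. x \<in> meas_hull M T a m (A i)}" by blast
  obtain p where p: "0 < p" "p < 1" "measure M (bad_set M T a m k A p) < 1"
    using bad_set_small_prob[OF da m(2)] by blast
  obtain c \<beta> :: real where c: "0 < c" and \<beta>: "\<beta> < 1" and large: "\<And>n D. D \<in> sets (future M T a 0) \<Longrightarrow> \<beta> \<le> measure M D \<Longrightarrow>
      \<exists>J. J \<subseteq> {..<n} \<and> shattered M T m k A D J \<and> c * real n - 1 \<le> real (card J)"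
    using exists_large_shattered[OF da AF p] by metis
  let ?good = "\<lambda>J. finite J \<and> shattered M T 1 k A (space M) J"
  have "\<exists>J. \<forall>n. ?good (J n) \<and> (J n \<subseteq> J (Suc n) \<and> (\<exists>N. c * real n - 1 \<le> real (card (J (Suc n) \<inter> {N..N + m * n}))))"
  proof (rule dependent_nat_choice)
    show "\<exists>J. ?good J"
    proof (intro exI[of _ "{}"] conjI)
      have "space M \<inter> {x \<in> space M. True} = space M" by auto
      then show "shattered M T 1 k A (space M) {}" by (simp add: shattered_def pattern_def prob_space)
    qed simp
  next
    fix J :: "nat set" and n assume "?good J"
    then show "\<exists>J'. ?good J' \<and> (J \<subseteq> J' \<and> (\<exists>N. c * real n - 1 \<le> real (card (J' \<inter> {N..N + m * n}))))"
      using extend_shattered[OF cpe a AF \<beta> large m(1), of J n] by blast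
  qed
  then obtain J where J: "\<And>n. finite (J n)" "\<And>n. shattered M T 1 k A (space M) (J n)" "\<And>n. J n \<subseteq> J (Suc n)"
    "\<And>n. \<exists>N. c * real n - 1 \<le> real (card (J (Suc n) \<inter> {N..N + m * n}))" by blast
  have "(\<Union>n. J n) \<in> Ind M T k A"
    using A by (intro Ind_of_patterns k J(1,2) incseq_SucI J(3)) auto
  moreover have "(\<Union>n. J n) \<in> F_pubd"
  proof (rule F_pubdI)
    \<comment> \<open>Once \<open>c n \<ge> 2\<close>, at least \<open>c n / 2\<close> of the at most \<open>2 m n\<close> times of the interval are hit.\<close>
    show "0 < c / (4 * m)" using c m(1) by simp
    fix N :: nat
    obtain n0 :: nat where n0: "2 / c < real n0" using reals_Archimedean2 by blast
    define n where "n = max 1 (max N n0)"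
    have n: "1 \<le> n" "N \<le> n" "2 / c < real n" using n0 by (auto simp: n_def)
    obtain b where b: "c * real n - 1 \<le> real (card (J (Suc n) \<inter> {b..b + m * n}))" using J(4) by blast
    have "card (J (Suc n) \<inter> {b..b + m * n}) \<le> card ((\<Union>n. J n) \<inter> {b..b + m * n})"
      by (intro card_mono) auto
    then have card: "c * real n - 1 \<le> real (card ((\<Union>n. J n) \<inter> {b..b + m * n}))" using b by simp
    have card_pos: "0 < real (card {b..b + m * n})" by (subst of_nat_0_less_iff) simp
    have "2 < c * n" using n(3) c by (simp add: field_simps)
    moreover have "c / (4 * m) * real (card {b..b + m * n}) \<le> c * n / 2"
    proof -
      have "1 \<le> m * n" using m(1) n(1) by (simp add: Suc_le_eq)
      then have "real (card {b..b + m * n}) \<le> real (2 * (m * n))" by (subst of_nat_le_iff) simp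
      then have "c / (4 * m) * real (card {b..b + m * n}) \<le> c / (4 * m) * real (2 * (m * n))"
        using c by (intro mult_left_mono) auto
      also have "\<dots> = c * n / 2" using m(1) by (simp add: field_simps)
      finally show ?thesis .
    qed
    ultimately have "c / (4 * m) * real (card {b..b + m * n}) \<le> real (card ((\<Union>n. J n) \<inter> {b..b + m * n}))"
      using card by linarith
    then have "c / (4 * m) \<le> real (card ((\<Union>n. J n) \<inter> {b..b + m * n})) / real (card {b..b + m * n})"
      by (simp only: pos_le_divide_eq[OF card_pos])
    moreover have "N \<le> card {b..b + m * n}"
    proof -
      have "1 * n \<le> m * n" using m(1) by (intro mult_le_mono1) simp
      then have "N \<le> Suc (m * n)" using n(2) by linarith
      then show ?thesis by simp
    qed
    ultimately show "\<exists>a b. a \<le> b \<and> N \<le> card {a..b} \<and>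
        c / (4 * m) \<le> real (card ((\<Union>n. J n) \<inter> {a..b})) / real (card {a..b})"
      by (intro exI[of _ b] exI[of _ "b + m * n"]) auto
  qed
  ultimately show "Ind M T k A \<inter> F_pubd \<noteq> {}" by blast
qed

end

theorem theorem6p2:
  fixes M :: "'a measure" and T :: "'a \<Rightarrow> 'a"
  assumes "mds M T"
  shows "(F_independent M T F_pubd \<longleftrightarrow> F_independent_of_order M T F_pubd 2) \<and>
         (F_independent_of_order M T F_pubd 2 \<longleftrightarrow> completely_positive_entropy M T)"
proof -
  interpret mds M T by (rule assms)
  show ?thesis
    using independent_order_2_imp_cpe cpe_imp_independent unfolding F_independent_def by fastforce
qed

end
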